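(* Let $B$ be a thin Blaschke product on the unit disk $\mathbb{D}$, and suppose there is a finite subset $F$ of $Z(B')=\{z\in\mathbb{D}: B'(z)=0\}$ such that: (i) the restriction $B|_{Z(B')\setminus F}$ is injective; (ii) each point of $Z(B')\setminus F$ is a simple zero of $B'$. Then $M_B$ has no nontrivial reducing subspace (that is, $M_B$ is irreducible) on the Bergman space $L^2_a(\mathbb{D})$; in this case $\mathcal{V}^*(B)$ is trivial, i.e. $\mathcal{V}^*(B)=\mathbb{C}I$.
   Context: $L^2_a(\mathbb{D})$ is the Bergman space of holomorphic functions on the open unit disk $\mathbb{D}$ that are square integrable with respect to normalized area measure. For a bounded holomorphic $\phi$ on $\mathbb{D}$, $M_\phi$ is the operator of multiplication by $\phi$ on $L^2_a(\mathbb{D})$. A closed subspace $M$ is reducing for $M_\phi$ if $M_\phi M\subseteq M$ and $M_\phi^*M\subseteq M$; it is nontrivial if $M\ne\{0\}$ and $M\neq L^2_a(\mathbb{D})$. $\mathcal{V}^*(\phi)=\{M_\phi,M_\phi^*\}'$ is the von Neumann algebra of bounded operators on $L^2_a(\mathbb{D})$ commuting with both $M_\phi$ and $M_\phi^*$. A thin Blaschke product is an infinite Blaschke product $B$ whose zero sequence $\{z_n\}$ satisfies $\lim_{k\to\infty}\prod_{j\ne k} d(z_j,z_k)=1$, where $d(z,\lambda)=\left|\frac{\lambda-z}{1-\overline{\lambda}z}\right|$ is the pseudohyperbolic distance. *)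

theory Defs
  imports "HOL-Complex_Analysis.Complex_Analysis"
begin

abbreviation unit_disk :: "complex set" (\<open>\<bbbD>\<close>) where
  "\<bbbD> \<equiv> ball 0 1"

section \<open>The Bergman space\<close>

text \<open>
  A function on the disk is represented by its extension by zero to the whole plane, so that
  equality of elements is equality on the disk.
\<close>

definition bergman_functions :: "(complex \<Rightarrow> complex) set" where
  "bergman_functions = {f. f holomorphic_on \<bbbD> \<and>
     set_integrable lborel \<bbbD> (\<lambda>z. (cmod (f z))\<^sup>2) \<and> (\<forall>z. z \<notin> \<bbbD> \<longrightarrow> f z = 0)}"

lemma bergman_functions_zero: "(\<lambda>_. 0) \<in> bergman_functions"
  by (simp add: bergman_functions_def set_integrable_def)

lemma borel_measurable_holomorphic_on_disk:
  assumes "f holomorphic_on \<bbbD>"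
  shows "set_borel_measurable lborel \<bbbD> f"
  using borel_measurable_continuous_on_indicator[OF _ holomorphic_on_imp_continuous_on[OF assms]]
  by (simp add: set_borel_measurable_def)

lemma set_integrable_mult_cnj:
  assumes "f \<in> bergman_functions" "g \<in> bergman_functions"
  shows "set_integrable lborel \<bbbD> (\<lambda>z. f z * cnj (g z))"
proof (rule set_integrable_bound)
  show "set_integrable lborel \<bbbD> (\<lambda>z. (cmod (f z))\<^sup>2 + (cmod (g z))\<^sup>2)"
    using assms by (intro set_integral_add) (auto simp: bergman_functions_def)
  have "continuous_on \<bbbD> (\<lambda>z. f z * cnj (g z))"
    using assms by (intro continuous_intros)
      (auto simp: bergman_functions_def holomorphic_on_imp_continuous_on)
  from borel_measurable_continuous_on_indicator[OF _ this]
  show "set_borel_measurable lborel \<bbbD> (\<lambda>z. f z * cnj (g z))"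
    by (simp add: set_borel_measurable_def)
  have "norm (f z * cnj (g z)) \<le> norm ((cmod (f z))\<^sup>2 + (cmod (g z))\<^sup>2)" for z
    using sum_squares_bound[of "cmod (f z)" "cmod (g z)"]
      mult_nonneg_nonneg[of "cmod (f z)" "cmod (g z)"]
    by (simp add: norm_mult del: mult_nonneg_nonneg)
  then show "AE z in lborel. z \<in> \<bbbD> \<longrightarrow>
      norm (f z * cnj (g z)) \<le> norm ((cmod (f z))\<^sup>2 + (cmod (g z))\<^sup>2)"
    by simp
qed

lemma bergman_functions_add:
  assumes "f \<in> bergman_functions" "g \<in> bergman_functions"
  shows "(\<lambda>z. f z + g z) \<in> bergman_functions"
proof -
  have "set_integrable lborel \<bbbD> (\<lambda>z. (cmod (f z + g z))\<^sup>2)"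
  proof (rule set_integrable_bound)
    show "set_integrable lborel \<bbbD> (\<lambda>z. 2 * (cmod (f z))\<^sup>2 + 2 * (cmod (g z))\<^sup>2)"
      using assms by (intro set_integral_add set_integrable_mult_right)
        (auto simp: bergman_functions_def)
    have "continuous_on \<bbbD> (\<lambda>z. (cmod (f z + g z))\<^sup>2)"
      using assms by (intro continuous_intros)
        (auto simp: bergman_functions_def holomorphic_on_imp_continuous_on)
    from borel_measurable_continuous_on_indicator[OF _ this]
    show "set_borel_measurable lborel \<bbbD> (\<lambda>z. (cmod (f z + g z))\<^sup>2)"
      by (simp add: set_borel_measurable_def)
    have "norm ((cmod (f z + g z))\<^sup>2) \<le> norm (2 * (cmod (f z))\<^sup>2 + 2 * (cmod (g z))\<^sup>2)" for z
    proof -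
      have "(cmod (f z + g z))\<^sup>2 \<le> (cmod (f z) + cmod (g z))\<^sup>2"
        by (intro power_mono norm_triangle_ineq norm_ge_zero)
      then show ?thesis
        using sum_squares_bound[of "cmod (f z)" "cmod (g z)"] by (simp add: power2_sum)
    qed
    then show "AE z in lborel. z \<in> \<bbbD> \<longrightarrow>
        norm ((cmod (f z + g z))\<^sup>2) \<le> norm (2 * (cmod (f z))\<^sup>2 + 2 * (cmod (g z))\<^sup>2)"
      by simp
  qed
  with assms show ?thesis
    by (auto simp: bergman_functions_def intro: holomorphic_intros)
qed

lemma bergman_functions_scale:
  assumes "f \<in> bergman_functions"
  shows "(\<lambda>z. c * f z) \<in> bergman_functions"
  using assms
  by (auto simp: bergman_functions_def norm_mult power_mult_distrib intro!: holomorphic_intros)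

typedef bergman = bergman_functions
  using bergman_functions_zero by blast

setup_lifting type_definition_bergman

instantiation bergman :: ab_group_add
begin

lift_definition zero_bergman :: bergman is "\<lambda>_. 0"
  by (rule bergman_functions_zero)

lift_definition plus_bergman :: "bergman \<Rightarrow> bergman \<Rightarrow> bergman" is "\<lambda>f g z. f z + g z"
  by (rule bergman_functions_add)

lift_definition uminus_bergman :: "bergman \<Rightarrow> bergman" is "\<lambda>f z. - f z"
  using bergman_functions_scale[of _ "-1"] by simp

definition minus_bergman :: "bergman \<Rightarrow> bergman \<Rightarrow> bergman" where
  "minus_bergman f g = f + - g"

instance
  by standard (transfer; auto simp: minus_bergman_def algebra_simps)+

end

lift_definition scaleC :: "complex \<Rightarrow> bergman \<Rightarrow> bergman" (infixr \<open>*\<^sub>C\<close> 75)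
  is "\<lambda>c f z. c * f z"
  by (rule bergman_functions_scale)

interpretation bergman: vector_space scaleC
  by standard (transfer; auto simp: algebra_simps)+

text \<open>The factor \<open>1 / pi\<close> normalizes the area measure of the disk.\<close>

lift_definition cinner :: "bergman \<Rightarrow> bergman \<Rightarrow> complex"
  is "\<lambda>f g. (1 / complex_of_real pi) * (LINT z:\<bbbD>|lborel. f z * cnj (g z))" .

lemma cinner_add_left: "cinner (f + g) h = cinner f h + cinner g h"
  by transfer (simp add: distrib_right set_integrable_mult_cnj set_integral_add distrib_left
      del: times_divide_eq_left add_divide_distrib)

lemma cinner_scaleC_left: "cinner (c *\<^sub>C f) g = c * cinner f g"
  by transfer (simp add: mult.assoc)

lemma cinner_commute: "cinner g f = cnj (cinner f g)"
proof -
  have "(LINT z:\<bbbD>|lborel. Rep_bergman g z * cnj (Rep_bergman f z))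
      = (LINT z|lborel. cnj (indicator \<bbbD> z *\<^sub>R (Rep_bergman f z * cnj (Rep_bergman g z))))"
    unfolding set_lebesgue_integral_def
    by (rule Bochner_Integration.integral_cong) (simp_all add: mult.commute)
  then show ?thesis
    by (simp add: cinner.rep_eq set_lebesgue_integral_def del: complex_cnj_scaleR complex_cnj_mult)
qed

lemma cinner_self:
  "cinner f f = of_real ((LINT z:\<bbbD>|lborel. (cmod (Rep_bergman f z))\<^sup>2) / pi)"
proof -
  have *: "indicator \<bbbD> z *\<^sub>R (Rep_bergman f z * cnj (Rep_bergman f z))
      = complex_of_real (indicator \<bbbD> z *\<^sub>R (cmod (Rep_bergman f z))\<^sup>2)" for z
    by (simp add: scaleR_conv_of_real flip: complex_norm_square)
  show ?thesis
    unfolding cinner.rep_eq set_lebesgue_integral_def * integral_complex_of_real by simp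
qed

lemma cinner_self_eq_0:
  assumes "cinner f f = 0"
  shows "f = 0"
proof (rule ccontr)
  define F where "F = Rep_bergman f"
  have F: "F \<in> bergman_functions"
    using Rep_bergman by (simp add: F_def)
  assume "f \<noteq> 0"
  then obtain w where w: "F w \<noteq> 0"
    unfolding F_def by transfer auto
  with F have "w \<in> \<bbbD>"
    by (auto simp: bergman_functions_def)
  have "(LINT z|lborel. indicator \<bbbD> z *\<^sub>R (cmod (F z))\<^sup>2) = 0"
    using assms by (simp add: cinner_self F_def set_lebesgue_integral_def)
  moreover have "integrable lborel (\<lambda>z. indicator \<bbbD> z *\<^sub>R (cmod (F z))\<^sup>2)"
    using F by (simp add: bergman_functions_def set_integrable_def)
  ultimately have "AE z in lborel. indicator \<bbbD> z *\<^sub>R (cmod (F z))\<^sup>2 = 0"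
    by (subst (asm) integral_nonneg_eq_0_iff_AE) auto
  then have ae: "AE z in lebesgue. z \<notin> {z \<in> \<bbbD>. F z \<noteq> 0}"
    by (intro AE_completion) (auto elim!: eventually_mono simp: indicator_def)
  have op: "open {z \<in> \<bbbD>. F z \<noteq> 0}"
    using F continuous_open_preimage[of \<bbbD> F "- {0}"]
    by (auto simp: bergman_functions_def vimage_def Int_def holomorphic_on_imp_continuous_on)
  then have "{z \<in> \<bbbD>. F z \<noteq> 0} \<in> sets lebesgue"
    by (intro lmeasurable_open fmeasurableD bounded_subset[OF bounded_ball[of 0 1]]) auto
  with ae have "negligible {z \<in> \<bbbD>. F z \<noteq> 0}"
    by (simp add: negligible_iff_null_sets AE_iff_null_sets)
  moreover have "{z \<in> \<bbbD>. F z \<noteq> 0} \<noteq> {}"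
    using w \<open>w \<in> \<bbbD>\<close> by blast
  ultimately show False
    using op open_not_negligible by blast
qed

instantiation bergman :: real_vector
begin

definition scaleR_bergman :: "real \<Rightarrow> bergman \<Rightarrow> bergman" where
  "scaleR_bergman r f = complex_of_real r *\<^sub>C f"

instance
  by standard (simp_all add: scaleR_bergman_def bergman.scale_right_distrib
      bergman.scale_left_distrib)

end

text \<open>
  The real inner product is the real part of the complex one; its norm is the Bergman norm, and
  it provides the topology of the space.
\<close>

instantiation bergman :: real_inner
begin

definition inner_bergman :: "bergman \<Rightarrow> bergman \<Rightarrow> real" where
  "inner_bergman f g = Re (cinner f g)"

definition norm_bergman :: "bergman \<Rightarrow> real" where
  "norm_bergman f = sqrt (inner f f)"

definition dist_bergman :: "bergman \<Rightarrow> bergman \<Rightarrow> real" where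
  "dist_bergman f g = norm (f - g)"

definition sgn_bergman :: "bergman \<Rightarrow> bergman" where
  "sgn_bergman f = f /\<^sub>R norm f"

definition uniformity_bergman :: "(bergman \<times> bergman) filter" where
  "uniformity_bergman = (INF e\<in>{0<..}. principal {(f, g). dist f g < e})"

definition open_bergman :: "bergman set \<Rightarrow> bool" where
  "open_bergman U \<longleftrightarrow> (\<forall>f\<in>U. eventually (\<lambda>(f', g). f' = f \<longrightarrow> g \<in> U) uniformity)"

instance
proof
  fix f g h :: bergman and r :: real
  show "inner f g = inner g f"
    by (simp add: inner_bergman_def cinner_commute[of f g])
  show "inner (f + g) h = inner f h + inner g h"
    by (simp add: inner_bergman_def cinner_add_left)
  show "inner (r *\<^sub>R f) g = r * inner f g"
    by (simp add: inner_bergman_def scaleR_bergman_def cinner_scaleC_left)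
  show "0 \<le> inner f f"
    by (auto simp: inner_bergman_def cinner_self set_lebesgue_integral_def
        intro!: divide_nonneg_pos integral_nonneg_AE)
  show "inner f f = 0 \<longleftrightarrow> f = 0"
  proof
    assume "inner f f = 0"
    then have "cinner f f = 0"
      by (simp add: inner_bergman_def cinner_self)
    then show "f = 0"
      by (rule cinner_self_eq_0)
  next
    assume "f = 0"
    then show "inner f f = 0"
      using cinner_scaleC_left[of 0 f f] by (simp add: inner_bergman_def)
  qed
qed (rule norm_bergman_def dist_bergman_def sgn_bergman_def uniformity_bergman_def
      open_bergman_def)+

end

section \<open>Operators on the Bergman space\<close>

definition bounded_operator :: "(bergman \<Rightarrow> bergman) \<Rightarrow> bool" where
  "bounded_operator T \<longleftrightarrow> bounded_linear T \<and> (\<forall>c f. T (c *\<^sub>C f) = c *\<^sub>C T f)"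

text \<open>
  The Hilbert space adjoint: the defining equation has at most one solution, and it has one
  whenever \<open>T\<close> is a bounded operator.
\<close>

definition cadjoint :: "(bergman \<Rightarrow> bergman) \<Rightarrow> bergman \<Rightarrow> bergman" where
  "cadjoint T = (THE S. \<forall>f g. cinner (T f) g = cinner f (S g))"

text \<open>
  The product \<open>\<phi> f\<close> is an element of the Bergman space when \<open>\<phi>\<close> is bounded and holomorphic on
  the disk; otherwise \<open>mult_op \<phi>\<close> is unspecified. The values of \<open>\<phi>\<close> outside the disk are
  irrelevant, as \<open>f\<close> vanishes there.
\<close>

definition mult_op :: "(complex \<Rightarrow> complex) \<Rightarrow> bergman \<Rightarrow> bergman" where
  "mult_op \<phi> f = Abs_bergman (\<lambda>z. \<phi> z * Rep_bergman f z)"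

definition reducing :: "(bergman \<Rightarrow> bergman) \<Rightarrow> bergman set \<Rightarrow> bool" where
  "reducing T M \<longleftrightarrow> bergman.subspace M \<and> closed M \<and> T ` M \<subseteq> M \<and> cadjoint T ` M \<subseteq> M"

definition nontrivial :: "bergman set \<Rightarrow> bool" where
  "nontrivial M \<longleftrightarrow> M \<noteq> {0} \<and> M \<noteq> UNIV"

definition von_Neumann_algebra :: "(complex \<Rightarrow> complex) \<Rightarrow> (bergman \<Rightarrow> bergman) set"
    (\<open>\<V>\<^sup>*\<close>) where
  "\<V>\<^sup>* \<phi> = {T. bounded_operator T \<and> T \<circ> mult_op \<phi> = mult_op \<phi> \<circ> T \<and>
     T \<circ> cadjoint (mult_op \<phi>) = cadjoint (mult_op \<phi>) \<circ> T}"

section \<open>Thin Blaschke products\<close>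

definition pseudohyperbolic_dist :: "complex \<Rightarrow> complex \<Rightarrow> real" where
  "pseudohyperbolic_dist z w = cmod ((w - z) / (1 - cnj w * z))"

definition blaschke_factor :: "complex \<Rightarrow> complex \<Rightarrow> complex" where
  "blaschke_factor a z =
     (if a = 0 then z else (of_real (cmod a) / a) * ((a - z) / (1 - cnj a * z)))"

text \<open>
  The sequence \<open>a\<close> lists the zeros with multiplicity (zero itself may occur among them), and \<open>c\<close>
  is the customary unimodular constant. Only the values of \<open>B\<close> on the disk are prescribed.
\<close>

definition infinite_blaschke_product :: "(complex \<Rightarrow> complex) \<Rightarrow> (nat \<Rightarrow> complex) \<Rightarrow> bool" where
  "infinite_blaschke_product B a \<longleftrightarrow>
     range a \<subseteq> \<bbbD> \<and> summable (\<lambda>n. 1 - cmod (a n)) \<and>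
     (\<exists>c. cmod c = 1 \<and> (\<forall>z\<in>\<bbbD>. B z = c * (\<Prod>n. blaschke_factor (a n) z)))"

definition thin_blaschke_product :: "(complex \<Rightarrow> complex) \<Rightarrow> bool" where
  "thin_blaschke_product B \<longleftrightarrow> (\<exists>a. infinite_blaschke_product B a \<and>
     (\<lambda>k. \<Prod>j. if j = k then 1 else pseudohyperbolic_dist (a j) (a k)) \<longlonglongrightarrow> 1)"

definition critical_points :: "(complex \<Rightarrow> complex) \<Rightarrow> complex set" where
  "critical_points B = {z \<in> \<bbbD>. deriv B z = 0}"

end

theory Submission
  imports Defs
begin

text \<open>
  Thinness gives, over every disk of radius less than 1, infinitely many holomorphic sections of
  \<open>B\<close> covering the preimage up to a compact set. An operator \<open>T\<close> commuting with \<open>M\<^sub>B\<close> and its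
  adjoint acts on the fibres of \<open>B\<close> through a matrix that is constant along sections and has
  square summable columns. Two points of a fibre are equivalent if exchanging them leaves the matrix
  invariant. A simple critical point which is alone in its fibre makes the two sheets meeting there
  equivalent, because monodromy exchanges them and fixes all others. If the classes were finite,
  a symmetric function of the class would therefore be locally a function of \<open>B\<close> outside
  finitely many values; far from the compact part it is a function of \<open>B\<close> over a whole disk
  containing these values, hence globally, which contradicts that distinct classes can be separated.
  So the classes are infinite, square summability kills the off-diagonal entries, and the diagonal
  one is constant because the set of regular points is connected.
\<close>

section \<open>Area integrals in the plane\<close>

text \<open>The matrix is constant along sections by a separation of variables. The fibre sum that
  relates \<open>T\<close> to its adjoint is holomorphic in one base point and antiholomorphic in a
  second one. It vanishes for equal base points, hence for all, and testing it with functions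
  concentrated at single points of a fibre shows that the entries depend on neither base point. The
  obstacle is that nothing is known about branching over the exceptional values. Loops around them
  are therefore never followed. A fibre has only finitely many points in the compact part, so if
  classes were finite, some class would lie entirely on sections over a whole disk around these
  values. From that disk the symmetric function is continued outward, where only simple critical
  values occur and boundedness removes the singularities. Equivalence is defined by transpositions
  rather than through a monodromy group: transitivity is then a conjugation, and entries repeat
  along a class without knowing which permutations come from loops.\<close>

definition complex_of_vec :: "real^2 \<Rightarrow> complex" where
  "complex_of_vec v = Complex (v $ 1) (v $ 2)"

definition vec_of_complex :: "complex \<Rightarrow> real^2" where
  "vec_of_complex z = vector [Re z, Im z]"

lemma vec_of_complex_inverse [simp]: "complex_of_vec (vec_of_complex z) = z"
  by (simp add: complex_of_vec_def vec_of_complex_def)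

lemma complex_of_vec_inverse [simp]: "vec_of_complex (complex_of_vec v) = v"
  by (simp add: complex_of_vec_def vec_of_complex_def vec_eq_iff forall_2)

lemma bounded_linear_complex_of_vec: "bounded_linear complex_of_vec"
  by (intro linear_conv_bounded_linear[THEN iffD1] linearI)
    (auto simp: complex_of_vec_def complex_eq_iff)

lemma bounded_linear_vec_of_complex: "bounded_linear vec_of_complex"
  by (intro linear_conv_bounded_linear[THEN iffD1] linearI)
    (auto simp: vec_of_complex_def vec_eq_iff forall_2)

lemma continuous_complex_of_vec [continuous_intros]:
  "continuous_on A f \<Longrightarrow> continuous_on A (\<lambda>x. complex_of_vec (f x))"
  by (rule bounded_linear.continuous_on[OF bounded_linear_complex_of_vec])

lemma continuous_vec_of_complex [continuous_intros]:
  "continuous_on A f \<Longrightarrow> continuous_on A (\<lambda>x. vec_of_complex (f x))"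
  by (rule bounded_linear.continuous_on[OF bounded_linear_vec_of_complex])

lemma measurable_complex_of_vec [measurable]: "complex_of_vec \<in> borel_measurable borel"
  by (intro borel_measurable_continuous_onI continuous_intros)

lemma measurable_vec_of_complex [measurable]: "vec_of_complex \<in> borel_measurable borel"
  by (intro borel_measurable_continuous_onI continuous_intros)

text \<open>Lebesgue measure is determined by boxes, and the coordinate map carries boxes to boxes
  of equal volume. Integrals over the plane thus become integrals over \<open>real^2\<close>, where
  Jacobian determinants make sense.\<close>

lemma distr_complex_of_vec: "distr lborel borel complex_of_vec = lborel"
proof (rule sym, rule lborel_eqI)
  fix l u :: complex
  assume le: "\<And>b. b \<in> Basis \<Longrightarrow> l \<bullet> b \<le> u \<bullet> b"
  have vim: "complex_of_vec -` box l u = box (vec_of_complex l) (vec_of_complex u)"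
    by (auto simp: complex_of_vec_def vec_of_complex_def mem_box_cart forall_2 in_box_complex_iff)
  have "emeasure lborel (complex_of_vec -` box l u) = ennreal (\<Prod>b\<in>Basis. (vec_of_complex u - vec_of_complex l) \<bullet> b)"
    unfolding vim using le
    using le[of 1] le[of \<i>]
    by (intro emeasure_lborel_box)
      (auto simp: Basis_vec_def vec_of_complex_def inner_axis UNIV_2 Basis_complex_def)
  also have "(\<Prod>b\<in>Basis. (vec_of_complex u - vec_of_complex l) \<bullet> b) = (\<Prod>b\<in>Basis. (u - l) \<bullet> b)"
    by (simp add: Basis_complex_def Basis_vec_def UNIV_2 vec_of_complex_def inner_axis axis_eq_axis)
  finally show "emeasure (distr lborel borel complex_of_vec) (box l u) = ennreal (\<Prod>b\<in>Basis. (u - l) \<bullet> b)"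
    by (simp add: emeasure_distr)
qed simp

lemma complex_integrable_of_real_iff:
  "integrable M (\<lambda>x. complex_of_real (f x)) \<longleftrightarrow> integrable M f"
  using integrable_Re[of M "\<lambda>x. complex_of_real (f x)"] by auto

lemma lborel_integral_complex_of_vec:
  fixes f :: "complex \<Rightarrow> 'a :: {banach, second_countable_topology}"
  assumes [measurable]: "f \<in> borel_measurable borel"
  shows "integrable lborel f \<longleftrightarrow> integrable lborel (\<lambda>v. f (complex_of_vec v))"
    and "integral\<^sup>L lborel f = (LINT v|lborel. f (complex_of_vec v))"
  by (subst distr_complex_of_vec[symmetric], simp add: integrable_distr_eq integral_distr)+

lemma integrable_complex_vec_iff:
  "integrable M f \<longleftrightarrow> integrable M (\<lambda>x. vec_of_complex (f x))"
  using integrable_bounded_linear[OF bounded_linear_complex_of_vec, of M "\<lambda>x. vec_of_complex (f x)"]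
    integrable_bounded_linear[OF bounded_linear_vec_of_complex, of M f] by auto

lemma integral_vec_of_complex:
  "vec_of_complex (integral\<^sup>L M f) = (LINT x|M. vec_of_complex (f x))"
proof -
  have "\<forall>z. complex_of_vec (vec_of_complex z) = z"
    by simp
  then show ?thesis
    using integral_bounded_linear'[OF bounded_linear_vec_of_complex bounded_linear_complex_of_vec, of M f]
    by argo
qed

lemma det_complex_mult:
  "det (matrix (\<lambda>v. vec_of_complex (c * complex_of_vec v))) = (cmod c)\<^sup>2"
  by (simp add: det_2 matrix_def vec_of_complex_def complex_of_vec_def axis_def cmod_power2)
    (simp add: power2_eq_square)

lemma vec_of_complex_scaleR: "vec_of_complex (r *\<^sub>R z) = r *\<^sub>R vec_of_complex z"
  by (rule linear_scale[OF bounded_linear.linear[OF bounded_linear_vec_of_complex]])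

text \<open>By the Cauchy-Riemann equations the real Jacobian determinant of \<open>g\<close> is the
  squared modulus of \<open>deriv g\<close>. Continuity of \<open>f\<close> makes both integrands
  Borel measurable, so that integrals over \<open>lborel\<close> and \<open>lebesgue\<close> agree
  and the formula in \<open>real^2\<close> can be transported.\<close>

proposition complex_change_of_variables:
  fixes f g :: "complex \<Rightarrow> complex"
  assumes S: "open S" and g: "g holomorphic_on S" and inj: "inj_on g S"
    and f: "continuous_on (g ` S) f"
  shows "set_integrable lborel (g ` S) f \<longleftrightarrow>
      set_integrable lborel S (\<lambda>z. (cmod (deriv g z))\<^sup>2 *\<^sub>R f (g z))" (is ?thesis1)
    and "set_integrable lborel (g ` S) f \<Longrightarrow> (LINT z:g ` S|lborel. f z) =
      (LINT z:S|lborel. (cmod (deriv g z))\<^sup>2 *\<^sub>R f (g z))" (is "_ \<Longrightarrow> ?thesis2")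
proof -
  have op: "open (g ` S)"
    using open_mapping_thm3[OF g S inj] .
  define T where "T = vec_of_complex ` S"
  have T_vim: "T = complex_of_vec -` S"
    unfolding T_def using image_iff[of _ vec_of_complex S] by (auto intro: rev_image_eqI)
  have "open T"
    unfolding T_vim by (intro open_vimage S continuous_intros)
  define G where "G = (\<lambda>v. vec_of_complex (g (complex_of_vec v)))"
  define G' where "G' = (\<lambda>v x. vec_of_complex (deriv g (complex_of_vec v) * complex_of_vec x))"
  define h where "h = (\<lambda>v. vec_of_complex (f (complex_of_vec v)))"
  have GT: "G ` T = complex_of_vec -` (g ` S)"
    unfolding T_def G_def image_image
    by (auto simp: image_iff) (metis complex_of_vec_inverse)
  have derG: "(G has_derivative G' v) (at v within T)" if "v \<in> T" for v
  proof -
    have "(g has_derivative (*) (deriv g (complex_of_vec v))) (at (complex_of_vec v))"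
      using holomorphic_derivI[OF g S] that T_vim has_field_derivative_def by blast
    then have "((\<lambda>v. g (complex_of_vec v)) has_derivative (\<lambda>x. deriv g (complex_of_vec v) * complex_of_vec x)) (at v within T)"
      using has_derivative_compose[OF bounded_linear_imp_has_derivative[OF bounded_linear_complex_of_vec]]
      by blast
    then show ?thesis
      unfolding G_def G'_def
      by (rule bounded_linear.has_derivative[OF bounded_linear_vec_of_complex])
  qed
  have injG: "inj_on G T"
    using inj unfolding G_def T_def inj_on_def by (auto) (metis vec_of_complex_inverse)
  have T_leb: "T \<in> sets lebesgue"
    using \<open>open T\<close> by (intro sets_completionI_sets) simp
  have detG: "\<bar>det (matrix (G' v))\<bar> = (cmod (deriv g (complex_of_vec v)))\<^sup>2" for v
    unfolding G'_def det_complex_mult by simp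
  note cov = has_absolute_integral_change_of_variables[OF T_leb derG injG, of h, unfolded detG]
  have f1: "(\<lambda>z. indicator (g ` S) z *\<^sub>R f z) \<in> borel_measurable borel"
    using borel_measurable_continuous_on_indicator[OF _ f] op by simp
  have cont2: "continuous_on S (\<lambda>z. (cmod (deriv g z))\<^sup>2 *\<^sub>R f (g z))"
    by (intro continuous_intros continuous_on_compose2[OF f] holomorphic_on_imp_continuous_on[OF g]
        holomorphic_on_imp_continuous_on[OF holomorphic_deriv[OF g S]]) auto
  have f2: "(\<lambda>z. indicator S z *\<^sub>R ((cmod (deriv g z))\<^sup>2 *\<^sub>R f (g z))) \<in> borel_measurable borel"
    using borel_measurable_continuous_on_indicator[OF _ cont2] S by simp
  have ind1: "indicator (g ` S) (complex_of_vec v) = (indicator (G ` T) v :: real)" for v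
    unfolding GT by (simp add: indicator_def)
  have ind2: "indicator S (complex_of_vec v) = (indicator T v :: real)" for v
    unfolding T_vim by (simp add: indicator_def)
  have A: "set_integrable lborel (g ` S) f \<longleftrightarrow> h absolutely_integrable_on (G ` T)"
    and A': "vec_of_complex (LINT z:g ` S|lborel. f z) = (LINT v:G ` T|lebesgue. h v)"
  proof -
    have m: "(\<lambda>v. indicator (G ` T) v *\<^sub>R h v) \<in> borel_measurable lborel"
      using measurable_compose[OF measurable_complex_of_vec f1] measurable_vec_of_complex
      unfolding ind1 h_def vec_of_complex_scaleR[symmetric] by simp
    show "set_integrable lborel (g ` S) f \<longleftrightarrow> h absolutely_integrable_on (G ` T)"
      unfolding set_integrable_def lborel_integral_complex_of_vec(1)[OF f1] ind1
        integrable_completion[OF m]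
      by (subst integrable_complex_vec_iff) (simp add: h_def vec_of_complex_scaleR)
    show "vec_of_complex (LINT z:g ` S|lborel. f z) = (LINT v:G ` T|lebesgue. h v)"
      unfolding set_lebesgue_integral_def lborel_integral_complex_of_vec(2)[OF f1] ind1
        integral_completion[OF m]
      unfolding integral_vec_of_complex vec_of_complex_scaleR h_def 
      by simp
  qed
  have B: "set_integrable lborel S (\<lambda>z. (cmod (deriv g z))\<^sup>2 *\<^sub>R f (g z)) \<longleftrightarrow>
      (\<lambda>v. (cmod (deriv g (complex_of_vec v)))\<^sup>2 *\<^sub>R h (G v)) absolutely_integrable_on T"
    and B': "vec_of_complex (LINT z:S|lborel. (cmod (deriv g z))\<^sup>2 *\<^sub>R f (g z)) =
       (LINT v:T|lebesgue. (cmod (deriv g (complex_of_vec v)))\<^sup>2 *\<^sub>R h (G v))"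
  proof -
    have m: "(\<lambda>v. indicator T v *\<^sub>R (cmod (deriv g (complex_of_vec v)))\<^sup>2 *\<^sub>R h (G v)) \<in> borel_measurable lborel"
      using measurable_compose[OF measurable_complex_of_vec f2] measurable_vec_of_complex
      unfolding ind2 h_def G_def vec_of_complex_inverse vec_of_complex_scaleR[symmetric] by simp
    show "set_integrable lborel S (\<lambda>z. (cmod (deriv g z))\<^sup>2 *\<^sub>R f (g z)) \<longleftrightarrow>
      (\<lambda>v. (cmod (deriv g (complex_of_vec v)))\<^sup>2 *\<^sub>R h (G v)) absolutely_integrable_on T"
      unfolding set_integrable_def lborel_integral_complex_of_vec(1)[OF f2] ind2
        integrable_completion[OF m]
      by (subst integrable_complex_vec_iff) (simp add: h_def G_def vec_of_complex_scaleR)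
    show "vec_of_complex (LINT z:S|lborel. (cmod (deriv g z))\<^sup>2 *\<^sub>R f (g z)) =
       (LINT v:T|lebesgue. (cmod (deriv g (complex_of_vec v)))\<^sup>2 *\<^sub>R h (G v))"
      unfolding set_lebesgue_integral_def lborel_integral_complex_of_vec(2)[OF f2] ind2
        integral_completion[OF m]
      unfolding integral_vec_of_complex vec_of_complex_scaleR h_def G_def vec_of_complex_inverse
      by simp
  qed
  show 1: ?thesis1
    unfolding A B using cov by blast
  show ?thesis2 if i: "set_integrable lborel (g ` S) f"
  proof -
    have h: "h absolutely_integrable_on (G ` T)"
      using i A by simp
    then have h': "(\<lambda>v. (cmod (deriv g (complex_of_vec v)))\<^sup>2 *\<^sub>R h (G v)) absolutely_integrable_on T"
      and eq: "integral T (\<lambda>v. (cmod (deriv g (complex_of_vec v)))\<^sup>2 *\<^sub>R h (G v)) = integral (G ` T) h"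
      using cov[of "integral (G ` T) h"] by auto
    have "vec_of_complex (LINT z:g ` S|lborel. f z)
        = vec_of_complex (LINT z:S|lborel. (cmod (deriv g z))\<^sup>2 *\<^sub>R f (g z))"
      unfolding A' B' set_lebesgue_integral_eq_integral(2)[OF h]
        set_lebesgue_integral_eq_integral(2)[OF h'] eq ..
    then show ?thesis
      by (metis vec_of_complex_inverse)
  qed
qed

corollary real_change_of_variables:
  fixes f :: "complex \<Rightarrow> real"
  assumes S: "open S" and g: "g holomorphic_on S" and inj: "inj_on g S"
    and f: "continuous_on (g ` S) f" and int: "set_integrable lborel (g ` S) f"
  shows "set_integrable lborel S (\<lambda>z. (cmod (deriv g z))\<^sup>2 * f (g z))"
    and "(LINT z:g ` S|lborel. f z) = (LINT z:S|lborel. (cmod (deriv g z))\<^sup>2 * f (g z))"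
proof -
  have c: "continuous_on (g ` S) (\<lambda>z. complex_of_real (f z))"
    by (intro continuous_intros f)
  have i: "set_integrable lborel (g ` S) (\<lambda>z. complex_of_real (f z))"
  proof -
    have "integrable lborel (\<lambda>z. complex_of_real (indicator (g ` S) z *\<^sub>R f z))"
      using int unfolding complex_integrable_of_real_iff set_integrable_def .
    then show ?thesis
      by (simp add: set_integrable_def scaleR_conv_of_real)
  qed
  note cov = complex_change_of_variables[OF S g inj c]
  have "set_integrable lborel S (\<lambda>z. (cmod (deriv g z))\<^sup>2 *\<^sub>R complex_of_real (f (g z)))"
    using cov(1) i by simp
  then have "integrable lborel (\<lambda>z. complex_of_real (indicator S z * ((cmod (deriv g z))\<^sup>2 * f (g z))))"
    by (simp add: set_integrable_def scaleR_conv_of_real)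
  then show "set_integrable lborel S (\<lambda>z. (cmod (deriv g z))\<^sup>2 * f (g z))"
    unfolding complex_integrable_of_real_iff set_integrable_def by simp
  have "complex_of_real (LINT z:g ` S|lborel. f z)
      = complex_of_real (LINT z:S|lborel. (cmod (deriv g z))\<^sup>2 * f (g z))"
    using cov(2)[OF i] by (simp only: set_integral_complex_of_real[symmetric] scaleR_conv_of_real of_real_mult)
  then show "(LINT z:g ` S|lborel. f z) = (LINT z:S|lborel. (cmod (deriv g z))\<^sup>2 * f (g z))"
    by (simp only: of_real_eq_iff)
qed

section \<open>Mean values of holomorphic functions over disks\<close>

lemma set_integrable_continuous_ball:
  fixes f :: "complex \<Rightarrow> 'a :: {banach, second_countable_topology}"
  assumes "continuous_on (cball z r) f"
  shows "set_integrable lborel (ball z r) f"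
proof -
  have "set_integrable lborel (cball z r) f"
    using borel_integrable_compact[OF compact_cball assms] by (simp add: set_integrable_def)
  then show ?thesis
    by (rule set_integrable_subset) auto
qed

text \<open>A rotation about \<open>z\<close> preserves the ball. Rotating by the angle
  \<open>pi / n\<close> changes the sign of the integrand, so the integral equals its own
  negative.\<close>

lemma integral_ball_power:
  fixes z :: complex
  assumes "n > 0"
  shows "(LINT u:ball z r|lborel. (u - z) ^ n) = 0"
proof -
  define \<omega> where "\<omega> = cis (pi / n)"
  have \<omega>: "\<omega> ^ n = - 1" "cmod \<omega> = 1" "\<omega> \<noteq> 0"
    using assms by (simp_all add: \<omega>_def Complex.DeMoivre[of "pi / n" n] del: Complex.DeMoivre)
  define g where "g = (\<lambda>u. z + \<omega> * (u - z))"
  have im: "g ` ball z r = ball z r"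
  proof
    show "g ` ball z r \<subseteq> ball z r"
      by (auto simp: g_def dist_norm norm_mult \<omega> norm_minus_commute)
    show "ball z r \<subseteq> g ` ball z r"
    proof
      fix u assume "u \<in> ball z r"
      then have "z + (u - z) / \<omega> \<in> ball z r"
        by (simp add: dist_norm norm_divide \<omega> norm_minus_commute)
      moreover have "u = g (z + (u - z) / \<omega>)"
        using \<omega> by (simp add: g_def)
      ultimately show "u \<in> g ` ball z r"
        by blast
    qed
  qed
  have der: "deriv g u = \<omega>" for u
    unfolding g_def by (rule DERIV_imp_deriv) (auto intro!: derivative_eq_intros)
  have "set_integrable lborel (g ` ball z r) (\<lambda>u. (u - z) ^ n)"
    unfolding im by (intro set_integrable_continuous_ball continuous_intros)
  then have "(LINT u:g ` ball z r|lborel. (u - z) ^ n)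
      = (LINT u:ball z r|lborel. (cmod (deriv g u))\<^sup>2 *\<^sub>R (g u - z) ^ n)"
    by (rule complex_change_of_variables(2)[rotated -1])
      (auto simp: g_def inj_on_def \<omega> intro!: holomorphic_intros continuous_intros)
  also have "\<dots> = (LINT u:ball z r|lborel. - ((u - z) ^ n))"
    unfolding der by (simp add: \<omega> g_def power_mult_distrib)
  finally have "(LINT u:ball z r|lborel. (u - z) ^ n) = - (LINT u:ball z r|lborel. (u - z) ^ n)"
    unfolding im by (simp add: set_lebesgue_integral_def)
  then show ?thesis
    by simp
qed

text \<open>Termwise integration of the Taylor series at \<open>z\<close>: every power except the
  constant one integrates to 0.\<close>

lemma area_mean_value:
  fixes f :: "complex \<Rightarrow> complex"
  assumes f: "f holomorphic_on ball z R" and r: "0 < r" "r < R"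
  shows "(LINT u:ball z r|lborel. f u) = measure lborel (ball z r) * f z"
proof -
  define a where "a = (\<lambda>n. (deriv ^^ n) f z / fact n)"
  define m where "m = measure lborel (ball z r)"
  have sums: "(\<lambda>n. a n * (u - z) ^ n) sums f u" if "u \<in> ball z R" for u
    using holomorphic_power_series[OF f that] by (simp add: a_def)
  \<comment> \<open>Convergence of the power series at the larger radius \<open>s\<close> yields
    absolute convergence at radius \<open>r\<close>, the majorant for exchanging sum and
    integral.\<close>
  obtain s where s: "r < s" "s < R"
    using r dense by blast
  have abs: "summable (\<lambda>n. cmod (a n) * r ^ n)"
  proof -
    have "summable (\<lambda>n. a n * of_real s ^ n)"
      using sums[of "z + of_real s"] s r by (auto simp: dist_norm sums_iff)
    from powser_insidea[OF this, of "of_real r"] s r show ?thesis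
      by (simp add: norm_mult norm_power)
  qed
  let ?g = "\<lambda>n u. indicator (ball z r) u *\<^sub>R (a n * (u - z) ^ n)"
  have bd: "norm (?g n u) \<le> indicator (ball z r) u * (cmod (a n) * r ^ n)" for n u
    by (auto simp: indicator_def norm_mult norm_power dist_norm norm_minus_commute
        intro!: mult_left_mono power_mono)
  have int: "integrable lborel (?g n)" for n
    using set_integrable_continuous_ball[of z r "\<lambda>u. a n * (u - z) ^ n"]
    unfolding set_integrable_def by (simp add: continuous_intros)
  have ind: "integrable lborel (indicat_real (ball z r))"
    using set_integrable_continuous_ball[of z r "\<lambda>_. 1 :: real"] by (simp add: set_integrable_def)
  have intn: "(LINT u|lborel. norm (?g n u)) \<le> m * (cmod (a n) * r ^ n)" for n
  proof -
    have "(LINT u|lborel. norm (?g n u)) \<le> (LINT u|lborel. indicator (ball z r) u * (cmod (a n) * r ^ n))"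
      using bd by (intro integral_mono integrable_norm int integrable_mult_left ind) auto
    also have "\<dots> = m * (cmod (a n) * r ^ n)"
      by (simp add: m_def)
    finally show ?thesis .
  qed
  have "(LINT u:ball z r|lborel. f u) = (LINT u|lborel. (\<Sum>n. ?g n u))"
    unfolding set_lebesgue_integral_def
  proof (rule Bochner_Integration.integral_cong)
    fix u
    show "indicat_real (ball z r) u *\<^sub>R f u = (\<Sum>n. ?g n u)"
      using sums[of u] r by (auto simp: indicator_def sums_iff)
  qed simp
  also have "\<dots> = (\<Sum>n. LINT u|lborel. ?g n u)"
  proof (rule integral_suminf)
    show "AE u in lborel. summable (\<lambda>n. norm (?g n u))"
    proof (rule AE_I2)
      fix u
      show "summable (\<lambda>n. norm (?g n u))"
        using bd by (intro summable_comparison_test'[OF summable_mult[OF abs], of 0]) auto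
    qed
    show "summable (\<lambda>n. LINT u|lborel. norm (?g n u))"
      using intn by (intro summable_comparison_test'[OF summable_mult[OF abs, of m], of 0]) auto
  qed (rule int)
  also have "\<dots> = (\<Sum>n. if n = 0 then of_real m * f z else 0)"
  proof (rule suminf_cong)
    fix n
    show "(LINT u|lborel. ?g n u) = (if n = 0 then of_real m * f z else 0)"
    proof -
      have "(LINT u|lborel. ?g n u) = (LINT u:ball z r|lborel. a n * (u - z) ^ n)"
        unfolding set_lebesgue_integral_def ..
      also have "\<dots> = a n * (LINT u:ball z r|lborel. (u - z) ^ n)"
        by (rule set_integral_mult_right)
      also have "\<dots> = (if n = 0 then of_real m * f z else 0)"
        using integral_ball_power[of n z r]
        by (auto simp: a_def m_def set_lebesgue_integral_def scaleR_conv_of_real)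
      finally show ?thesis .
    qed
  qed
  also have "\<dots> = of_real m * f z"
    by (subst suminf_finite[of "{0}"]) auto
  finally show ?thesis
    by (simp add: m_def)
qed

text \<open>The mean value identity for the square of \<open>f\<close>, which is again holomorphic,
  followed by the triangle inequality for integrals.\<close>

lemma area_mean_bound:
  fixes f :: "complex \<Rightarrow> complex"
  assumes f: "f holomorphic_on ball z R" and r: "0 < r" "r < R"
  shows "measure lborel (ball z r) * (cmod (f z))\<^sup>2 \<le> (LINT u:ball z r|lborel. (cmod (f u))\<^sup>2)"
proof -
  have "(\<lambda>u. (f u)\<^sup>2) holomorphic_on ball z R"
    by (intro holomorphic_intros f)
  from area_mean_value[OF this r]
  have "measure lborel (ball z r) * (cmod (f z))\<^sup>2 = norm (LINT u:ball z r|lborel. (f u)\<^sup>2)"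
    by (simp add: norm_mult norm_power)
  also have "\<dots> \<le> (LINT u:ball z r|lborel. norm ((f u)\<^sup>2))"
    unfolding set_lebesgue_integral_def
    by (rule order_trans[OF integral_norm_bound]) (simp add: norm_power)
  finally show ?thesis
    by (simp add: norm_power)
qed

lemma measure_ball_pos: "r > 0 \<Longrightarrow> measure lborel (ball (z :: complex) r) > 0"
  using content_ball_pos by simp

section \<open>The Bergman space as a Hilbert space\<close>

lemma Rep_bergman_holomorphic: "Rep_bergman f holomorphic_on \<bbbD>"
  using Rep_bergman[of f] by (simp add: bergman_functions_def)

lemma Rep_bergman_square_integrable: "set_integrable lborel \<bbbD> (\<lambda>z. (cmod (Rep_bergman f z))\<^sup>2)"
  using Rep_bergman[of f] by (simp add: bergman_functions_def)

lemma Rep_bergman_outside: "z \<notin> \<bbbD> \<Longrightarrow> Rep_bergman f z = 0"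
  using Rep_bergman[of f] by (auto simp: bergman_functions_def)

lemma bergman_eqI: "(\<And>z. z \<in> \<bbbD> \<Longrightarrow> Rep_bergman f z = Rep_bergman g z) \<Longrightarrow> f = g"
  by (metis Rep_bergman_inject Rep_bergman_outside ext)

lemma Rep_bergman_diff: "Rep_bergman (f - g) z = Rep_bergman f z - Rep_bergman g z"
  unfolding minus_bergman_def plus_bergman.rep_eq uminus_bergman.rep_eq by simp

lemma norm_bergman_square: "(norm (f :: bergman))\<^sup>2 = (LINT z:\<bbbD>|lborel. (cmod (Rep_bergman f z))\<^sup>2) / pi"
  unfolding power2_norm_eq_inner inner_bergman_def cinner_self by simp

lemma set_integral_nonneg_mono:
  fixes f :: "'a \<Rightarrow> real"
  assumes "set_integrable M B f" "A \<subseteq> B" "A \<in> sets M" "\<And>x. x \<in> B \<Longrightarrow> 0 \<le> f x"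
  shows "(LINT x:A|M. f x) \<le> (LINT x:B|M. f x)"
proof -
  have "set_integrable M A f"
    by (rule set_integrable_subset[OF assms(1,3,2)])
  then show ?thesis
    using assms unfolding set_lebesgue_integral_def set_integrable_def
    by (intro integral_mono) (auto simp: indicator_def)
qed

text \<open>Around every point of modulus at most \<open>s\<close> fits a disk of one fixed radius
  inside the unit disk, and the area mean over it is controlled by the norm. Norm convergence
  therefore implies locally uniform convergence.\<close>

lemma bergman_point_bound:
  assumes s: "s < 1"
  obtains C where "C > 0" "\<And>f z. cmod z \<le> s \<Longrightarrow> cmod (Rep_bergman f z) \<le> C * norm f"
proof
  define r where "r = (1 - s) / 2"
  define m where "m = measure lborel (ball (0 :: complex) r)"
  have r: "0 < r" "r < 1 - s"
    using s by (auto simp: r_def)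
  have m: "m > 0"
    using measure_ball_pos[OF r(1)] by (simp add: m_def)
  show "sqrt (pi / m) > 0"
    using m by simp
  fix f z assume z: "cmod z \<le> s"
  have sub: "ball z (1 - s) \<subseteq> \<bbbD>"
  proof
    fix u assume "u \<in> ball z (1 - s)"
    then have "cmod (u - z) < 1 - s"
      by (simp add: dist_norm norm_minus_commute)
    then show "u \<in> \<bbbD>"
      using z norm_triangle_ineq[of "u - z" z] by simp
  qed
  have m': "measure lborel (ball z r) = m"
    using r by (simp add: m_def content_ball)
  have "m * (cmod (Rep_bergman f z))\<^sup>2 \<le> (LINT u:ball z r|lborel. (cmod (Rep_bergman f u))\<^sup>2)"
    using area_mean_bound[OF holomorphic_on_subset[OF Rep_bergman_holomorphic sub] r] by (simp add: m')
  also have "\<dots> \<le> (LINT u:\<bbbD>|lborel. (cmod (Rep_bergman f u))\<^sup>2)"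
    using sub r by (intro set_integral_nonneg_mono Rep_bergman_square_integrable) auto
  also have "\<dots> = pi * (norm f)\<^sup>2"
    by (simp add: norm_bergman_square)
  finally have "(cmod (Rep_bergman f z))\<^sup>2 \<le> (pi / m) * (norm f)\<^sup>2"
    using m by (simp add: field_simps)
  then have "sqrt ((cmod (Rep_bergman f z))\<^sup>2) \<le> sqrt ((pi / m) * (norm f)\<^sup>2)"
    by (rule real_sqrt_le_mono)
  then show "cmod (Rep_bergman f z) \<le> sqrt (pi / m) * norm f"
    unfolding real_sqrt_mult[of "pi / m"] by simp
qed

text \<open>Fatou's lemma for the squared moduli. With \<open>Y m = X n - X m\<close> it bounds the
  distance of a member of a Cauchy sequence from its pointwise limit before that limit is known to
  belong to the space.\<close>

lemma bergman_fatou: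
  assumes c: "c \<ge> 0" and Y: "\<And>m. m \<ge> N \<Longrightarrow> norm (Y m :: bergman) \<le> c"
    and lim: "\<And>z. z \<in> \<bbbD> \<Longrightarrow> (\<lambda>m. Rep_bergman (Y m) z) \<longlonglongrightarrow> G z"
    and G: "G holomorphic_on \<bbbD>" and G0: "\<And>z. z \<notin> \<bbbD> \<Longrightarrow> G z = 0"
  obtains g where "Rep_bergman g = G" "norm g \<le> c"
proof -
  define u where "u = (\<lambda>m z. ennreal (indicator \<bbbD> z * (cmod (Rep_bergman (Y (m + N)) z))\<^sup>2))"
  have meas: "(\<lambda>z. indicator \<bbbD> z * (cmod (h z))\<^sup>2) \<in> borel_measurable lborel"
    if "h holomorphic_on \<bbbD>" for h
  proof -
    have "continuous_on \<bbbD> (\<lambda>z. (cmod (h z))\<^sup>2)"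
      by (intro continuous_intros holomorphic_on_imp_continuous_on that)
    from borel_measurable_continuous_on_indicator[OF _ this] show ?thesis
      by simp
  qed
  have nn: "(\<integral>\<^sup>+ z. u m z \<partial>lborel) \<le> ennreal (pi * c\<^sup>2)" for m
  proof -
    have "(\<integral>\<^sup>+ z. u m z \<partial>lborel) = ennreal (LINT z|lborel. indicator \<bbbD> z * (cmod (Rep_bergman (Y (m + N)) z))\<^sup>2)"
      unfolding u_def using Rep_bergman_square_integrable[of "Y (m + N)"]
      by (intro nn_integral_eq_integral) (auto simp: set_integrable_def)
    also have "(LINT z|lborel. indicator \<bbbD> z * (cmod (Rep_bergman (Y (m + N)) z))\<^sup>2) = pi * (norm (Y (m + N)))\<^sup>2"
      by (simp add: norm_bergman_square set_lebesgue_integral_def)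
    also have "\<dots> \<le> pi * c\<^sup>2"
      using Y[of "m + N"] by (intro mult_left_mono power_mono) auto
    finally show ?thesis
      by (simp add: ennreal_leI)
  qed
  have "(\<integral>\<^sup>+ z. ennreal (indicator \<bbbD> z * (cmod (G z))\<^sup>2) \<partial>lborel) = (\<integral>\<^sup>+ z. liminf (\<lambda>m. u m z) \<partial>lborel)"
  proof (rule nn_integral_cong)
    fix z
    have "(\<lambda>m. u m z) \<longlonglongrightarrow> ennreal (indicator \<bbbD> z * (cmod (G z))\<^sup>2)"
    proof (cases "z \<in> \<bbbD>")
      case True
      then show ?thesis
        unfolding u_def using LIMSEQ_ignore_initial_segment[OF lim[OF True], of N]
        by (intro tendsto_intros tendsto_ennrealI) auto
    qed (simp add: u_def)
    then show "ennreal (indicator \<bbbD> z * (cmod (G z))\<^sup>2) = liminf (\<lambda>m. u m z)"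
      by (simp add: lim_imp_Liminf)
  qed
  also have "\<dots> \<le> liminf (\<lambda>m. \<integral>\<^sup>+ z. u m z \<partial>lborel)"
  proof (rule nn_integral_liminf)
    show "u i \<in> borel_measurable lborel" for i
      unfolding u_def
      by (rule measurable_compose[OF meas measurable_ennreal]) (rule Rep_bergman_holomorphic)
  qed
  also have "\<dots> \<le> ennreal (pi * c\<^sup>2)"
  proof -
    have "liminf (\<lambda>m. \<integral>\<^sup>+ z. u m z \<partial>lborel) \<le> limsup (\<lambda>m. \<integral>\<^sup>+ z. u m z \<partial>lborel)"
      by (rule Liminf_le_Limsup) simp
    also have "\<dots> \<le> ennreal (pi * c\<^sup>2)"
      by (rule Limsup_bounded) (simp add: nn)
    finally show ?thesis .
  qed
  finally have bound: "(\<integral>\<^sup>+ z. ennreal (indicator \<bbbD> z * (cmod (G z))\<^sup>2) \<partial>lborel) \<le> ennreal (pi * c\<^sup>2)" .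
  then have "integrable lborel (\<lambda>z. indicator \<bbbD> z * (cmod (G z))\<^sup>2)"
    by (intro integrableI_nonneg meas G) (auto simp: le_less_trans)
  then have "G \<in> bergman_functions"
    using G G0 by (auto simp: bergman_functions_def set_integrable_def)
  then have rep: "Rep_bergman (Abs_bergman G) = G"
    by (rule Abs_bergman_inverse)
  have "ennreal (pi * (norm (Abs_bergman G))\<^sup>2) = (\<integral>\<^sup>+ z. ennreal (indicator \<bbbD> z * (cmod (G z))\<^sup>2) \<partial>lborel)"
    using \<open>integrable lborel _\<close>
    by (subst nn_integral_eq_integral) (auto simp: norm_bergman_square set_lebesgue_integral_def rep)
  with bound have "ennreal (pi * (norm (Abs_bergman G))\<^sup>2) \<le> ennreal (pi * c\<^sup>2)"
    by argo
  then have "pi * (norm (Abs_bergman G))\<^sup>2 \<le> pi * c\<^sup>2"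
    by (subst (asm) ennreal_le_iff) simp_all
  then have "norm (Abs_bergman G) \<le> c"
    using c by (simp add: power2_le_iff_abs_le)
  with rep show ?thesis
    by (rule that)
qed

section \<open>Completeness\<close>

lemma uniform_limit_Rep_bergman:
  assumes "Cauchy X" "s < 1"
  shows "uniform_limit (cball 0 s) (\<lambda>n. Rep_bergman (X n)) (\<lambda>z. lim (\<lambda>n. Rep_bergman (X n) z)) sequentially"
proof -
  obtain C where C: "C > 0" "\<And>f z. cmod z \<le> s \<Longrightarrow> cmod (Rep_bergman f z) \<le> C * norm f"
    using bergman_point_bound[OF assms(2)] by blast
  have "uniformly_Cauchy_on (cball 0 s) (\<lambda>n. Rep_bergman (X n))"
    unfolding uniformly_Cauchy_on_def
  proof (intro allI impI)
    fix e :: real assume e: "e > 0"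
    then obtain M where M: "\<And>m n. m \<ge> M \<Longrightarrow> n \<ge> M \<Longrightarrow> dist (X m) (X n) < e / C"
      using assms(1) C(1) by (meson Cauchy_def divide_pos_pos)
    show "\<exists>M. \<forall>x\<in>cball 0 s. \<forall>m\<ge>M. \<forall>n\<ge>M. dist (Rep_bergman (X m) x) (Rep_bergman (X n) x) < e"
    proof (intro exI ballI allI impI)
      fix x :: complex and m n assume "x \<in> cball 0 s" "M \<le> m" "M \<le> n"
      then have "cmod (Rep_bergman (X m - X n) x) \<le> C * norm (X m - X n)" "C * norm (X m - X n) < e"
        using C M[of m n] by (auto simp: dist_norm field_simps)
      then show "dist (Rep_bergman (X m) x) (Rep_bergman (X n) x) < e"
        by (simp add: dist_norm Rep_bergman_diff)
    qed
  qed
  then have "uniformly_convergent_on (cball 0 s) (\<lambda>n. Rep_bergman (X n))"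
    by (rule Cauchy_uniformly_convergent)
  then show ?thesis
    by (simp add: uniformly_convergent_uniform_limit_iff)
qed

text \<open>Pointwise limits exist by the evaluation bound and are locally uniform, hence
  holomorphic. Fatou's lemma for differences of members shows both that the limit lies in the space
  and that convergence holds in norm.\<close>

instance bergman :: complete_space
proof
  fix X :: "nat \<Rightarrow> bergman" assume X: "Cauchy X"
  define F where "F = (\<lambda>z. if z \<in> \<bbbD> then lim (\<lambda>n. Rep_bergman (X n) z) else 0)"
  have ul: "uniform_limit (cball 0 s) (\<lambda>n. Rep_bergman (X n)) F sequentially" if "s < 1" for s
    using uniform_limit_Rep_bergman[OF X that]
    by (rule uniform_limit_cong'[THEN iffD1, rotated -1]) (use that in \<open>auto simp: F_def\<close>)
  have lim: "(\<lambda>n. Rep_bergman (X n) z) \<longlonglongrightarrow> F z" if "z \<in> \<bbbD>" for z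
    using tendsto_uniform_limitI[OF ul[of "cmod z"]] that by simp
  have F: "F holomorphic_on \<bbbD>"
  proof (rule holomorphic_uniform_sequence[OF _ Rep_bergman_holomorphic])
    fix z :: complex assume z: "z \<in> \<bbbD>"
    define d where "d = (1 - cmod z) / 2"
    have d: "d > 0" "cmod z + d < 1"
      using z by (auto simp: d_def field_simps)
    have sub: "cball z d \<subseteq> cball 0 (cmod z + d)"
    proof
      fix u assume "u \<in> cball z d"
      then show "u \<in> cball 0 (cmod z + d)"
        using norm_triangle_ineq[of "u - z" z] by (simp add: dist_norm norm_minus_commute)
    qed
    moreover have "cball 0 (cmod z + d) \<subseteq> \<bbbD>"
      using d by auto
    ultimately show "\<exists>d>0. cball z d \<subseteq> \<bbbD> \<and> uniform_limit (cball z d) (\<lambda>n. Rep_bergman (X n)) F sequentially"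
      using d uniform_limit_on_subset[OF ul[OF d(2)] sub] by blast
  qed simp
  have F0: "F z = 0" if "z \<notin> \<bbbD>" for z
    using that by (simp add: F_def)
  have key: "\<exists>g. Rep_bergman g = (\<lambda>z. Rep_bergman (X n) z - F z) \<and> norm g \<le> e"
    if e: "e > 0" and n: "\<And>m. m \<ge> N \<Longrightarrow> norm (X n - X m) \<le> e" for e n N
  proof (rule bergman_fatou[of e N "\<lambda>m. X n - X m" "\<lambda>z. Rep_bergman (X n) z - F z"])
    show "(\<lambda>z. Rep_bergman (X n) z - F z) holomorphic_on \<bbbD>"
      by (intro holomorphic_intros F Rep_bergman_holomorphic)
    show "(\<lambda>m. Rep_bergman (X n - X m) z) \<longlonglongrightarrow> Rep_bergman (X n) z - F z" if "z \<in> \<bbbD>" for z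
      unfolding Rep_bergman_diff by (intro tendsto_intros lim that)
  qed (use e n F0 Rep_bergman_outside in auto)
  obtain N1 where N1: "\<And>m n. m \<ge> N1 \<Longrightarrow> n \<ge> N1 \<Longrightarrow> dist (X m) (X n) < 1"
    using X Cauchy_def zero_less_one by metis
  obtain g where g: "Rep_bergman g = (\<lambda>z. Rep_bergman (X N1) z - F z)"
    using key[of 1 N1 N1] N1[of N1] by (auto simp: dist_norm less_imp_le)
  define f where "f = X N1 - g"
  have f: "Rep_bergman f = F"
    by (auto simp: f_def Rep_bergman_diff g)
  have "X \<longlonglongrightarrow> f"
  proof (rule LIMSEQ_I)
    fix r :: real assume r: "r > 0"
    then obtain N where N: "\<And>m n. m \<ge> N \<Longrightarrow> n \<ge> N \<Longrightarrow> dist (X m) (X n) < r / 2"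
      using X Cauchy_def half_gt_zero by metis
    show "\<exists>N. \<forall>n\<ge>N. norm (X n - f) < r"
    proof (intro exI allI impI)
      fix n assume n: "N \<le> n"
      obtain h where h: "Rep_bergman h = (\<lambda>z. Rep_bergman (X n) z - F z)" "norm h \<le> r / 2"
        using key[of "r / 2" N n] N[OF n] r by (auto simp: dist_norm less_imp_le)
      have "h = X n - f"
        by (rule bergman_eqI) (simp add: h Rep_bergman_diff f)
      with h r show "norm (X n - f) < r"
        by simp
    qed
  qed
  then show "convergent X"
    by (rule convergentI)
qed

text \<open>Minimizing \<open>\<parallel>x\<parallel>\<^sup>2 - 2 \<phi> x\<close> gives the Riesz representation theorem and the
  orthogonal projection at once.\<close>

lemma riesz_representation_subspace:
  fixes \<phi> :: "'a :: {real_inner, complete_space} \<Rightarrow> real"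
  assumes M: "subspace M" "closed M" and \<phi>: "bounded_linear \<phi>"
  obtains m where "m \<in> M" "\<And>x. x \<in> M \<Longrightarrow> \<phi> x = m \<bullet> x"
proof -
  interpret \<phi>: bounded_linear \<phi> by (rule \<phi>)
  define J where "J = (\<lambda>x. (norm x)\<^sup>2 - 2 * \<phi> x)"
  obtain K where K: "\<And>x. norm (\<phi> x) \<le> norm x * K"
    using \<phi>.nonneg_bounded by blast
  have lower: "J x \<ge> - (K\<^sup>2)" for x
  proof -
    have "0 \<le> (norm x - K)\<^sup>2"
      by simp
    then show ?thesis
      using K[of x] by (simp add: J_def power2_diff algebra_simps)
  qed
  define d where "d = Inf (J ` M)"
  have bdd: "bdd_below (J ` M)"
    using lower by (auto simp: bdd_below_def)
  have ne: "J ` M \<noteq> {}"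
    using subspace_0[OF M(1)] by blast
  have d: "d \<le> J x" if "x \<in> M" for x
    unfolding d_def using that bdd by (intro cInf_lower) auto
  have "\<exists>x\<in>M. J x < d + 1 / real (Suc n)" for n
    using cInf_lessD[OF ne, of "d + 1 / real (Suc n)"] by (force simp: d_def)
  then obtain X where X: "\<And>n. X n \<in> M" "\<And>n. J (X n) < d + 1 / real (Suc n)"
    by metis
  \<comment> \<open>Parallelogram identity: the midpoint lies in \<open>M\<close>, so
    \<open>J\<close> is at least \<open>d\<close> there, and two near-minimizers must be close to
    each other.\<close>
  have par: "(norm (x - y))\<^sup>2 \<le> 2 * (J x - d) + 2 * (J y - d)" if "x \<in> M" "y \<in> M" for x y
  proof -
    have "d \<le> J ((1 / 2) *\<^sub>R (x + y))"
      using that M(1) by (intro d) (simp add: subspace_add subspace_scale)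
    moreover have "(norm (x - y))\<^sup>2 = 2 * J x + 2 * J y - 4 * J ((1 / 2) *\<^sub>R (x + y))"
    proof -
      have "J ((1 / 2) *\<^sub>R (x + y)) = (norm (x + y))\<^sup>2 / 4 - \<phi> x - \<phi> y"
        by (simp add: J_def power_divide \<phi>.scaleR \<phi>.add add_divide_distrib)
      moreover have "(norm (x - y))\<^sup>2 = 2 * (norm x)\<^sup>2 + 2 * (norm y)\<^sup>2 - (norm (x + y))\<^sup>2"
        by (simp add: power2_norm_eq_inner inner_simps inner_commute)
      ultimately show ?thesis
        by (simp add: J_def)
    qed
    ultimately show ?thesis
      by argo
  qed
  have "Cauchy X"
  proof (rule metric_CauchyI)
    fix e :: real assume e: "e > 0"
    obtain N where N: "1 / real (Suc N) < e\<^sup>2 / 4"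
      using e reals_Archimedean[of "e\<^sup>2 / 4"] by (auto simp: inverse_eq_divide)
    show "\<exists>N. \<forall>m\<ge>N. \<forall>n\<ge>N. dist (X m) (X n) < e"
    proof (intro exI allI impI)
      fix m n assume mn: "N \<le> m" "N \<le> n"
      have "1 / real (Suc m) \<le> 1 / real (Suc N)" "1 / real (Suc n) \<le> 1 / real (Suc N)"
        using mn by (auto intro!: divide_left_mono)
      then have "(norm (X m - X n))\<^sup>2 < e\<^sup>2"
        using par[OF X(1) X(1), of m n] X(2)[of m] X(2)[of n] N by argo
      then show "dist (X m) (X n) < e"
        using e by (simp add: dist_norm power2_less_imp_less)
    qed
  qed
  then obtain m where m: "X \<longlonglongrightarrow> m"
    using Cauchy_convergent convergent_def by blast
  have mM: "m \<in> M"
    using closed_sequentially[OF M(2) X(1) m] .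
  have "(\<lambda>n. J (X n)) \<longlonglongrightarrow> J m"
    unfolding J_def by (intro tendsto_intros m \<phi>.tendsto)
  moreover have "(\<lambda>n. d + 1 / real (Suc n)) \<longlonglongrightarrow> d + 0"
    using LIMSEQ_inverse_real_of_nat by (intro tendsto_intros) (simp add: inverse_eq_divide)
  ultimately have "J m \<le> d"
    using X(2) by (intro LIMSEQ_le[of "\<lambda>n. J (X n)" "J m" "\<lambda>n. d + 1 / real (Suc n)" d])
      (auto intro: less_imp_le)
  have "\<phi> x = m \<bullet> x" if x: "x \<in> M" for x
  proof -
    have ineq: "0 \<le> t * (t * (norm x)\<^sup>2 + 2 * (m \<bullet> x - \<phi> x))" for t
    proof -
      have "J m \<le> J (m + t *\<^sub>R x)"
        using d[of "m + t *\<^sub>R x"] \<open>J m \<le> d\<close> mM x M(1) by (force simp: subspace_add subspace_scale)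
      then show ?thesis
        by (simp add: J_def \<phi>.add \<phi>.scaleR power2_norm_eq_inner inner_simps inner_commute
            algebra_simps)
    qed
    define b where "b = m \<bullet> x - \<phi> x"
    \<comment> \<open>Adding 1 keeps the denominator positive when \<open>x = 0\<close>. For
      \<open>t = - b / a\<close> the minimality inequality turns into a square times a negative
      number, which forces \<open>b = 0\<close>.\<close>
    define a where "a = (norm x)\<^sup>2 + 1"
    have a: "a > 0"
      by (simp add: a_def add_nonneg_pos)
    have "0 \<le> (- b / a) * ((- b / a) * (norm x)\<^sup>2 + 2 * b)"
      using ineq[of "- b / a"] by (simp add: b_def)
    also have "\<dots> = (b / a)\<^sup>2 * ((norm x)\<^sup>2 - 2 * a)"
      using a by (simp add: field_simps power2_eq_square)
    finally have "b = 0"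
      using a by (auto simp: zero_le_mult_iff a_def add_nonneg_eq_0_iff)
    then show ?thesis
      by (simp add: b_def)
  qed
  with mM show ?thesis
    by (rule that)
qed

section \<open>Complex adjoints and multiplication operators\<close>

lemma Re_cinner: "Re (cinner f g) = f \<bullet> g"
  by (simp add: inner_bergman_def)

lemma Im_cinner: "Im (cinner f g) = - ((\<i> *\<^sub>C f) \<bullet> g)"
  by (simp add: inner_bergman_def cinner_scaleC_left)

lemma cinner_scaleC_right: "cinner f (c *\<^sub>C g) = cnj c * cinner f g"
  by (metis cinner_commute cinner_scaleC_left complex_cnj_mult)

lemma cinner_add_right: "cinner f (g + h) = cinner f g + cinner f h"
  by (metis cinner_add_left cinner_commute complex_cnj_add)

lemma cinner_diff_right: "cinner h (f - g) = cinner h f - cinner h g"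
  using cinner_add_right[of h "f - g" g] by simp

lemma cinner_eqI: "(\<And>h. cinner h f = cinner h g) \<Longrightarrow> f = g"
  using cinner_self_eq_0[of "f - g"] by (simp add: cinner_diff_right)

lemma norm_scaleC: "norm (c *\<^sub>C f) = cmod c * norm f"
proof -
  have "(norm (c *\<^sub>C f))\<^sup>2 = (cmod c * norm f)\<^sup>2"
    by (simp add: norm_bergman_square scaleC.rep_eq norm_mult power_mult_distrib)
  then show ?thesis
    by (simp add: power2_eq_iff_nonneg)
qed

lemma bounded_operator_scaleC: "bounded_operator ((*\<^sub>C) c)"
  unfolding bounded_operator_def
  by (intro conjI bounded_linear_intro[of _ "cmod c"])
    (simp_all add: bergman.scale_right_distrib scaleR_bergman_def norm_scaleC mult.commute)

text \<open>The real inner product sees only the real part; testing with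
  \<open>\<i> *\<^sub>C f\<close> as well recovers the imaginary part. In this way the real
  representation theorem produces complex adjoints.\<close>

lemma cinner_eq_if_inner_eq:
  assumes lin: "\<And>f. T (\<i> *\<^sub>C f) = \<i> *\<^sub>C T f" and eq: "\<And>f. T f \<bullet> g = f \<bullet> h"
  shows "cinner (T f) g = cinner f h"
  using eq[of f] eq[of "\<i> *\<^sub>C f"] by (simp add: complex_eq_iff Re_cinner Im_cinner lin)

text \<open>The representing vectors give a solution of the adjoint equation, and nondegeneracy of
  the inner product makes it the only one, so the definite description denotes it.\<close>

lemma cadjoint:
  assumes T: "bounded_operator T"
  shows "cinner (T f) g = cinner f (cadjoint T g)"
proof -
  have bl: "bounded_linear T" and lin: "\<And>c f. T (c *\<^sub>C f) = c *\<^sub>C T f"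
    using T by (auto simp: bounded_operator_def)
  have "\<exists>h. \<forall>f. cinner (T f) g = cinner f h" for g
  proof -
    have "bounded_linear (\<lambda>f. T f \<bullet> g)"
      by (rule bounded_linear_compose[OF bounded_linear_inner_left bl])
    then obtain h where "\<And>f. T f \<bullet> g = h \<bullet> f"
      using riesz_representation_subspace[of UNIV "\<lambda>f. T f \<bullet> g"] by auto
    then show ?thesis
      using cinner_eq_if_inner_eq[of T g h] lin by (auto simp: inner_commute)
  qed
  then obtain S where S: "\<forall>f g. cinner (T f) g = cinner f (S g)"
    by metis
  have "S' = S" if "\<forall>f g. cinner (T f) g = cinner f (S' g)" for S'
    using that S by (intro ext cinner_eqI) simp
  then have "\<forall>f g. cinner (T f) g = cinner f (cadjoint T g)"
    unfolding cadjoint_def using S theI[of "\<lambda>S. \<forall>f g. cinner (T f) g = cinner f (S g)" S] by blast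
  then show ?thesis
    by simp
qed

lemma cadjoint_right: "bounded_operator T \<Longrightarrow> cinner f (T g) = cinner (cadjoint T f) g"
  by (metis cadjoint cinner_commute)

lemma cadjoint_eqI:
  "bounded_operator T \<Longrightarrow> (\<And>f. cinner (T f) g = cinner f h) \<Longrightarrow> cadjoint T g = h"
  by (rule cinner_eqI) (simp add: cadjoint[symmetric])

lemma cadjoint_scaleC: "bounded_operator T \<Longrightarrow> cadjoint T (c *\<^sub>C f) = c *\<^sub>C cadjoint T f"
  by (rule cadjoint_eqI) (simp_all add: cinner_scaleC_right cadjoint)

definition bounded_holomorphic :: "(complex \<Rightarrow> complex) \<Rightarrow> bool" where
  "bounded_holomorphic \<phi> \<longleftrightarrow> \<phi> holomorphic_on \<bbbD> \<and> bounded (\<phi> ` \<bbbD>)"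

lemma bounded_holomorphic_mult_bergman:
  assumes "\<phi> holomorphic_on \<bbbD>" and K: "\<And>z. z \<in> \<bbbD> \<Longrightarrow> cmod (\<phi> z) \<le> K"
  shows "(\<lambda>z. \<phi> z * Rep_bergman f z) \<in> bergman_functions"
proof -
  have hol: "(\<lambda>z. \<phi> z * Rep_bergman f z) holomorphic_on \<bbbD>"
    by (intro holomorphic_intros assms Rep_bergman_holomorphic)
  have "set_integrable lborel \<bbbD> (\<lambda>z. (cmod (\<phi> z * Rep_bergman f z))\<^sup>2)"
  proof (rule set_integrable_bound)
    show "set_integrable lborel \<bbbD> (\<lambda>z. K\<^sup>2 * (cmod (Rep_bergman f z))\<^sup>2)"
      by (intro set_integrable_mult_right Rep_bergman_square_integrable)
    have "continuous_on \<bbbD> (\<lambda>z. (cmod (\<phi> z * Rep_bergman f z))\<^sup>2)"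
      by (intro continuous_intros holomorphic_on_imp_continuous_on[OF hol])
    from borel_measurable_continuous_on_indicator[OF _ this]
    show "set_borel_measurable lborel \<bbbD> (\<lambda>z. (cmod (\<phi> z * Rep_bergman f z))\<^sup>2)"
      by (simp add: set_borel_measurable_def)
    have "norm ((cmod (\<phi> z * Rep_bergman f z))\<^sup>2) \<le> norm (K\<^sup>2 * (cmod (Rep_bergman f z))\<^sup>2)"
      if "z \<in> \<bbbD>" for z
      using K[OF that] by (simp add: norm_mult power_mult_distrib mult_right_mono power_mono)
    then show "AE z in lborel. z \<in> \<bbbD> \<longrightarrow>
        norm ((cmod (\<phi> z * Rep_bergman f z))\<^sup>2) \<le> norm (K\<^sup>2 * (cmod (Rep_bergman f z))\<^sup>2)"
      by simp
  qed
  with hol show ?thesis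
    by (auto simp: bergman_functions_def Rep_bergman_outside)
qed

lemma Rep_mult_op:
  assumes "bounded_holomorphic \<phi>"
  shows "Rep_bergman (mult_op \<phi> f) z = \<phi> z * Rep_bergman f z"
proof -
  obtain K where "\<And>z. z \<in> \<bbbD> \<Longrightarrow> cmod (\<phi> z) \<le> K"
    using assms unfolding bounded_holomorphic_def bounded_iff by blast
  then show ?thesis
    using bounded_holomorphic_mult_bergman[of \<phi> K f] assms
    by (simp add: mult_op_def Abs_bergman_inverse bounded_holomorphic_def)
qed

lemma norm_bergman_le:
  assumes "\<And>z. z \<in> \<bbbD> \<Longrightarrow> cmod (Rep_bergman g z) \<le> K * cmod (Rep_bergman f z)" "K \<ge> 0"
  shows "norm g \<le> K * norm f"
proof -
  have "(LINT z:\<bbbD>|lborel. (cmod (Rep_bergman g z))\<^sup>2) \<le> (LINT z:\<bbbD>|lborel. K\<^sup>2 * (cmod (Rep_bergman f z))\<^sup>2)"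
    using assms power_mono[OF assms(1), of _ 2]
    by (intro set_integral_mono set_integrable_mult_right Rep_bergman_square_integrable)
      (auto simp: power_mult_distrib)
  then have "pi * (norm g)\<^sup>2 \<le> K\<^sup>2 * (pi * (norm f)\<^sup>2)"
    by (simp add: norm_bergman_square)
  then have "(norm g)\<^sup>2 \<le> (K * norm f)\<^sup>2"
    by (simp add: power_mult_distrib mult.left_commute)
  then show ?thesis
    using assms(2) by (simp add: power2_le_iff_abs_le)
qed

lemma bounded_operator_mult_op:
  assumes "bounded_holomorphic \<phi>"
  shows "bounded_operator (mult_op \<phi>)"
proof -
  obtain K where K: "\<And>z. z \<in> \<bbbD> \<Longrightarrow> cmod (\<phi> z) \<le> K"
    using assms unfolding bounded_holomorphic_def bounded_iff by blast
  have "K \<ge> 0"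
    using K[of 0] order_trans[OF norm_ge_zero] by auto
  then have "norm (mult_op \<phi> f) \<le> K * norm f" for f
    by (intro norm_bergman_le) (auto simp: Rep_mult_op assms norm_mult K mult_right_mono)
  then show ?thesis
    unfolding bounded_operator_def
    by (intro conjI bounded_linear_intro[of _ K] allI bergman_eqI)
      (auto simp: Rep_mult_op assms plus_bergman.rep_eq scaleC.rep_eq scaleR_bergman_def
        algebra_simps)
qed

lemma bounded_holomorphic_bergman:
  assumes "bounded_holomorphic \<phi>"
  obtains f where "\<And>z. z \<in> \<bbbD> \<Longrightarrow> Rep_bergman f z = \<phi> z"
proof -
  have "set_integrable lborel \<bbbD> (\<lambda>z. 1 :: real)"
    by (intro set_integrable_continuous_ball continuous_intros)
  then have "set_integrable lborel \<bbbD> (\<lambda>z. (cmod (if z \<in> \<bbbD> then 1 else 0))\<^sup>2)"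
    by (rule set_integrable_cong[THEN iffD1, rotated -1]) auto
  moreover have "(\<lambda>z. if z \<in> \<bbbD> then 1 else 0) holomorphic_on \<bbbD>"
    by (rule holomorphic_transform[of "\<lambda>_. 1"]) auto
  ultimately have "(\<lambda>z. if z \<in> \<bbbD> then 1 else 0) \<in> bergman_functions"
    by (simp add: bergman_functions_def)
  then have "Rep_bergman (Abs_bergman (\<lambda>z. if z \<in> \<bbbD> then 1 else 0)) z = 1" if "z \<in> \<bbbD>" for z
    using that by (subst Abs_bergman_inverse) auto
  then show ?thesis
    by (intro that[of "mult_op \<phi> (Abs_bergman (\<lambda>z. if z \<in> \<bbbD> then 1 else 0))"])
      (simp add: Rep_mult_op assms)
qed

section \<open>The kernel of an operator in the commutant\<close>

lemma set_integral_eq_0_continuous: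
  fixes h :: "complex \<Rightarrow> real"
  assumes S: "open S" and h: "continuous_on S h" "\<And>z. z \<in> S \<Longrightarrow> 0 \<le> h z"
    and int: "set_integrable lborel S h" "(LINT z:S|lborel. h z) = 0" and z0: "z0 \<in> S"
  shows "h z0 = 0"
proof (rule ccontr)
  assume "h z0 \<noteq> 0"
  then have pos: "h z0 > 0"
    using h(2)[OF z0] by simp
  have "continuous (at z0) h"
    using h(1) S z0 by (simp add: continuous_on_eq_continuous_at)
  then obtain d where d: "d > 0" "\<And>z. dist z z0 < d \<Longrightarrow> dist (h z) (h z0) < h z0 / 2"
    unfolding continuous_at_eps_delta using pos half_gt_zero by blast
  obtain d' where d': "d' > 0" "ball z0 d' \<subseteq> S"
    using S z0 open_contains_ball by blast
  define r where "r = min d d'"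
  have r: "r > 0" "ball z0 r \<subseteq> S"
    using d d' by (auto simp: r_def)
  have low: "h z0 / 2 \<le> h z" if "z \<in> ball z0 r" for z
    using d(2)[of z] that by (simp add: r_def dist_commute dist_real_def) (smt (verit) field_sum_of_halves)
  have i: "set_integrable lborel (ball z0 r) h"
    using int(1) r by (auto intro: set_integrable_subset)
  have "h z0 / 2 * measure lborel (ball z0 r) = (LINT z:ball z0 r|lborel. h z0 / 2)"
    by (simp add: set_lebesgue_integral_def)
  also have "\<dots> \<le> (LINT z:ball z0 r|lborel. h z)"
    using low by (intro set_integral_mono i set_integrable_continuous_ball continuous_intros) auto
  also have "\<dots> \<le> (LINT z:S|lborel. h z)"
    using h r by (intro set_integral_nonneg_mono int) auto
  finally show False
    using int(2) measure_ball_pos[OF r(1), of z0] pos by (simp add: mult_le_0_iff)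
qed

lemma holomorphic_on_suminf:
  fixes f :: "nat \<Rightarrow> complex \<Rightarrow> complex"
  assumes S: "open S" and f: "\<And>n. f n holomorphic_on S"
    and M: "\<And>n z. z \<in> S \<Longrightarrow> cmod (f n z) \<le> M n" "summable M"
  shows "(\<lambda>z. \<Sum>n. f n z) holomorphic_on S"
proof (rule holomorphic_uniform_sequence[OF S])
  show "(\<lambda>z. \<Sum>i<n. f i z) holomorphic_on S" for n
    by (intro holomorphic_intros f)
  fix z assume "z \<in> S"
  then obtain d where d: "d > 0" "cball z d \<subseteq> S"
    using S open_contains_cball by blast
  have "uniform_limit (cball z d) (\<lambda>n z. \<Sum>i<n. f i z) (\<lambda>z. \<Sum>n. f n z) sequentially"
    by (rule Weierstrass_m_test[OF _ M(2)]) (use M(1) d in blast)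
  with d show "\<exists>d>0. cball z d \<subseteq> S \<and>
      uniform_limit (cball z d) (\<lambda>n z. \<Sum>i<n. f i z) (\<lambda>z. \<Sum>n. f n z) sequentially"
    by blast
qed

lemma zero_islimpt_reals: "r > 0 \<Longrightarrow> (0 :: complex) islimpt (ball 0 r \<inter> \<real>)"
  unfolding islimpt_approachable
proof (intro allI impI)
  fix e :: real assume "r > 0" "e > 0"
  then show "\<exists>x'\<in>ball 0 r \<inter> \<real>. x' \<noteq> (0 :: complex) \<and> dist x' 0 < e"
    by (intro bexI[of _ "of_real (min r e / 2)"]) auto
qed

text \<open>Writing \<open>w = w0 + s + \<i> t\<close>, the sum is holomorphic in \<open>s\<close> and \<open>t\<close> and vanishes for real
  \<open>s\<close>, \<open>t\<close>.\<close>

lemma polarization: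
  fixes a b d e :: "nat \<Rightarrow> complex \<Rightarrow> complex"
  assumes hol: "\<And>n. a n holomorphic_on ball w0 R" "\<And>n. b n holomorphic_on ball w0 R"
      "\<And>n. d n holomorphic_on ball w0 R" "\<And>n. e n holomorphic_on ball w0 R"
    and M: "\<And>n w w'. w \<in> ball w0 R \<Longrightarrow> w' \<in> ball w0 R \<Longrightarrow>
        cmod (a n w * cnj (b n w') - d n w * cnj (e n w')) \<le> M n" "summable M"
    and diag: "\<And>w. w \<in> ball w0 R \<Longrightarrow> (\<Sum>n. a n w * cnj (b n w) - d n w * cnj (e n w)) = 0"
    and w: "w \<in> ball w0 (R / 2)" "w' \<in> ball w0 (R / 2)"
  shows "(\<Sum>n. a n w * cnj (b n w') - d n w * cnj (e n w')) = 0"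
proof -
  have R: "R > 0"
    using w(1) by (auto simp: dist_norm) (smt (verit) norm_ge_zero field_sum_of_halves)
  let ?U = "ball (0 :: complex) (R / 2)"
  \<comment> \<open>For real \<open>s\<close> and \<open>t\<close> the points \<open>p s t\<close>
    and \<open>q s t\<close> coincide, so \<open>diag\<close> applies. The conjugation inside
    \<open>q\<close> cancels the one on \<open>b\<close> and \<open>e\<close>, which makes
    \<open>J\<close> holomorphic in each variable.\<close>
  define p where "p = (\<lambda>s t. w0 + (s + \<i> * t))"
  define q where "q = (\<lambda>s t. w0 + cnj (s - \<i> * t))"
  define J where "J = (\<lambda>s t. \<Sum>n. a n (p s t) * cnj (b n (q s t)) - d n (p s t) * cnj (e n (q s t)))"
  have in_ball: "p s t \<in> ball w0 R" "q s t \<in> ball w0 R" if "s \<in> ?U" "t \<in> ?U" for s t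
  proof -
    have "cmod (s + \<i> * t) < R" "cmod (s - \<i> * t) < R"
      using that norm_triangle_ineq[of s "\<i> * t"] norm_triangle_ineq4[of s "\<i> * t"]
      by (auto simp: norm_mult)
    then show "p s t \<in> ball w0 R" "q s t \<in> ball w0 R"
      using norm_minus_cancel[of "s + \<i> * t"]
      unfolding p_def q_def by (auto simp: dist_norm simp del: complex_cnj_diff)
  qed
  have hol_cnj: "(\<lambda>v. cnj (f (w0 + cnj v))) holomorphic_on ball 0 R"
    if f: "f holomorphic_on ball w0 R" for f
  proof -
    have "(\<lambda>v. f (w0 + v)) holomorphic_on cnj ` ball 0 R"
      by (rule holomorphic_on_compose_gen[OF _ f, unfolded comp_def])
        (auto intro!: holomorphic_intros simp: dist_norm)
    from holomorphic_on_compose_cnj_cnj[OF this] show ?thesis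
      by (simp add: comp_def)
  qed
  have hol_p1: "(\<lambda>s. f (p s t)) holomorphic_on ?U" "(\<lambda>s. cnj (f (q s t))) holomorphic_on ?U"
    if f: "f holomorphic_on ball w0 R" and t: "t \<in> ?U" for f t
  proof -
    show "(\<lambda>s. f (p s t)) holomorphic_on ?U"
      using in_ball t unfolding p_def
      by (intro holomorphic_on_compose_gen[OF _ f, unfolded comp_def] holomorphic_intros) auto
    have "cmod (s - \<i> * t) < R" if "cmod s < R / 2" for s
      using that t norm_triangle_ineq4[of s "\<i> * t"] by (auto simp: norm_mult)
    then show "(\<lambda>s. cnj (f (q s t))) holomorphic_on ?U"
      unfolding q_def
      by (intro holomorphic_on_compose_gen[OF _ hol_cnj[OF f], unfolded comp_def] holomorphic_intros) auto
  qed
  have hol_p2: "(\<lambda>t. f (p s t)) holomorphic_on ?U" "(\<lambda>t. cnj (f (q s t))) holomorphic_on ?U"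
    if f: "f holomorphic_on ball w0 R" and s: "s \<in> ?U" for f s
  proof -
    show "(\<lambda>t. f (p s t)) holomorphic_on ?U"
      using in_ball s unfolding p_def
      by (intro holomorphic_on_compose_gen[OF _ f, unfolded comp_def] holomorphic_intros) auto
    have "cmod (s - \<i> * t) < R" if "cmod t < R / 2" for t
      using that s norm_triangle_ineq4[of s "\<i> * t"] by (auto simp: norm_mult)
    then show "(\<lambda>t. cnj (f (q s t))) holomorphic_on ?U"
      unfolding q_def
      by (intro holomorphic_on_compose_gen[OF _ hol_cnj[OF f], unfolded comp_def] holomorphic_intros) auto
  qed
  have J1: "(\<lambda>s. J s t) holomorphic_on ?U" if "t \<in> ?U" for t
    unfolding J_def using M in_ball that
    by (intro holomorphic_on_suminf[where M = M] holomorphic_on_diff holomorphic_on_mult hol_p1 hol) auto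
  have J2: "(\<lambda>t. J s t) holomorphic_on ?U" if "s \<in> ?U" for s
    unfolding J_def using M in_ball that
    by (intro holomorphic_on_suminf[where M = M] holomorphic_on_diff holomorphic_on_mult hol_p2 hol) auto
  have zero_limpt: "0 islimpt (?U \<inter> \<real>)"
    using R by (intro zero_islimpt_reals) simp
  have J0: "J s t = 0" if "s \<in> ?U \<inter> \<real>" "t \<in> ?U \<inter> \<real>" for s t
  proof -
    have "q s t = p s t"
      using that by (auto simp: p_def q_def Reals_cnj_iff)
    then show ?thesis
      using diag[OF in_ball(1), of s t] that by (simp add: J_def)
  qed
  \<comment> \<open>The identity theorem is used one variable at a time: here in \<open>t\<close>
    for real \<open>s\<close>, afterwards in \<open>s\<close>.\<close>
  have J1': "J s t = 0" if s: "s \<in> ?U \<inter> \<real>" and t: "t \<in> ?U" for s t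
    by (rule analytic_continuation[OF J2 open_ball connected_ball _ _ zero_limpt J0[OF s] t])
      (use s R in auto)
  have J2': "J s t = 0" if s: "s \<in> ?U" and t: "t \<in> ?U" for s t
    by (rule analytic_continuation[OF J1[OF t] open_ball connected_ball _ _ zero_limpt J1'[OF _ t] s])
      (use t R in auto)
  \<comment> \<open>Solution of \<open>w - w0 = s + \<i> * t\<close> and
    \<open>cnj (w' - w0) = s - \<i> * t\<close>. The bound \<open>R / 2\<close> on \<open>w\<close>
    and \<open>w'\<close> keeps \<open>s\<close> and \<open>t\<close> in \<open>?U\<close>.\<close>
  define s where "s = ((w - w0) + cnj (w' - w0)) / 2"
  define t where "t = ((w - w0) - cnj (w' - w0)) / (2 * \<i>)"
  have "cmod ((w - w0) + cnj (w' - w0)) < R" "cmod ((w - w0) - cnj (w' - w0)) < R"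
    using w norm_triangle_ineq[of "w - w0" "cnj (w' - w0)"] norm_triangle_ineq4[of "w - w0" "cnj (w' - w0)"]
    by (auto simp: dist_norm norm_minus_commute simp del: complex_cnj_diff)
  then have st: "s \<in> ?U" "t \<in> ?U"
    by (auto simp: s_def t_def norm_divide norm_mult)
  have "s + \<i> * t = w - w0" "s - \<i> * t = cnj (w' - w0)"
    by (auto simp: s_def t_def field_simps)
  then have "p s t = w" "q s t = w0 + cnj (cnj (w' - w0))"
    by (simp_all only: p_def q_def) simp
  then have "p s t = w" "q s t = w'"
    by simp_all
  with J2'[OF st] show ?thesis
    by (simp add: J_def)
qed

section \<open>Moments against powers of the symbol and its conjugate\<close>

locale commutant =
  fixes B :: "complex \<Rightarrow> complex" and T :: "bergman \<Rightarrow> bergman"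
  assumes B_holomorphic: "B holomorphic_on \<bbbD>"
    and B_less_1: "z \<in> \<bbbD> \<Longrightarrow> cmod (B z) < 1"
    and T: "T \<in> \<V>\<^sup>* B"
begin

abbreviation "S \<equiv> cadjoint T"

lemma B_bounded: "bounded_holomorphic B"
  unfolding bounded_holomorphic_def bounded_iff using B_holomorphic B_less_1 less_imp_le by blast

lemma T_bounded: "bounded_operator T"
  using T by (simp add: von_Neumann_algebra_def)

lemma T_mult: "T (mult_op B f) = mult_op B (T f)"
  using T by (auto simp: von_Neumann_algebra_def fun_eq_iff)

lemma T_adjoint_mult: "T (cadjoint (mult_op B) f) = cadjoint (mult_op B) (T f)"
  using T by (auto simp: von_Neumann_algebra_def fun_eq_iff)

text \<open>Adjoints are taken in the relation between \<open>T\<close> and the adjoint of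
  \<open>mult_op B\<close>. This is where commuting with both operators enters: powers of
  \<open>B\<close> now pass through \<open>T\<close> and through its adjoint alike.\<close>

lemma S_mult: "S (mult_op B g) = mult_op B (S g)"
proof (rule cinner_eqI)
  fix h
  note M = bounded_operator_mult_op[OF B_bounded]
  show "cinner h (S (mult_op B g)) = cinner h (mult_op B (S g))"
    by (simp add: cadjoint[OF T_bounded, symmetric] cadjoint_right[OF M] T_adjoint_mult[symmetric])
qed

lemma Rep_mult_power: "Rep_bergman ((mult_op B ^^ n) f) z = B z ^ n * Rep_bergman f z"
  by (induction n) (simp_all add: Rep_mult_op[OF B_bounded])

lemma T_mult_power: "T ((mult_op B ^^ n) f) = (mult_op B ^^ n) (T f)"
  by (induction n) (simp_all add: T_mult)

lemma S_mult_power: "S ((mult_op B ^^ n) f) = (mult_op B ^^ n) (S f)"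
  by (induction n) (simp_all add: S_mult)

text \<open>Integrals of \<open>defect f g\<close> against \<open>B ^ m * cnj B ^ n\<close> are differences
  \<open>\<langle>T (B\<^sup>m f), B\<^sup>n g\<rangle> - \<langle>B\<^sup>m f, S (B\<^sup>n g)\<rangle> = 0\<close>. By density of polynomials in \<open>w\<close> and
  \<open>cnj w\<close>, its sum over the fibres of \<open>B\<close>, with the Jacobian as weight, vanishes identically.\<close>

definition defect :: "bergman \<Rightarrow> bergman \<Rightarrow> complex \<Rightarrow> complex" where
  "defect f g z = Rep_bergman (T f) z * cnj (Rep_bergman g z) -
     Rep_bergman f z * cnj (Rep_bergman (S g) z)"

definition moment_free :: "(complex \<Rightarrow> complex) set" where
  "moment_free = {\<Psi>. continuous_on \<bbbD> \<Psi> \<and> set_integrable lborel \<bbbD> \<Psi> \<and>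
     (\<forall>m n. (LINT z:\<bbbD>|lborel. B z ^ m * cnj (B z) ^ n * \<Psi> z) = 0)}"

lemma set_integrable_bounded_mult:
  fixes b \<Psi> :: "complex \<Rightarrow> complex"
  assumes "continuous_on \<bbbD> b" "\<And>z. z \<in> \<bbbD> \<Longrightarrow> cmod (b z) \<le> K"
    and \<Psi>: "continuous_on \<bbbD> \<Psi>" "set_integrable lborel \<bbbD> \<Psi>"
  shows "set_integrable lborel \<bbbD> (\<lambda>z. b z * \<Psi> z)"
proof (rule set_integrable_bound)
  show "set_integrable lborel \<bbbD> (\<lambda>z. of_real K * \<Psi> z)"
    by (intro set_integrable_mult_right \<Psi>)
  have "continuous_on \<bbbD> (\<lambda>z. b z * \<Psi> z)"
    by (intro continuous_intros assms)
  from borel_measurable_continuous_on_indicator[OF _ this]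
  show "set_borel_measurable lborel \<bbbD> (\<lambda>z. b z * \<Psi> z)"
    by (simp add: set_borel_measurable_def)
  have "norm (b z * \<Psi> z) \<le> norm (of_real K * \<Psi> z)" if "z \<in> \<bbbD>" for z
  proof -
    have "cmod (b z) \<le> \<bar>K\<bar>"
      using assms(2)[OF that] by simp
    then show ?thesis
      by (simp add: norm_mult mult_right_mono)
  qed
  then show "AE z in lborel. z \<in> \<bbbD> \<longrightarrow> norm (b z * \<Psi> z) \<le> norm (of_real K * \<Psi> z)"
    by simp
qed

lemma continuous_B: "continuous_on \<bbbD> B"
  by (rule holomorphic_on_imp_continuous_on[OF B_holomorphic])

lemma moment_free_integrable:
  assumes "\<Psi> \<in> moment_free"
  shows "set_integrable lborel \<bbbD> (\<lambda>z. B z ^ m * cnj (B z) ^ n * \<Psi> z)"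
proof (rule set_integrable_bounded_mult[of _ 1])
  show "cmod (B z ^ m * cnj (B z) ^ n) \<le> 1" if "z \<in> \<bbbD>" for z
    using B_less_1[OF that] by (auto simp: norm_mult norm_power intro!: mult_le_one power_le_one)
qed (use assms in \<open>auto simp: moment_free_def intro!: continuous_intros continuous_B\<close>)

lemma moment_free_mult_B: "\<Psi> \<in> moment_free \<Longrightarrow> (\<lambda>z. B z * \<Psi> z) \<in> moment_free"
proof -
  assume \<Psi>: "\<Psi> \<in> moment_free"
  have eq: "B z ^ m * cnj (B z) ^ n * (B z * \<Psi> z) = B z ^ Suc m * cnj (B z) ^ n * \<Psi> z" for m n z
    by (simp add: mult_ac)
  show ?thesis
    using \<Psi> moment_free_integrable[OF \<Psi>, of 1 0] unfolding moment_free_def mem_Collect_eq eq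
    by (auto intro!: continuous_intros continuous_B simp del: power_Suc)
qed

lemma moment_free_mult_cnj_B: "\<Psi> \<in> moment_free \<Longrightarrow> (\<lambda>z. cnj (B z) * \<Psi> z) \<in> moment_free"
proof -
  assume \<Psi>: "\<Psi> \<in> moment_free"
  have eq: "B z ^ m * cnj (B z) ^ n * (cnj (B z) * \<Psi> z) = B z ^ m * cnj (B z) ^ Suc n * \<Psi> z" for m n z
    by (simp add: mult_ac)
  show ?thesis
    using \<Psi> moment_free_integrable[OF \<Psi>, of 0 1] unfolding moment_free_def mem_Collect_eq eq
    by (auto intro!: continuous_intros continuous_B simp del: power_Suc)
qed

lemma moment_free_scale: "\<Psi> \<in> moment_free \<Longrightarrow> (\<lambda>z. c * \<Psi> z) \<in> moment_free"
proof -
  assume \<Psi>: "\<Psi> \<in> moment_free"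
  have eq: "B z ^ m * cnj (B z) ^ n * (c * \<Psi> z) = c * (B z ^ m * cnj (B z) ^ n * \<Psi> z)" for m n z
    by (simp add: mult_ac)
  show ?thesis
    using \<Psi> unfolding moment_free_def mem_Collect_eq eq
    by (auto intro!: continuous_intros continuous_B)
qed

lemma moment_free_add:
  assumes "\<Psi> \<in> moment_free" "\<Phi> \<in> moment_free"
  shows "(\<lambda>z. \<Psi> z + \<Phi> z) \<in> moment_free"
proof -
  have eq: "B z ^ m * cnj (B z) ^ n * (\<Psi> z + \<Phi> z) =
      B z ^ m * cnj (B z) ^ n * \<Psi> z + B z ^ m * cnj (B z) ^ n * \<Phi> z" for m n z
    by (simp add: algebra_simps)
  show ?thesis
    using assms moment_free_integrable[OF assms(1)] moment_free_integrable[OF assms(2)]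
    unfolding moment_free_def mem_Collect_eq eq
    by (auto intro!: continuous_intros continuous_B set_integral_add)
qed

text \<open>\<open>moment_free\<close> is closed under linear combinations and under multiplication
  by \<open>B\<close> and its conjugate, and a real linear function of \<open>w\<close> is a
  combination of \<open>w\<close> and \<open>cnj w\<close>.\<close>

lemma moment_free_polynomial:
  "real_polynomial_function \<phi> \<Longrightarrow> \<Psi> \<in> moment_free \<Longrightarrow> (\<lambda>z. of_real (\<phi> (B z)) * \<Psi> z) \<in> moment_free"
proof (induction \<phi> arbitrary: \<Psi> rule: real_polynomial_function.induct)
  case (linear \<phi>)
  \<comment> \<open>Obtained from \<open>\<phi> w = Re w * \<phi> 1 + Im w * \<phi> \<i>\<close> by
    writing the real and imaginary parts through \<open>w\<close> and \<open>cnj w\<close>.\<close>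
  define c where "c = (of_real (\<phi> 1) - \<i> * of_real (\<phi> \<i>)) / 2"
  have c: "of_real (\<phi> w) = c * w + cnj c * cnj w" for w
  proof -
    have "\<phi> w = \<phi> (Re w *\<^sub>R 1 + Im w *\<^sub>R \<i>)"
      by (rule arg_cong[of _ _ \<phi>]) (simp add: complex_eq_iff)
    also have "\<dots> = Re w * \<phi> 1 + Im w * \<phi> \<i>"
      by (simp only: linear_add[OF bounded_linear.linear[OF linear(1)]]
          linear_scale[OF bounded_linear.linear[OF linear(1)]] real_scaleR_def)
    finally have "\<phi> w = Re w * \<phi> 1 + Im w * \<phi> \<i>" .
    then show ?thesis
      by (simp add: c_def complex_eq_iff field_simps)
  qed
  have "(\<lambda>z. c * (B z * \<Psi> z) + cnj c * (cnj (B z) * \<Psi> z)) \<in> moment_free"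
    by (intro moment_free_add moment_free_scale moment_free_mult_B moment_free_mult_cnj_B linear)
  then show ?case
    by (simp add: c algebra_simps)
next
  case (const c)
  then show ?case
    by (rule moment_free_scale)
next
  case (add \<phi> \<phi>')
  then have "(\<lambda>z. of_real (\<phi> (B z)) * \<Psi> z + of_real (\<phi>' (B z)) * \<Psi> z) \<in> moment_free"
    by (intro moment_free_add)
  then show ?case
    by (simp add: algebra_simps)
next
  case (mult \<phi> \<phi>')
  then have "(\<lambda>z. of_real (\<phi> (B z)) * (of_real (\<phi>' (B z)) * \<Psi> z)) \<in> moment_free"
    by blast
  then show ?case
    by (simp add: mult.assoc)
qed

lemma continuous_Rep: "continuous_on \<bbbD> (Rep_bergman f)"
  by (rule holomorphic_on_imp_continuous_on[OF Rep_bergman_holomorphic])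

lemma defect_moment_free: "defect f g \<in> moment_free"
proof -
  have int: "set_integrable lborel \<bbbD> (\<lambda>z. Rep_bergman h z * cnj (Rep_bergman k z))" for h k
    by (intro set_integrable_mult_cnj Rep_bergman)
  have "(LINT z:\<bbbD>|lborel. B z ^ m * cnj (B z) ^ n * defect f g z) = 0" for m n
  proof -
    have eq: "B z ^ m * cnj (B z) ^ n * defect f g z =
        Rep_bergman ((mult_op B ^^ m) (T f)) z * cnj (Rep_bergman ((mult_op B ^^ n) g) z) -
        Rep_bergman ((mult_op B ^^ m) f) z * cnj (Rep_bergman ((mult_op B ^^ n) (S g)) z)" for z
      by (simp add: Rep_mult_power defect_def algebra_simps)
    have "cinner ((mult_op B ^^ m) (T f)) ((mult_op B ^^ n) g)
        = cinner ((mult_op B ^^ m) f) ((mult_op B ^^ n) (S g))"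
      unfolding T_mult_power[symmetric] S_mult_power[symmetric] by (rule cadjoint[OF T_bounded])
    then show ?thesis
      unfolding eq set_integral_diff(2)[OF int int] cinner.rep_eq by simp
  qed
  moreover have "set_integrable lborel \<bbbD> (defect f g)"
    unfolding defect_def by (intro set_integral_diff int)
  moreover have "continuous_on \<bbbD> (defect f g)"
    unfolding defect_def by (intro continuous_intros continuous_Rep)
  ultimately show ?thesis
    by (simp add: moment_free_def)
qed

text \<open>Stone-Weierstrass on the closed disk, which contains all values of \<open>B\<close>: a
  uniform error of the test function costs at most that error times the integral of
  \<open>cmod (\<Psi> z)\<close>.\<close>

lemma moment_free_continuous:
  assumes \<Psi>: "\<Psi> \<in> moment_free" and \<phi>: "continuous_on (cball 0 1) \<phi>"
  shows "(LINT z:\<bbbD>|lborel. of_real (\<phi> (B z)) * \<Psi> z) = 0"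
proof -
  have cont: "continuous_on \<bbbD> \<Psi>" and int: "set_integrable lborel \<bbbD> \<Psi>"
    using \<Psi> by (auto simp: moment_free_def)
  define I where "I = (LINT z:\<bbbD>|lborel. cmod (\<Psi> z))"
  have intn: "set_integrable lborel \<bbbD> (\<lambda>z. cmod (\<Psi> z))"
    using set_integrable_norm[OF int] .
  have "I \<ge> 0"
    unfolding I_def set_lebesgue_integral_def by (intro integral_nonneg_AE) auto
  have Bc: "B z \<in> cball 0 1" if "z \<in> \<bbbD>" for z
    using B_less_1[OF that] by simp
  have cont\<phi>: "continuous_on \<bbbD> (\<lambda>z. complex_of_real (\<phi> (B z)))"
    using Bc by (intro continuous_intros continuous_on_compose2[OF \<phi> continuous_B]) auto
  obtain K where K: "\<And>w. w \<in> cball 0 1 \<Longrightarrow> norm (\<phi> w) \<le> K"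
    using compact_imp_bounded[OF compact_continuous_image[OF \<phi> compact_cball]]
    unfolding bounded_iff by blast
  have int\<phi>: "set_integrable lborel \<bbbD> (\<lambda>z. of_real (\<phi> (B z)) * \<Psi> z)"
    using K Bc by (intro set_integrable_bounded_mult[of _ K] cont\<phi> cont int) auto
  have "cmod (LINT z:\<bbbD>|lborel. of_real (\<phi> (B z)) * \<Psi> z) \<le> e" if e: "e > 0" for e
  proof -
    \<comment> \<open>The summand 1 guards against \<open>I = 0\<close>.\<close>
    define e' where "e' = e / (I + 1)"
    have e': "e' > 0" "e' * I \<le> e"
      using e \<open>I \<ge> 0\<close> by (auto simp: e'_def field_simps)
    obtain g where g: "real_polynomial_function g" "\<And>w. w \<in> cball 0 1 \<Longrightarrow> \<bar>\<phi> w - g w\<bar> < e'"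
      using Stone_Weierstrass_real_polynomial_function[OF compact_cball \<phi> e'(1)] by blast
    have gm: "(\<lambda>z. of_real (g (B z)) * \<Psi> z) \<in> moment_free"
      by (rule moment_free_polynomial[OF g(1) \<Psi>])
    have intg: "set_integrable lborel \<bbbD> (\<lambda>z. of_real (g (B z)) * \<Psi> z)"
      using gm by (simp add: moment_free_def)
    have int0: "(LINT z:\<bbbD>|lborel. of_real (g (B z)) * \<Psi> z) = 0"
    proof -
      have "\<forall>m n. (LINT z:\<bbbD>|lborel. B z ^ m * cnj (B z) ^ n * (of_real (g (B z)) * \<Psi> z)) = 0"
        using gm unfolding moment_free_def by blast
      from spec[OF spec[OF this, of 0], of 0] show ?thesis
        by simp
    qed
    have "cmod (LINT z:\<bbbD>|lborel. of_real (\<phi> (B z)) * \<Psi> z)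
        = cmod (LINT z:\<bbbD>|lborel. of_real (\<phi> (B z)) * \<Psi> z - of_real (g (B z)) * \<Psi> z)"
      by (simp add: set_integral_diff(2)[OF int\<phi> intg] int0)
    also have "\<dots> \<le> (LINT z:\<bbbD>|lborel. cmod (of_real (\<phi> (B z)) * \<Psi> z - of_real (g (B z)) * \<Psi> z))"
      by (intro set_integral_norm_bound set_integral_diff int\<phi> intg)
    also have "\<dots> \<le> (LINT z:\<bbbD>|lborel. e' * cmod (\<Psi> z))"
    proof (intro set_integral_mono set_integrable_norm set_integral_diff(1) int\<phi> intg
        set_integrable_mult_right intn)
      fix z assume "z \<in> \<bbbD>"
      then have "\<bar>\<phi> (B z) - g (B z)\<bar> \<le> e'"
        using g(2)[OF Bc] less_imp_le by blast
      then have "cmod (of_real (\<phi> (B z) - g (B z)) * \<Psi> z) \<le> e' * cmod (\<Psi> z)"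
        by (simp add: norm_mult mult_right_mono del: of_real_diff)
      then show "cmod (of_real (\<phi> (B z)) * \<Psi> z - of_real (g (B z)) * \<Psi> z) \<le> e' * cmod (\<Psi> z)"
        by (simp add: algebra_simps)
    qed (use int in auto)
    also have "\<dots> = e' * I"
      by (simp add: I_def)
    finally show ?thesis
      using e'(2) by linarith
  qed
  then have "cmod (LINT z:\<bbbD>|lborel. of_real (\<phi> (B z)) * \<Psi> z) \<le> 0"
    by (rule field_le_epsilon) simp
  then show ?thesis
    by simp
qed

end

section \<open>Pullbacks along the sheets of an evenly covered disk\<close>

lemma deriv_section:
  assumes B: "B holomorphic_on \<bbbD>"
    and N: "open N" "\<tau> holomorphic_on N" "\<And>w. w \<in> N \<Longrightarrow> \<tau> w \<in> \<bbbD> \<and> B (\<tau> w) = w" and w: "w \<in> N"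
  shows "deriv B (\<tau> w) * deriv \<tau> w = 1"
proof -
  have "(\<tau> has_field_derivative deriv \<tau> w) (at w)"
    by (rule holomorphic_derivI[OF N(2,1) w])
  moreover have "(B has_field_derivative deriv B (\<tau> w)) (at (\<tau> w))"
    by (rule holomorphic_derivI[OF B open_ball]) (use N(3)[OF w] in blast)
  ultimately have "((\<lambda>w. B (\<tau> w)) has_field_derivative deriv B (\<tau> w) * deriv \<tau> w) (at w)"
    using DERIV_chain2 by blast
  moreover have "((\<lambda>w. B (\<tau> w)) has_field_derivative 1) (at w)"
    by (rule DERIV_cong_ev[THEN iffD2, OF refl _ refl DERIV_ident])
      (use N w in \<open>auto intro!: eventually_nhds_in_open[THEN eventually_mono, of N]\<close>)
  ultimately show ?thesis
    by (rule DERIV_unique)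
qed

text \<open>The sections list every fibre over the disk without repetition. The fibres to be treated
  are countably infinite, so \<open>nat\<close> can index the sheets.\<close>

locale even_cover =
  fixes B :: "complex \<Rightarrow> complex" and \<tau> :: "nat \<Rightarrow> complex \<Rightarrow> complex" and w0 :: complex and \<rho> :: real
  assumes B_hol: "B holomorphic_on \<bbbD>"
    and \<rho>_pos: "\<rho> > 0"
    and \<tau>_hol: "\<tau> n holomorphic_on ball w0 \<rho>"
    and \<tau>_in: "w \<in> ball w0 \<rho> \<Longrightarrow> \<tau> n w \<in> \<bbbD>"
    and B_\<tau>: "w \<in> ball w0 \<rho> \<Longrightarrow> B (\<tau> n w) = w"
    and \<tau>_inj: "w \<in> ball w0 \<rho> \<Longrightarrow> \<tau> n w = \<tau> m w \<Longrightarrow> n = m"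
    and \<tau>_cover: "z \<in> \<bbbD> \<Longrightarrow> B z \<in> ball w0 \<rho> \<Longrightarrow> \<exists>n. z = \<tau> n (B z)"
begin

abbreviation "N \<equiv> ball w0 \<rho>"

lemma \<tau>_inj_on: "inj_on (\<tau> n) N"
  by (rule inj_onI) (metis B_\<tau>)

lemma open_sheet: "open (\<tau> n ` N)"
  by (rule open_mapping_thm3[OF \<tau>_hol open_ball \<tau>_inj_on])

lemma sheet_subset: "\<tau> n ` N \<subseteq> \<bbbD>"
  using \<tau>_in by blast

lemma sheets_disjoint: "n \<noteq> m \<Longrightarrow> \<tau> n ` N \<inter> \<tau> m ` N = {}"
  using B_\<tau> \<tau>_inj by (auto) metis

lemma deriv_B_\<tau>: "w \<in> N \<Longrightarrow> deriv B (\<tau> n w) * deriv (\<tau> n) w = 1"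
  by (rule deriv_section[OF B_hol open_ball \<tau>_hol]) (use \<tau>_in B_\<tau> in blast)+

text \<open>The pullback of the differential \<open>f dz\<close> under a section. With the
  derivative as a factor, the integrals of the squared moduli over all sheets add up to the area
  integral of the squared modulus of \<open>f\<close> over the preimage of the disk.\<close>

definition pull :: "bergman \<Rightarrow> nat \<Rightarrow> complex \<Rightarrow> complex" where
  "pull f n w = Rep_bergman f (\<tau> n w) * deriv (\<tau> n) w"

lemma pull_holomorphic: "pull f n holomorphic_on N"
  unfolding pull_def
  by (intro holomorphic_on_mult holomorphic_deriv \<tau>_hol open_ball
      holomorphic_on_compose_gen[OF \<tau>_hol Rep_bergman_holomorphic, unfolded comp_def] sheet_subset)

text \<open>On the half disk the pullback to a sheet is controlled by the area integral over that
  sheet, and since the sheets are disjoint these integrals have a finite sum. Square summability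
  uniform in \<open>w\<close> makes the sums over fibres converge uniformly.\<close>

lemma pull_bound:
  obtains A where "\<And>n w. w \<in> ball w0 (\<rho> / 2) \<Longrightarrow> cmod (pull f n w) \<le> A n"
    "\<And>n. A n \<ge> 0" "summable (\<lambda>n. (A n)\<^sup>2)"
proof -
  define h where "h = (\<lambda>z. (cmod (Rep_bergman f z))\<^sup>2)"
  have h_int: "set_integrable lborel \<bbbD> h"
    unfolding h_def by (rule Rep_bergman_square_integrable)
  have h_int': "set_integrable lborel (\<tau> n ` N) h" for n
    using set_integrable_subset[OF h_int _ sheet_subset] open_sheet by simp
  have h_cont: "continuous_on (\<tau> n ` N) h" for n
    unfolding h_def
    by (intro continuous_intros continuous_on_subset[OF _ sheet_subset] holomorphic_on_imp_continuous_on
        Rep_bergman_holomorphic)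
  define I where "I = (\<lambda>n. LINT z:\<tau> n ` N|lborel. h z)"
  have I_nonneg: "I n \<ge> 0" for n
    unfolding I_def set_lebesgue_integral_def h_def by (intro integral_nonneg_AE) auto
  have "summable I"
  proof (rule summableI_nonneg_bounded[OF I_nonneg])
    fix k
    have "(\<Sum>n<k. I n) = (LINT z:(\<Union>n\<in>{..<k}. \<tau> n ` N)|lborel. h z)"
      unfolding I_def using sheets_disjoint open_sheet h_int'
      by (subst set_integral_finite_Union) (auto simp: disjoint_family_on_def)
    also have "\<dots> \<le> (LINT z:\<bbbD>|lborel. h z)"
      using sheet_subset open_sheet
      by (intro set_integral_nonneg_mono h_int) (auto simp: h_def intro!: sets.finite_UN)
    finally show "(\<Sum>n<k. I n) \<le> (LINT z:\<bbbD>|lborel. h z)" .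
  qed
  have eq: "(cmod (deriv (\<tau> n) w))\<^sup>2 * h (\<tau> n w) = (cmod (pull f n w))\<^sup>2" for n w
    by (simp add: h_def pull_def norm_mult power_mult_distrib)
  note cov = real_change_of_variables[OF open_ball \<tau>_hol \<tau>_inj_on h_cont h_int', unfolded eq]
  \<comment> \<open>The mean value bound needs a radius strictly below that of a disk of holomorphy:
    about a point of the half disk, \<open>\<rho> / 2\<close> still fits into \<open>N\<close>, and
    \<open>\<rho> / 4\<close> is below it.\<close>
  define m where "m = measure lborel (ball (0 :: complex) (\<rho> / 4))"
  have m: "m > 0"
    using measure_ball_pos \<rho>_pos by (simp add: m_def)
  show ?thesis
  proof
    fix n w assume w: "w \<in> ball w0 (\<rho> / 2)"
    have sub: "ball w (\<rho> / 2) \<subseteq> N"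
    proof
      fix u assume "u \<in> ball w (\<rho> / 2)"
      then show "u \<in> N"
        using w dist_triangle[of w0 u w] by simp
    qed
    have sub': "ball w (\<rho> / 4) \<subseteq> N"
      using sub \<rho>_pos subset_ball[of "\<rho> / 4" "\<rho> / 2" w] by auto
    have "m * (cmod (pull f n w))\<^sup>2 \<le> (LINT u:ball w (\<rho> / 4)|lborel. (cmod (pull f n u))\<^sup>2)"
      using area_mean_bound[OF holomorphic_on_subset[OF pull_holomorphic sub], of "\<rho> / 4" f n] \<rho>_pos
      by (simp add: m_def content_ball)
    also have "\<dots> \<le> (LINT u:N|lborel. (cmod (pull f n u))\<^sup>2)"
      using sub' by (intro set_integral_nonneg_mono cov(1)) auto
    also have "\<dots> = I n"
      by (simp add: I_def cov(2))
    finally have "(cmod (pull f n w))\<^sup>2 \<le> I n / m"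
      using m by (simp add: field_simps)
    then show "cmod (pull f n w) \<le> sqrt (I n / m)"
      by (simp add: real_le_rsqrt)
  next
    show "sqrt (I n / m) \<ge> 0" for n
      using I_nonneg m by simp
    show "summable (\<lambda>n. (sqrt (I n / m))\<^sup>2)"
      using I_nonneg m \<open>summable I\<close> by (simp add: summable_divide)
  qed
qed

end

section \<open>The commutation relation on a single fibre\<close>

locale commutant_cover = commutant B T + even_cover B \<tau> w0 \<rho> for B T \<tau> w0 \<rho>
begin

text \<open>For \<open>w = w'\<close> this is \<open>defect\<close> on sheet \<open>n\<close> times
  the Jacobian of the section. Two base points are kept because each term is holomorphic in
  \<open>w\<close> and antiholomorphic in \<open>w'\<close>, so that polarization applies.\<close>

definition fibre_defect :: "bergman \<Rightarrow> bergman \<Rightarrow> nat \<Rightarrow> complex \<Rightarrow> complex \<Rightarrow> complex" where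
  "fibre_defect f g n w w' = pull (T f) n w * cnj (pull g n w') - pull f n w * cnj (pull (S g) n w')"

lemma fibre_defect_bound:
  obtains M where "\<And>n w w'. w \<in> ball w0 (\<rho> / 2) \<Longrightarrow> w' \<in> ball w0 (\<rho> / 2) \<Longrightarrow>
      cmod (fibre_defect f g n w w') \<le> M n" "summable M"
proof -
  obtain A1 where A1: "\<And>n w. w \<in> ball w0 (\<rho> / 2) \<Longrightarrow> cmod (pull (T f) n w) \<le> A1 n"
    "\<And>n. A1 n \<ge> 0" "summable (\<lambda>n. (A1 n)\<^sup>2)"
    using pull_bound[of "T f"] by blast
  obtain A2 where A2: "\<And>n w. w \<in> ball w0 (\<rho> / 2) \<Longrightarrow> cmod (pull g n w) \<le> A2 n"
    "\<And>n. A2 n \<ge> 0" "summable (\<lambda>n. (A2 n)\<^sup>2)"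
    using pull_bound[of g] by blast
  obtain A3 where A3: "\<And>n w. w \<in> ball w0 (\<rho> / 2) \<Longrightarrow> cmod (pull f n w) \<le> A3 n"
    "\<And>n. A3 n \<ge> 0" "summable (\<lambda>n. (A3 n)\<^sup>2)"
    using pull_bound[of f] by blast
  obtain A4 where A4: "\<And>n w. w \<in> ball w0 (\<rho> / 2) \<Longrightarrow> cmod (pull (S g) n w) \<le> A4 n"
    "\<And>n. A4 n \<ge> 0" "summable (\<lambda>n. (A4 n)\<^sup>2)"
    using pull_bound[of "S g"] by blast
  define M where "M = (\<lambda>n. ((A1 n)\<^sup>2 + (A2 n)\<^sup>2) + ((A3 n)\<^sup>2 + (A4 n)\<^sup>2))"
  have am: "x * y \<le> x\<^sup>2 + y\<^sup>2" if "0 \<le> x" "0 \<le> y" for x y :: real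
    using sum_squares_bound[of x y] mult_nonneg_nonneg[OF that] by linarith
  show ?thesis
  proof (rule that[of M])
    show "summable M"
      unfolding M_def by (intro summable_add A1 A2 A3 A4)
    fix n w w' assume w: "w \<in> ball w0 (\<rho> / 2)" "w' \<in> ball w0 (\<rho> / 2)"
    have "cmod (fibre_defect f g n w w') \<le>
        cmod (pull (T f) n w) * cmod (pull g n w') + cmod (pull f n w) * cmod (pull (S g) n w')"
      unfolding fibre_defect_def by (rule order_trans[OF norm_triangle_ineq4]) (simp add: norm_mult)
    also have "\<dots> \<le> A1 n * A2 n + A3 n * A4 n"
      by (intro add_mono mult_mono A1 A2 A3 A4 w norm_ge_zero)
    also have "\<dots> \<le> M n"
      unfolding M_def by (intro add_mono am A1 A2 A3 A4)
    finally show "cmod (fibre_defect f g n w w') \<le> M n" .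
  qed
qed

lemma fibre_defect_continuous: "continuous_on N (\<lambda>w. fibre_defect f g n w w)"
  unfolding fibre_defect_def
  by (intro continuous_intros holomorphic_on_imp_continuous_on pull_holomorphic)

lemma fibre_defect_defect:
  "fibre_defect f g n w w = (cmod (deriv (\<tau> n) w))\<^sup>2 *\<^sub>R defect f g (\<tau> n w)"
proof -
  have "complex_of_real ((cmod (deriv (\<tau> n) w))\<^sup>2) = deriv (\<tau> n) w * cnj (deriv (\<tau> n) w)"
    by (rule complex_norm_square)
  then show ?thesis
    unfolding fibre_defect_def defect_def pull_def scaleR_conv_of_real
    by (simp add: algebra_simps)
qed

text \<open>The integral of \<open>\<phi> (B z) * defect f g z\<close> over the disk vanishes. Its
  integrand lives on the disjoint sheets, and a change of variables moves each part to the base.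
  Support in the half disk is imposed because the summable majorant for exchanging sum and integral
  is available there.\<close>

lemma fibre_defect_integral:
  fixes \<phi> :: "complex \<Rightarrow> real"
  assumes \<phi>: "continuous_on UNIV \<phi>" and \<phi>0: "\<And>w. w \<notin> ball w0 (\<rho> / 2) \<Longrightarrow> \<phi> w = 0"
  shows "(LINT w:ball w0 (\<rho> / 2)|lborel. of_real (\<phi> w) * (\<Sum>n. fibre_defect f g n w w)) = 0"
    and "set_integrable lborel (ball w0 (\<rho> / 2)) (\<lambda>w. of_real (\<phi> w) * (\<Sum>n. fibre_defect f g n w w))"
proof -
  let ?V = "ball w0 (\<rho> / 2)"
  have VN: "?V \<subseteq> N"
    using \<rho>_pos by (intro subset_ball) simp
  define F where "F = (\<lambda>z. of_real (\<phi> (B z)) * defect f g z)"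
  obtain K where K: "\<And>w. w \<in> cball 0 1 \<Longrightarrow> norm (\<phi> w) \<le> K"
    using compact_imp_bounded[OF compact_continuous_image[OF continuous_on_subset[OF \<phi>] compact_cball]]
    unfolding bounded_iff by blast
  have cont_defect: "continuous_on \<bbbD> (defect f g)" and int_defect: "set_integrable lborel \<bbbD> (defect f g)"
    using defect_moment_free[of f g] by (auto simp: moment_free_def)
  have F_cont: "continuous_on \<bbbD> F"
    unfolding F_def
    by (intro continuous_intros cont_defect continuous_on_compose2[OF \<phi> continuous_B]) auto
  have F_int: "set_integrable lborel \<bbbD> F"
    unfolding F_def using K B_less_1 less_imp_le
    by (intro set_integrable_bounded_mult[of _ K] cont_defect int_defect continuous_intros
        continuous_on_compose2[OF \<phi> continuous_B]) auto
  have F0: "(LINT z:\<bbbD>|lborel. F z) = 0"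
    unfolding F_def by (rule moment_free_continuous[OF defect_moment_free continuous_on_subset[OF \<phi>]]) simp
  define A where "A = (\<Union>n. \<tau> n ` N)"
  have A: "A \<subseteq> \<bbbD>" "open A"
    using sheet_subset open_sheet by (auto simp: A_def)
  have F_outside: "F z = 0" if "z \<in> \<bbbD>" "z \<notin> A" for z
  proof -
    have "B z \<notin> N"
      using \<tau>_cover[of z] that unfolding A_def by blast
    then have "\<phi> (B z) = 0"
      using VN by (intro \<phi>0) blast
    then show ?thesis
      by (simp add: F_def)
  qed
  have "(LINT z:\<bbbD>|lborel. F z) = (LINT z:A|lborel. F z)"
    unfolding set_lebesgue_integral_def
    by (rule Bochner_Integration.integral_cong) (use A F_outside in \<open>auto simp: indicator_def\<close>)
  also have "\<dots> = (\<Sum>n. LINT z:\<tau> n ` N|lborel. F z)"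
    unfolding A_def
  proof (rule lebesgue_integral_countable_add)
    show "set_integrable lborel (\<Union>n. \<tau> n ` N) F"
      using set_integrable_subset[OF F_int _ A(1)] A(2) by (simp add: A_def)
  qed (use open_sheet sheets_disjoint in auto)
  also have "\<dots> = (\<Sum>n. LINT w:?V|lborel. of_real (\<phi> w) * fibre_defect f g n w w)"
  proof (rule suminf_cong)
    fix n
    have "set_integrable lborel (\<tau> n ` N) F"
      using set_integrable_subset[OF F_int _ sheet_subset] open_sheet by simp
    then have "(LINT z:\<tau> n ` N|lborel. F z) = (LINT w:N|lborel. (cmod (deriv (\<tau> n) w))\<^sup>2 *\<^sub>R F (\<tau> n w))"
      by (intro complex_change_of_variables(2) \<tau>_hol \<tau>_inj_on continuous_on_subset[OF F_cont sheet_subset]) simp_all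
    also have "\<dots> = (LINT w:?V|lborel. of_real (\<phi> w) * fibre_defect f g n w w)"
      unfolding set_lebesgue_integral_def
    proof (rule Bochner_Integration.integral_cong)
      fix w
      show "indicat_real N w *\<^sub>R (cmod (deriv (\<tau> n) w))\<^sup>2 *\<^sub>R F (\<tau> n w) =
          indicat_real ?V w *\<^sub>R (of_real (\<phi> w) * fibre_defect f g n w w)"
      proof (cases "w \<in> ?V")
        case True
        then show ?thesis
          using VN B_\<tau>[of w n] by (auto simp: F_def fibre_defect_defect)
      next
        case False
        then show ?thesis
          using \<phi>0[OF False] B_\<tau>[of w n] by (auto simp: F_def indicator_def)
      qed
    qed simp
    finally show "(LINT z:\<tau> n ` N|lborel. F z) = (LINT w:?V|lborel. of_real (\<phi> w) * fibre_defect f g n w w)" .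
  qed
  also have "\<dots> = (\<Sum>n. LINT w|lborel. indicator ?V w *\<^sub>R (of_real (\<phi> w) * fibre_defect f g n w w))"
    by (simp add: set_lebesgue_integral_def)
  finally have sum0: "(\<Sum>n. LINT w|lborel. indicator ?V w *\<^sub>R (of_real (\<phi> w) * fibre_defect f g n w w)) = 0"
    using F0 by simp
  obtain M where M: "\<And>n w w'. w \<in> ?V \<Longrightarrow> w' \<in> ?V \<Longrightarrow> cmod (fibre_defect f g n w w') \<le> M n" "summable M"
    using fibre_defect_bound[of f g] by blast
  have ind: "integrable lborel (indicat_real ?V)"
    using set_integrable_continuous_ball[of w0 "\<rho> / 2" "\<lambda>_. 1 :: real"] by (simp add: set_integrable_def)
  obtain K' where K': "\<And>w. w \<in> cball w0 (\<rho> / 2) \<Longrightarrow> norm (\<phi> w) \<le> K'"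
    using compact_imp_bounded[OF compact_continuous_image[OF continuous_on_subset[OF \<phi>] compact_cball]]
    unfolding bounded_iff by blast
  let ?G = "\<lambda>n w. indicator ?V w *\<^sub>R (of_real (\<phi> w) * fibre_defect f g n w w)"
  have G_bound: "norm (?G n w) \<le> indicator ?V w * (K' * M n)" for n w
  proof (cases "w \<in> ?V")
    case True
    then have "\<bar>\<phi> w\<bar> * cmod (fibre_defect f g n w w) \<le> K' * M n"
      using K'[of w] M(1)[of w w n] by (intro mult_mono) auto
    with True show ?thesis
      by (simp add: norm_mult)
  qed simp
  have G_int: "integrable lborel (?G n)" for n
  proof (rule Bochner_Integration.integrable_bound[OF integrable_mult_left[OF ind]])
    have "continuous_on ?V (\<lambda>w. of_real (\<phi> w) * fibre_defect f g n w w)"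
      by (intro continuous_intros continuous_on_subset[OF fibre_defect_continuous VN]
          continuous_on_subset[OF \<phi>]) simp
    from borel_measurable_continuous_on_indicator[OF _ this]
    show "?G n \<in> borel_measurable lborel"
      by simp
    show "AE w in lborel. norm (?G n w) \<le> norm (indicator ?V w * (K' * M n))"
      using G_bound by (intro AE_I2) (metis norm_ge_zero real_norm_def abs_of_nonneg order_trans)
  qed
  have GM: "(LINT w|lborel. norm (?G n w)) \<le> (measure lborel ?V * K') * M n" for n
  proof -
    have "(LINT w|lborel. norm (?G n w)) \<le> (LINT w|lborel. indicator ?V w * (K' * M n))"
      using G_bound by (intro integral_mono integrable_norm G_int integrable_mult_left ind) auto
    then show ?thesis
      by (simp add: mult.assoc)
  qed
  have ae: "AE w in lborel. summable (\<lambda>n. norm (?G n w))"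
  proof (rule AE_I2)
    fix w
    show "summable (\<lambda>n. norm (?G n w))"
      by (rule summable_comparison_test'[OF summable_mult[OF summable_mult[OF M(2), of K'], of "indicator ?V w"], of 0])
        (use G_bound in auto)
  qed
  have smm: "summable (\<lambda>n. LINT w|lborel. norm (?G n w))"
    by (rule summable_comparison_test'[OF summable_mult[OF M(2), of "measure lborel ?V * K'"], of 0])
      (use GM in auto)
  have eq: "indicator ?V w *\<^sub>R (of_real (\<phi> w) * (\<Sum>n. fibre_defect f g n w w)) = (\<Sum>n. ?G n w)" for w
  proof (cases "w \<in> ?V")
    case True
    have "summable (\<lambda>n. fibre_defect f g n w w)"
      by (rule summable_comparison_test'[OF M(2), of 0]) (use M(1)[OF True True] in auto)
    with True show ?thesis
      by (simp add: suminf_mult)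
  qed simp
  show "(LINT w:?V|lborel. of_real (\<phi> w) * (\<Sum>n. fibre_defect f g n w w)) = 0"
    unfolding set_lebesgue_integral_def eq integral_suminf[OF G_int ae smm] by (rule sum0)
  show "set_integrable lborel ?V (\<lambda>w. of_real (\<phi> w) * (\<Sum>n. fibre_defect f g n w w))"
    unfolding set_integrable_def eq by (rule integrable_suminf[OF G_int ae smm])
qed

text \<open>The fundamental lemma of the calculus of variations: the fibre sum is tested against a
  function manufactured from itself, which makes the integrand continuous and nonnegative.\<close>

lemma fibre_defect_diagonal:
  assumes w: "w \<in> ball w0 (\<rho> / 2)"
  shows "(\<Sum>n. fibre_defect f g n w w) = 0"
proof -
  let ?V = "ball w0 (\<rho> / 2)"
  define Q where "Q = (\<lambda>w. \<Sum>n. fibre_defect f g n w w)"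
  have VN: "?V \<subseteq> N"
    using \<rho>_pos by (intro subset_ball) simp
  obtain M where M: "\<And>n w w'. w \<in> ?V \<Longrightarrow> w' \<in> ?V \<Longrightarrow> cmod (fibre_defect f g n w w') \<le> M n" "summable M"
    using fibre_defect_bound[of f g] by blast
  have Q: "continuous_on ?V Q"
  proof (rule uniform_limit_theorem)
    show "uniform_limit ?V (\<lambda>n w. \<Sum>i<n. fibre_defect f g i w w) Q sequentially"
      unfolding Q_def by (rule Weierstrass_m_test[OF _ M(2)]) (use M(1) in blast)
    show "\<forall>\<^sub>F n in sequentially. continuous_on ?V (\<lambda>w. \<Sum>i<n. fibre_defect f g i w w)"
      by (intro always_eventually allI continuous_intros continuous_on_subset[OF fibre_defect_continuous VN])
  qed simp
  have Qb: "cmod (Q w) \<le> suminf M" if "w \<in> ?V" for w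
    unfolding Q_def
    by (rule order_trans[OF summable_norm suminf_le])
      (use M that in \<open>auto intro: summable_comparison_test'[of M 0]\<close>)
  \<comment> \<open>Test functions are real valued, hence the passage to real linear functionals
    \<open>L\<close>, later taken to be \<open>Re\<close> and \<open>Im\<close>.\<close>
  have main: "L (Q w) = 0" if L: "bounded_linear L" "\<And>x. \<bar>L x\<bar> \<le> cmod x" for L :: "complex \<Rightarrow> real"
  proof -
    \<comment> \<open>The weight is positive inside the half disk and tends to 0 at its boundary; as
      the fibre sum is bounded, extension by 0 is continuous.\<close>
    define \<phi> where "\<phi> = (\<lambda>u. if u \<in> ?V then (\<rho> / 2 - dist w0 u) * L (Q u) else 0)"
    have LQ: "continuous_on ?V (\<lambda>u. L (Q u))"
      by (rule bounded_linear.continuous_on[OF L(1) Q])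
    have \<phi>_bound: "\<bar>\<phi> u\<bar> \<le> \<bar>\<rho> / 2 - dist w0 u\<bar> * \<bar>suminf M\<bar>" for u
      using L(2)[of "Q u"] Qb[of u] by (auto simp: \<phi>_def abs_mult intro!: mult_left_mono)
    have "continuous (at u) \<phi>" for u
    proof -
      consider "u \<in> ?V" | "dist w0 u = \<rho> / 2" | "dist w0 u > \<rho> / 2"
        by fastforce
      then show ?thesis
      proof cases
        case 1
        have "continuous_on ?V \<phi>"
          by (subst continuous_on_cong[OF refl, of _ _ "\<lambda>u. (\<rho> / 2 - dist w0 u) * L (Q u)"])
            (auto simp: \<phi>_def intro!: continuous_intros LQ)
        with 1 show ?thesis
          using continuous_on_eq_continuous_at by blast
      next
        case 2
        then have \<phi>u: "\<phi> u = 0"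
          by (simp add: \<phi>_def)
        have "((\<lambda>x. \<bar>\<rho> / 2 - dist w0 x\<bar> * \<bar>suminf M\<bar>) \<longlongrightarrow> \<bar>\<rho> / 2 - dist w0 u\<bar> * \<bar>suminf M\<bar>) (at u)"
          by (intro tendsto_intros)
        then have "((\<lambda>x. \<bar>\<rho> / 2 - dist w0 x\<bar> * \<bar>suminf M\<bar>) \<longlongrightarrow> 0) (at u)"
          by (simp add: 2)
        then have "(\<phi> \<longlongrightarrow> 0) (at u)"
          by (rule Lim_null_comparison[rotated]) (use \<phi>_bound in auto)
        then show ?thesis
          by (simp add: continuous_at \<phi>u)
      next
        case 3
        have op: "open (- cball w0 (\<rho> / 2))"
          by (intro open_Compl closed_cball)
        have "continuous_on (- cball w0 (\<rho> / 2)) \<phi>"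
          by (subst continuous_on_cong[OF refl, of _ _ "\<lambda>u. 0"]) (auto simp: \<phi>_def)
        moreover have "u \<in> - cball w0 (\<rho> / 2)"
          using 3 by simp
        ultimately show ?thesis
          using continuous_on_eq_continuous_at[OF op] by blast
      qed
    qed
    then have \<phi>: "continuous_on UNIV \<phi>"
      by (simp add: continuous_at_imp_continuous_on)
    have \<phi>0: "\<phi> u = 0" if "u \<notin> ?V" for u
      using that by (simp add: \<phi>_def)
    have I: "(LINT u:?V|lborel. of_real (\<phi> u) * Q u) = 0"
        "set_integrable lborel ?V (\<lambda>u. of_real (\<phi> u) * Q u)"
      unfolding Q_def by (rule fibre_defect_integral[OF \<phi> \<phi>0], assumption)+
    define h where "h = (\<lambda>u. (\<rho> / 2 - dist w0 u) * (L (Q u))\<^sup>2)"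
    have Lh: "L (of_real (\<phi> u) * Q u) = h u" if "u \<in> ?V" for u
    proof -
      have "L (\<phi> u *\<^sub>R Q u) = \<phi> u * L (Q u)"
        using linear_scale[OF bounded_linear.linear[OF L(1)]] by simp
      with that show ?thesis
        by (simp add: h_def \<phi>_def scaleR_conv_of_real power2_eq_square)
    qed
    have ind_h: "indicat_real ?V u *\<^sub>R h u = L (indicat_real ?V u *\<^sub>R (of_real (\<phi> u) * Q u))" for u
      using Lh[of u] linear_0[OF bounded_linear.linear[OF L(1)]] by (auto simp: indicator_def)
    have int_h: "set_integrable lborel ?V h"
      unfolding set_integrable_def ind_h
      by (rule integrable_bounded_linear[OF L(1)]) (use I(2) in \<open>simp add: set_integrable_def\<close>)
    have "(LINT u:?V|lborel. h u) = L (LINT u:?V|lborel. of_real (\<phi> u) * Q u)"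
      unfolding set_lebesgue_integral_def ind_h
      by (rule integral_bounded_linear[OF L(1)]) (use I(2) in \<open>simp add: set_integrable_def\<close>)
    also have "\<dots> = 0"
      unfolding I(1) by (rule linear_0[OF bounded_linear.linear[OF L(1)]])
    finally have "h w = 0"
      by (intro set_integral_eq_0_continuous[OF open_ball _ _ int_h _ w])
        (auto simp: h_def intro!: continuous_intros LQ)
    then show ?thesis
      using w by (simp add: h_def)
  qed
  have "Re (Q w) = 0" "Im (Q w) = 0"
    by (intro main bounded_linear_Re bounded_linear_Im abs_Re_le_cmod abs_Im_le_cmod)+
  then show ?thesis
    by (simp add: Q_def complex_eq_iff)
qed

text \<open>The diagonal case holds on radius \<open>\<rho> / 2\<close>, and polarization halves the
  radius once more.\<close>

lemma fibre_defect_zero: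
  assumes w: "w \<in> ball w0 (\<rho> / 4)" "w' \<in> ball w0 (\<rho> / 4)"
  shows "(\<Sum>n. fibre_defect f g n w w') = 0"
proof -
  have VN: "ball w0 (\<rho> / 2) \<subseteq> N"
    using \<rho>_pos by (intro subset_ball) simp
  obtain M where M: "\<And>n w w'. w \<in> ball w0 (\<rho> / 2) \<Longrightarrow> w' \<in> ball w0 (\<rho> / 2) \<Longrightarrow>
      cmod (fibre_defect f g n w w') \<le> M n" "summable M"
    using fibre_defect_bound[of f g] by blast
  show ?thesis
    unfolding fibre_defect_def
  proof (rule polarization[where R = "\<rho> / 2" and M = M and ?w0.0 = w0])
    show "(\<Sum>n. pull (T f) n w * cnj (pull g n w) - pull f n w * cnj (pull (S g) n w)) = 0"
      if "w \<in> ball w0 (\<rho> / 2)" for w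
      using fibre_defect_diagonal[OF that, of f g] by (simp add: fibre_defect_def)
  qed (use M w in \<open>auto simp: fibre_defect_def[symmetric] intro!: holomorphic_on_subset[OF pull_holomorphic VN]\<close>)
qed

end

section \<open>Matrix entries on a fibre\<close>

context commutant
begin

text \<open>Up to the factor \<open>deriv B \<zeta>\<close>, \<open>peak \<zeta>\<close> is the indicator of \<open>\<zeta>\<close> on the fibre of \<open>\<zeta>\<close>,
  so testing \<open>T\<close> with it isolates a single sheet.\<close>

definition peak :: "complex \<Rightarrow> bergman" where
  "peak \<zeta> = (SOME f. \<forall>z\<in>\<bbbD>. Rep_bergman f z = (if z = \<zeta> then deriv B \<zeta> else (B z - B \<zeta>) / (z - \<zeta>)))"

text \<open>The entry in row \<open>z\<close> and column \<open>\<zeta>\<close> of the matrix by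
  which \<open>T\<close> acts on a fibre. Dividing by \<open>deriv B z\<close> amounts to
  multiplying by the derivative of the section through \<open>z\<close>, so the entry is a value of
  \<open>pull\<close>.\<close>

definition kern :: "complex \<Rightarrow> complex \<Rightarrow> complex" where
  "kern z \<zeta> = Rep_bergman (T (peak \<zeta>)) z / deriv B z"

text \<open>The difference quotient is bounded, near \<open>\<zeta>\<close> by compactness and
  elsewhere by \<open>2 / r\<close> since \<open>cmod (B z) < 1\<close>. Hence it comes from an
  element of the space, and the choice operator has a witness.\<close>

lemma Rep_peak:
  assumes \<zeta>: "\<zeta> \<in> \<bbbD>" and z: "z \<in> \<bbbD>"
  shows "Rep_bergman (peak \<zeta>) z = (if z = \<zeta> then deriv B \<zeta> else (B z - B \<zeta>) / (z - \<zeta>))"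
proof -
  define g where "g = (\<lambda>z. if z = \<zeta> then deriv B \<zeta> else (B z - B \<zeta>) / (z - \<zeta>))"
  have hol: "g holomorphic_on \<bbbD>"
    unfolding g_def by (rule pole_lemma[OF B_holomorphic]) (use \<zeta> in \<open>simp add: interior_open\<close>)
  obtain r where r: "r > 0" "cball \<zeta> r \<subseteq> \<bbbD>"
    using \<zeta> open_contains_cball[of \<bbbD>] open_ball by blast
  have "compact (g ` cball \<zeta> r)"
    by (intro compact_continuous_image holomorphic_on_imp_continuous_on
        holomorphic_on_subset[OF hol r(2)] compact_cball)
  from compact_imp_bounded[OF this] obtain K where K: "\<And>z. z \<in> cball \<zeta> r \<Longrightarrow> cmod (g z) \<le> K"
    unfolding bounded_iff by blast
  have "cmod (g z) \<le> max K (2 / r)" if z: "z \<in> \<bbbD>" for z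
  proof (cases "z \<in> cball \<zeta> r")
    case False
    then have far: "cmod (z - \<zeta>) > r"
      by (simp add: dist_norm norm_minus_commute)
    have "cmod (B z - B \<zeta>) \<le> 2"
      using norm_triangle_ineq4[of "B z" "B \<zeta>"] B_less_1[OF z] B_less_1[OF \<zeta>] by linarith
    then have "cmod (B z - B \<zeta>) / cmod (z - \<zeta>) \<le> 2 / r"
      using far r by (intro frac_le) auto
    then show ?thesis
      using far r by (auto simp: g_def norm_divide)
  qed (use K in \<open>auto simp: le_max_iff_disj\<close>)
  then have "bounded_holomorphic g"
    using hol unfolding bounded_holomorphic_def bounded_iff by blast
  then obtain f where "\<And>z. z \<in> \<bbbD> \<Longrightarrow> Rep_bergman f z = g z"
    using bounded_holomorphic_bergman by blast
  then have "\<exists>f. \<forall>z\<in>\<bbbD>. Rep_bergman f z = g z"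
    by blast
  then have "\<forall>z\<in>\<bbbD>. Rep_bergman (peak \<zeta>) z = g z"
    unfolding peak_def g_def by (rule someI_ex)
  with z show ?thesis
    by (simp add: g_def)
qed

end

context commutant_cover
begin

lemma pull_peak:
  assumes w: "w \<in> N"
  shows "pull (peak (\<tau> j w)) n w = (if n = j then 1 else 0)"
proof (cases "n = j")
  case True
  then show ?thesis
    using deriv_B_\<tau>[OF w, of j] by (simp add: pull_def Rep_peak \<tau>_in[OF w, simplified])
next
  case False
  then have "\<tau> n w \<noteq> \<tau> j w"
    using \<tau>_inj[OF w] by blast
  with False show ?thesis
    by (simp add: pull_def Rep_peak \<tau>_in[OF w, simplified] B_\<tau>[OF w])
qed

lemma kern_pull:
  assumes w: "w \<in> N"
  shows "kern (\<tau> i w) (\<tau> j w) = pull (T (peak (\<tau> j w))) i w"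
proof -
  have "deriv B (\<tau> i w) \<noteq> 0"
    using deriv_B_\<tau>[OF w, of i] by auto
  then have "deriv (\<tau> i) w = 1 / deriv B (\<tau> i w)"
    using deriv_B_\<tau>[OF w, of i] by (intro eq_divide_imp) (simp_all add: mult.commute)
  then show ?thesis
    unfolding kern_def pull_def by simp
qed

text \<open>With peaks on sheets \<open>j\<close> and \<open>i\<close> over two base points, only
  two terms of the vanishing fibre sum survive. The left side involves only \<open>w\<close> and the
  right side only \<open>w'\<close>, so neither depends on its base point.\<close>

lemma kern_eq_pull_adjoint:
  assumes w: "w \<in> ball w0 (\<rho> / 4)" "w' \<in> ball w0 (\<rho> / 4)"
  shows "kern (\<tau> i w) (\<tau> j w) = cnj (pull (S (peak (\<tau> i w'))) j w')"
proof -
  have "ball w0 (\<rho> / 4) \<subseteq> N"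
    using \<rho>_pos by (intro subset_ball) simp
  then have wN: "w \<in> N" "w' \<in> N"
    using w by blast+
  have "0 = (\<Sum>n. fibre_defect (peak (\<tau> j w)) (peak (\<tau> i w')) n w w')"
    using fibre_defect_zero[OF w] by simp
  also have "\<dots> = (\<Sum>n. (if n = i then pull (T (peak (\<tau> j w))) i w else 0) -
      (if n = j then cnj (pull (S (peak (\<tau> i w'))) j w') else 0))"
    by (rule suminf_cong) (simp add: fibre_defect_def pull_peak[OF wN(1)] pull_peak[OF wN(2)])
  also have "\<dots> = pull (T (peak (\<tau> j w))) i w - cnj (pull (S (peak (\<tau> i w'))) j w')"
  proof -
    have single: "(\<lambda>n. if n = k then x else 0) sums x" for k and x :: complex
      using sums_If_finite_set[of "{k}" "\<lambda>_. x"] by simp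
    show ?thesis
      by (rule sums_unique[symmetric]) (intro sums_diff single)
  qed
  finally show ?thesis
    by (simp add: kern_pull[OF wN(1)])
qed

lemma kern_constant:
  assumes w: "w \<in> ball w0 (\<rho> / 4)"
  shows "kern (\<tau> i w) (\<tau> j w) = kern (\<tau> i w0) (\<tau> j w0)"
  using kern_eq_pull_adjoint[OF w w] kern_eq_pull_adjoint[OF _ w, of w0] \<rho>_pos by simp

text \<open>Column \<open>j\<close> consists of the pullbacks of one element of the space, the image
  of a peak.\<close>

lemma kern_column_summable: "summable (\<lambda>n. (cmod (kern (\<tau> n w0) (\<tau> j w0)))\<^sup>2)"
proof -
  obtain A where A: "\<And>n w. w \<in> ball w0 (\<rho> / 2) \<Longrightarrow> cmod (pull (T (peak (\<tau> j w0))) n w) \<le> A n"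
    "\<And>n. A n \<ge> 0" "summable (\<lambda>n. (A n)\<^sup>2)"
    using pull_bound[of "T (peak (\<tau> j w0))"] by blast
  show ?thesis
    by (rule summable_comparison_test'[OF A(3), of 0])
      (use A(1)[of w0] \<rho>_pos in \<open>auto simp: kern_pull intro!: power_mono\<close>)
qed

text \<open>Testing against the peak of sheet \<open>i\<close> isolates the value of
  \<open>T f\<close> there. The coefficients of the values of \<open>f\<close> are the entries of
  row \<open>i\<close>, of which only the diagonal one is left.\<close>

lemma diagonal_kern:
  assumes "\<And>n. n \<noteq> i \<Longrightarrow> kern (\<tau> i w0) (\<tau> n w0) = 0"
  shows "Rep_bergman (T f) (\<tau> i w0) = kern (\<tau> i w0) (\<tau> i w0) * Rep_bergman f (\<tau> i w0)"
proof -
  have w0: "w0 \<in> N" "w0 \<in> ball w0 (\<rho> / 4)"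
    using \<rho>_pos by auto
  have "0 = (\<Sum>n. fibre_defect f (peak (\<tau> i w0)) n w0 w0)"
    using fibre_defect_zero[OF w0(2) w0(2)] by simp
  also have "\<dots> = (\<Sum>n. if n = i then pull (T f) i w0 - pull f i w0 * kern (\<tau> i w0) (\<tau> i w0) else 0)"
  proof (rule suminf_cong)
    fix n
    show "fibre_defect f (peak (\<tau> i w0)) n w0 w0 =
        (if n = i then pull (T f) i w0 - pull f i w0 * kern (\<tau> i w0) (\<tau> i w0) else 0)"
      using assms[of n] kern_eq_pull_adjoint[OF w0(2) w0(2), of i n]
      by (auto simp: fibre_defect_def pull_peak[OF w0(1)])
  qed
  also have "\<dots> = pull (T f) i w0 - pull f i w0 * kern (\<tau> i w0) (\<tau> i w0)"
    by (subst suminf_finite[of "{i}"]) auto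
  finally have "pull (T f) i w0 = pull f i w0 * kern (\<tau> i w0) (\<tau> i w0)"
    by simp
  then show ?thesis
    using deriv_B_\<tau>[OF w0(1), of i] by (auto simp: pull_def)
qed

end

section \<open>Sheets of a thin Blaschke product\<close>

text \<open>If \<open>cmod (H 0)\<close> is close to 1, Schwarz's lemma forces \<open>H\<close> to
  be nearly constant, so \<open>z * H z\<close> is a small perturbation of a linear map. It models
  \<open>B\<close> in a coordinate centred at one of its zeros. The two conditions in
  \<open>small\<close> give a Lipschitz bound for the perturbation and a lower bound on the circle
  of radius \<open>\<rho>\<close>.\<close>

lemma holomorphic_almost_linear:
  fixes H :: "complex \<Rightarrow> complex"
  assumes H: "H holomorphic_on \<bbbD>" and H1: "\<And>z. z \<in> \<bbbD> \<Longrightarrow> cmod (H z) < 1"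
    and \<delta>: "\<delta> = cmod (H 0)" and \<rho>: "0 < \<rho>" "\<rho> < 1"
    and small: "16 * (1 - \<delta>) / (1 - \<rho>)\<^sup>2 \<le> \<delta> / 2" "r + 4 * (1 - \<delta>) / (1 - \<rho>) < \<rho> * \<delta>"
    and r: "r > 0"
  shows "\<And>z. cmod z = \<rho> \<Longrightarrow> r < cmod (z * H z)"
    and "\<exists>s. s holomorphic_on ball 0 r \<and> (\<forall>w\<in>ball 0 r. cmod (s w) < \<rho> \<and> s w * H (s w) = w) \<and>
        (\<forall>z. cmod z \<le> \<rho> \<longrightarrow> cmod (z * H z) < r \<longrightarrow> z = s (z * H z))"
proof -
  define h where "h = H 0"
  define e where "e = (\<lambda>z. z * (H z - h))"
  define \<eta> where "\<eta> = 4 * (1 - \<delta>) / (1 - \<rho>)"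
  \<comment> \<open>Radius for Cauchy's estimate: such disks about points of
    \<open>cball 0 \<rho>\<close> stay where the perturbation is bounded by \<open>\<eta>\<close>.
    The quotient \<open>\<eta> / d\<close> is the left side of the first smallness
    condition.\<close>
  define d where "d = (1 - \<rho>) / 4"
  have \<delta>1: "\<delta> < 1"
    using H1[of 0] \<delta> by simp
  have \<eta>: "\<eta> > 0"
    using \<delta>1 \<rho> by (simp add: \<eta>_def)
  have \<delta>0: "\<delta> > 0"
  proof -
    have "\<rho> * \<delta> > 0"
      using small(2) r \<eta> unfolding \<eta>_def[symmetric] by linarith
    then show ?thesis
      using \<rho> by (simp add: zero_less_mult_iff)
  qed
  have hd: "cmod h = \<delta>" "h \<noteq> 0"
    using \<delta> \<delta>0 by (auto simp: h_def)
  have d: "d > 0"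
    using \<rho> by (simp add: d_def)
  \<comment> \<open>Schwarz's lemma for \<open>H\<close> followed by the automorphism sending
    \<open>h\<close> to 0. The resulting inequality has \<open>cmod (H z - h)\<close> on both sides;
    the factor \<open>cmod z\<close>, at most \<open>(1 + \<rho>) / 2\<close>, lets it be absorbed
    on the left.\<close>
  have H_near: "cmod (H z - h) \<le> \<eta>" if z: "cmod z \<le> (1 + \<rho>) / 2" for z
  proof -
    define K where "K = (\<lambda>z. Moebius_function 0 h (H z))"
    have z1: "cmod z < 1"
      using z \<rho> by simp
    have hol: "K holomorphic_on ball 0 1"
      unfolding K_def using H1 hd \<delta>1
      by (intro holomorphic_on_compose_gen[OF H Moebius_function_holomorphic, unfolded comp_def]) auto
    have "cmod (K z) \<le> cmod z"
      by (rule Schwarz_Lemma(1)[OF hol _ _ z1])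
        (use H1 hd \<delta>1 in \<open>auto simp: K_def h_def Moebius_function_eq_zero intro!: Moebius_function_norm_lt_1\<close>)
    moreover have "cmod (K z) = cmod (H z - h) / cmod (1 - cnj h * H z)"
      by (simp add: K_def Moebius_function_simple norm_divide)
    moreover have "1 - cnj h * H z \<noteq> 0"
    proof
      assume "1 - cnj h * H z = 0"
      then have "cmod (cnj h * H z) = 1"
        by (metis eq_iff_diff_eq_0 norm_one)
      then have "\<delta> * cmod (H z) = 1"
        by (simp add: norm_mult hd)
      moreover have "\<delta> * cmod (H z) < 1 * 1"
        using \<delta>1 H1[of z] z1 \<delta>0 by (intro mult_strict_mono) auto
      ultimately show False
        by simp
    qed
    ultimately have "cmod (H z - h) \<le> cmod z * cmod (1 - cnj h * H z)"
      by (simp add: divide_le_eq)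
    also have "1 - cnj h * H z = (1 - cnj h * h) - cnj h * (H z - h)"
      by (simp add: algebra_simps)
    also have "cmod \<dots> \<le> cmod (1 - cnj h * h) + cmod (cnj h * (H z - h))"
      by (rule norm_triangle_ineq4)
    also have "cnj h * h = of_real (\<delta>\<^sup>2)"
      using complex_norm_square[of h] hd by (simp add: mult.commute)
    also have "cmod (1 - of_real (\<delta>\<^sup>2)) = 1 - \<delta>\<^sup>2"
      using \<delta>1 \<delta>0 by (metis abs_of_nonneg norm_of_real of_real_1 of_real_diff diff_ge_0_iff_ge
          less_imp_le power_le_one)
    also have "cmod (cnj h * (H z - h)) \<le> 1 * cmod (H z - h)"
      using \<delta>1 \<delta>0 by (simp add: norm_mult hd mult_left_le_one_le)
    also have "1 - \<delta>\<^sup>2 \<le> 2 * (1 - \<delta>)"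
      using zero_le_power2[of "1 - \<delta>"] by (simp add: power2_eq_square algebra_simps)
    finally have "cmod (H z - h) \<le> cmod z * (2 * (1 - \<delta>) + cmod (H z - h))"
      by (simp add: mult_left_mono)
    also have "\<dots> \<le> (1 + \<rho>) / 2 * (2 * (1 - \<delta>) + cmod (H z - h))"
      using z \<delta>1 by (intro mult_right_mono) auto
    finally have "(1 - \<rho>) * cmod (H z - h) \<le> (1 + \<rho>) * (2 * (1 - \<delta>))"
      by (simp add: field_simps)
    also have "\<dots> \<le> 2 * (2 * (1 - \<delta>))"
      using \<rho> \<delta>1 by (intro mult_right_mono) auto
    finally show ?thesis
      using \<rho> by (simp add: \<eta>_def field_simps)
  qed
  have e_bound: "cmod (e z) \<le> \<eta>" if z: "cmod z \<le> (1 + \<rho>) / 2" for z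
  proof -
    have "cmod (e z) \<le> 1 * \<eta>"
      unfolding e_def norm_mult using H_near[OF z] z \<rho> by (intro mult_mono) auto
    then show ?thesis
      by simp
  qed
  have e_hol: "e holomorphic_on \<bbbD>"
    unfolding e_def by (intro holomorphic_intros H)
  have lip: "cmod (e x - e y) \<le> \<delta> / 2 * cmod (x - y)" if xy: "x \<in> cball 0 \<rho>" "y \<in> cball 0 \<rho>" for x y
  proof (rule field_differentiable_bound[of "cball 0 \<rho>" e "deriv e"])
    fix z :: complex assume z: "z \<in> cball 0 \<rho>"
    have "z \<in> \<bbbD>"
      using z \<rho> by auto
    then show "(e has_field_derivative deriv e z) (at z within cball 0 \<rho>)"
      using holomorphic_derivI[OF e_hol open_ball] by (meson has_field_derivative_at_within)
    have sub: "cmod x \<le> (1 + \<rho>) / 2" if "x \<in> cball z d" for x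
    proof -
      have "cmod x \<le> cmod z + cmod (x - z)"
        using norm_triangle_ineq[of z "x - z"] by simp
      then show ?thesis
        using that z \<rho> by (simp add: d_def dist_norm norm_minus_commute field_simps)
    qed
    have sub': "cball z d \<subseteq> \<bbbD>"
    proof
      fix x assume "x \<in> cball z d"
      from sub[OF this] \<rho> show "x \<in> \<bbbD>"
        by simp
    qed
    have "cmod ((deriv ^^ 1) e z) \<le> fact 1 * \<eta> / d ^ 1"
    proof (rule Cauchy_inequality[OF _ _ d])
      show "e holomorphic_on ball z d"
        using holomorphic_on_subset[OF e_hol] sub' ball_subset_cball by blast
      show "continuous_on (cball z d) e"
        using holomorphic_on_imp_continuous_on[OF holomorphic_on_subset[OF e_hol sub']] .
    qed (use e_bound sub in \<open>auto simp: dist_norm\<close>)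
    also have "\<dots> = 16 * (1 - \<delta>) / (1 - \<rho>)\<^sup>2"
      using \<rho> by (simp add: \<eta>_def d_def power2_eq_square field_simps)
    finally have "cmod ((deriv ^^ 1) e z) \<le> \<delta> / 2"
      using small(1) by linarith
    then show "cmod (deriv e z) \<le> \<delta> / 2"
      by simp
  qed (use xy in auto)
  have F: "z * H z = h * z + e z" for z
    by (simp add: e_def algebra_simps)
  show big: "r < cmod (z * H z)" if z: "cmod z = \<rho>" for z
  proof -
    have "\<delta> * \<rho> = cmod (z * H z - e z)"
      unfolding F by (simp add: norm_mult hd z)
    also have "\<dots> \<le> cmod (z * H z) + cmod (e z)"
      by (rule norm_triangle_ineq4)
    also have "cmod (e z) \<le> \<eta>"
      using z \<rho> by (intro e_bound) simp
    finally show ?thesis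
      using small(2) by (simp add: \<eta>_def mult.commute)
  qed
  have inj: "inj_on (\<lambda>z. z * H z) (cball 0 \<rho>)"
  proof (rule inj_onI)
    fix x y assume xy: "x \<in> cball 0 \<rho>" "y \<in> cball 0 \<rho>" "x * H x = y * H y"
    then have "h * (x - y) = - (e x - e y)"
      unfolding F by (simp add: algebra_simps)
    then have "\<delta> * cmod (x - y) = cmod (e x - e y)"
      by (metis hd(1) norm_minus_cancel norm_mult)
    also have "\<dots> \<le> \<delta> / 2 * cmod (x - y)"
      by (rule lip[OF xy(1,2)])
    finally show "x = y"
      using \<delta>0 by simp
  qed
  \<comment> \<open>The equation \<open>z * H z = w\<close> is read as a fixed point problem; the
    Lipschitz constant \<open>\<delta> / 2\<close> of \<open>e\<close>, divided by
    \<open>cmod h = \<delta>\<close>, gives the contraction factor \<open>1 / 2\<close>.\<close>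
  have surj: "\<exists>z\<in>ball 0 \<rho>. z * H z = w" if w: "w \<in> ball 0 r" for w
  proof -
    have "\<exists>!z\<in>cball 0 \<rho>. (w - e z) / h = z"
    proof (rule Banach_fix[of _ "1 / 2"])
      show "(\<lambda>z. (w - e z) / h) ` cball 0 \<rho> \<subseteq> cball 0 \<rho>"
      proof (clarsimp simp: norm_divide hd)
        fix z assume z: "cmod z \<le> \<rho>"
        have "cmod (w - e z) \<le> cmod w + cmod (e z)"
          by (rule norm_triangle_ineq4)
        also have "\<dots> \<le> r + \<eta>"
          using w e_bound[of z] z \<rho> by (intro add_mono) auto
        also have "\<dots> \<le> \<rho> * \<delta>"
          using small(2) by (simp add: \<eta>_def)
        finally show "cmod (w - e z) / \<delta> \<le> \<rho>"
          using \<delta>0 by (simp add: field_simps)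
      qed
      show "\<And>x y. x \<in> cball 0 \<rho> \<Longrightarrow> y \<in> cball 0 \<rho> \<Longrightarrow> dist ((w - e x) / h) ((w - e y) / h) \<le> 1 / 2 * dist x y"
      proof -
        fix x y :: complex assume xy: "x \<in> cball 0 \<rho>" "y \<in> cball 0 \<rho>"
        have "(w - e x) / h - (w - e y) / h = - (e x - e y) / h"
          by (simp add: diff_divide_distrib)
        then have "dist ((w - e x) / h) ((w - e y) / h) = cmod (e x - e y) / \<delta>"
          by (simp only: dist_norm norm_divide norm_minus_cancel hd)
        also have "\<dots> \<le> (\<delta> / 2 * cmod (x - y)) / \<delta>"
          using \<delta>0 by (intro divide_right_mono lip[OF xy]) auto
        finally show "dist ((w - e x) / h) ((w - e y) / h) \<le> 1 / 2 * dist x y"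
          using \<delta>0 by (simp add: dist_norm)
      qed
    qed (use \<rho> in \<open>auto simp: complete_eq_closed\<close>)
    then obtain z where z: "z \<in> cball 0 \<rho>" "(w - e z) / h = z"
      by blast
    then have "z * H z = w"
      unfolding F using hd by (simp add: field_simps)
    moreover have "cmod z \<noteq> \<rho>"
      using big[of z] \<open>z * H z = w\<close> w by auto
    ultimately show ?thesis
      using z by auto
  qed
  have F_hol: "(\<lambda>z. z * H z) holomorphic_on ball 0 \<rho>"
    using \<rho> by (intro holomorphic_intros holomorphic_on_subset[OF H]) auto
  obtain s where s: "s holomorphic_on (\<lambda>z. z * H z) ` ball 0 \<rho>" "\<And>z. z \<in> ball 0 \<rho> \<Longrightarrow> s (z * H z) = z"
    using holomorphic_has_inverse[OF F_hol open_ball inj_on_subset[OF inj ball_subset_cball]] by metis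
  have "s holomorphic_on ball 0 r"
    by (rule holomorphic_on_subset[OF s(1)]) (use surj in force)
  moreover have "cmod (s w) < \<rho> \<and> s w * H (s w) = w" if w: "w \<in> ball 0 r" for w
  proof -
    obtain z where z: "z \<in> ball 0 \<rho>" "z * H z = w"
      using surj[OF w] by blast
    with s(2)[OF z(1)] show ?thesis
      by simp
  qed
  moreover have "z = s (z * H z)" if "cmod z \<le> \<rho>" "cmod (z * H z) < r" for z
  proof -
    have "cmod z \<noteq> \<rho>"
      using big[of z] that(2) by auto
    then show ?thesis
      using s(2)[of z] that(1) by simp
  qed
  ultimately show "\<exists>s. s holomorphic_on ball 0 r \<and> (\<forall>w\<in>ball 0 r. cmod (s w) < \<rho> \<and> s w * H (s w) = w) \<and>
        (\<forall>z. cmod z \<le> \<rho> \<longrightarrow> cmod (z * H z) < r \<longrightarrow> z = s (z * H z))"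
    by blast
qed

text \<open>The majorant in \<open>near\<close> has the shape satisfied by Blaschke factors and is
  uniform on compact subsets. The third conclusion makes contact with products of real numbers, in
  which thinness is expressed.\<close>

lemma holomorphic_infinite_product:
  fixes u :: "nat \<Rightarrow> complex \<Rightarrow> complex"
  assumes hol: "\<And>n. u n holomorphic_on \<bbbD>"
    and near: "\<And>n z. z \<in> \<bbbD> \<Longrightarrow> cmod (1 - u n z) \<le> d n * ((1 + cmod z) / (1 - cmod z))"
    and d: "summable d"
  shows "\<And>z. z \<in> \<bbbD> \<Longrightarrow> (\<lambda>N. \<Prod>n<N. u n z) \<longlonglongrightarrow> (\<Prod>n. u n z)"
    and "(\<lambda>z. \<Prod>n. u n z) holomorphic_on \<bbbD>"
    and "\<And>z. z \<in> \<bbbD> \<Longrightarrow> (\<Prod>n. cmod (u n z)) = cmod (\<Prod>n. u n z)"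
proof -
  have summ: "summable (\<lambda>n. cmod (u n z - 1))" if "z \<in> \<bbbD>" for z
    by (rule summable_comparison_test'[OF summable_mult2[OF d, of "(1 + cmod z) / (1 - cmod z)"], of 0])
      (use near[OF that] in \<open>auto simp: norm_minus_commute\<close>)
  show lim: "(\<lambda>N. \<Prod>n<N. u n z) \<longlonglongrightarrow> (\<Prod>n. u n z)" if "z \<in> \<bbbD>" for z
  proof -
    have "convergent_prod (\<lambda>n. u n z)"
      by (intro abs_convergent_prod_imp_convergent_prod summable_imp_abs_convergent_prod summ that)
    from convergent_prod_LIMSEQ[OF this] show ?thesis
      by (simp add: LIMSEQ_lessThan_iff_atMost)
  qed
  show "(\<lambda>z. \<Prod>n. u n z) holomorphic_on \<bbbD>"
  proof (rule holomorphic_uniform_sequence)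
    show "(\<lambda>z. \<Prod>n<N. u n z) holomorphic_on \<bbbD>" for N
      by (intro holomorphic_intros hol)
    fix z :: complex assume z: "z \<in> \<bbbD>"
    define t where "t = (1 - cmod z) / 2"
    have t: "t > 0" "cmod z + t < 1"
      using z by (auto simp: t_def field_simps)
    have norm_le: "cmod x \<le> cmod z + t" if "x \<in> cball z t" for x
      using norm_triangle_ineq[of z "x - z"] that by (simp add: dist_norm norm_minus_commute)
    have sub: "cball z t \<subseteq> \<bbbD>"
    proof
      fix x assume "x \<in> cball z t"
      from norm_le[OF this] t show "x \<in> \<bbbD>"
        by simp
    qed
    have "d n \<ge> 0" for n
      using near[of 0 n] order_trans[OF norm_ge_zero] by fastforce
    then have bound: "norm (cmod (u n x - 1)) \<le> d n * (2 / (1 - (cmod z + t)))" if "x \<in> cball z t" for n x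
    proof -
      have "cmod (u n x - 1) \<le> d n * ((1 + cmod x) / (1 - cmod x))"
        using near[of x n] sub that by (auto simp: norm_minus_commute)
      also have "\<dots> \<le> d n * (2 / (1 - (cmod z + t)))"
        using norm_le[OF that] t \<open>\<And>n. d n \<ge> 0\<close> by (intro mult_left_mono frac_le) auto
      finally show ?thesis
        by simp
    qed
    have "uniformly_convergent_on (cball z t) (\<lambda>N x. \<Prod>n<N. u n x)"
    proof (rule uniformly_convergent_on_prod')
      show "continuous_on (cball z t) (u n)" for n
        by (rule holomorphic_on_imp_continuous_on[OF holomorphic_on_subset[OF hol sub]])
      show "uniformly_convergent_on (cball z t) (\<lambda>N x. \<Sum>n<N. cmod (u n x - 1))"
        by (rule Weierstrass_m_test'[OF bound summable_mult2[OF d]])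
    qed simp
    then have "uniform_limit (cball z t) (\<lambda>N x. \<Prod>n<N. u n x) (\<lambda>x. lim (\<lambda>N. \<Prod>n<N. u n x)) sequentially"
      by (simp add: uniformly_convergent_uniform_limit_iff)
    moreover have "lim (\<lambda>N. \<Prod>n<N. u n x) = (\<Prod>n. u n x)" if "x \<in> cball z t" for x
      using lim[of x] sub that by (intro limI) blast
    ultimately have "uniform_limit (cball z t) (\<lambda>N x. \<Prod>n<N. u n x) (\<lambda>x. \<Prod>n. u n x) sequentially"
      by (subst uniform_limit_cong'[of _ _ "\<lambda>N x. \<Prod>n<N. u n x" _ "\<lambda>x. lim (\<lambda>N. \<Prod>n<N. u n x)"]) auto
    with t sub show "\<exists>t>0. cball z t \<subseteq> \<bbbD> \<and>
        uniform_limit (cball z t) (\<lambda>N x. \<Prod>n<N. u n x) (\<lambda>x. \<Prod>n. u n x) sequentially"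
      by blast
  qed simp
  show "(\<Prod>n. cmod (u n z)) = cmod (\<Prod>n. u n z)" if z: "z \<in> \<bbbD>" for z
  proof (rule LIMSEQ_unique)
    have "summable (\<lambda>n. norm (cmod (u n z) - 1))"
      by (rule summable_comparison_test'[OF summ[OF z], of 0])
        (metis abs_norm_cancel norm_one norm_triangle_ineq3 real_norm_def)
    then have "convergent_prod (\<lambda>n. cmod (u n z))"
      by (intro abs_convergent_prod_imp_convergent_prod summable_imp_abs_convergent_prod)
    from convergent_prod_LIMSEQ[OF this]
    show "(\<lambda>N. \<Prod>n<N. cmod (u n z)) \<longlonglongrightarrow> (\<Prod>n. cmod (u n z))"
      by (simp add: LIMSEQ_lessThan_iff_atMost)
    show "(\<lambda>N. \<Prod>n<N. cmod (u n z)) \<longlonglongrightarrow> cmod (\<Prod>n. u n z)"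
      unfolding prod_norm by (intro tendsto_norm lim z)
  qed
qed

section \<open>Blaschke factors\<close>

lemma one_minus_cnj_mult_neq_0:
  assumes "cmod a < 1" "cmod z \<le> 1"
  shows "1 - cnj a * z \<noteq> 0"
proof
  assume "1 - cnj a * z = 0"
  then have "cmod (cnj a * z) = 1"
    by (metis eq_iff_diff_eq_0 norm_one)
  moreover have "cmod a * cmod z < 1"
    using assms mult_left_le[of "cmod z" "cmod a"] by simp
  ultimately show False
    by (simp add: norm_mult)
qed

lemma norm_blaschke_factor: "cmod (blaschke_factor a z) = cmod ((a - z) / (1 - cnj a * z))"
  by (simp add: blaschke_factor_def norm_mult norm_divide)

lemma norm_blaschke_factor_less_1:
  assumes "cmod a < 1" "cmod z < 1"
  shows "cmod (blaschke_factor a z) < 1"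
  using Moebius_function_norm_lt_1[OF assms, of 0]
  unfolding norm_blaschke_factor Moebius_function_simple
  by (simp add: norm_divide norm_minus_commute)

lemma norm_blaschke_factor_circle:
  assumes "cmod a < 1" "cmod z = 1"
  shows "cmod (blaschke_factor a z) = 1"
proof -
  have "z * cnj z = 1"
    using assms(2) by (simp add: complex_norm_square[symmetric])
  then have "z * cnj (z - a) = 1 - cnj a * z"
    by (simp add: algebra_simps)
  then have "cmod (1 - cnj a * z) = cmod (z - a)"
    using assms(2) by (metis complex_mod_cnj mult_1 norm_mult)
  then show ?thesis
    using one_minus_cnj_mult_neq_0[of a z] assms
    by (auto simp: norm_blaschke_factor norm_divide norm_minus_commute)
qed

lemma holomorphic_blaschke_factor: "cmod a < 1 \<Longrightarrow> blaschke_factor a holomorphic_on \<bbbD>"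
  unfolding blaschke_factor_def[abs_def] using one_minus_cnj_mult_neq_0
  by (cases "a = 0") (auto intro!: holomorphic_intros)

lemma continuous_blaschke_factor: "cmod a < 1 \<Longrightarrow> continuous_on (cball 0 1) (blaschke_factor a)"
  unfolding blaschke_factor_def[abs_def] using one_minus_cnj_mult_neq_0
  by (cases "a = 0") (auto intro!: continuous_intros)

text \<open>For \<open>a\<close> nonzero the numerator of the difference from 1 factors exactly,
  with \<open>1 - cmod a\<close> as a factor. This is how summability of
  \<open>1 - cmod (a n)\<close> yields a convergent product. The normalization of the factor at
  \<open>a = 0\<close> is different, hence the separate case.\<close>

lemma blaschke_factor_near_1:
  assumes a: "cmod a < 1" and z: "cmod z < 1"
  shows "cmod (1 - blaschke_factor a z) \<le> (1 - cmod a) * ((1 + cmod z) / (1 - cmod z))"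
proof (cases "a = 0")
  case True
  have "cmod (1 - z) \<le> 1 + cmod z"
    using norm_triangle_ineq4[of 1 z] by simp
  also have "\<dots> \<le> (1 + cmod z) / (1 - cmod z)"
    using z by (simp add: pos_le_divide_eq mult_left_le)
  finally show ?thesis
    using True by (simp add: blaschke_factor_def)
next
  case False
  have ne: "1 - cnj a * z \<noteq> 0"
    using one_minus_cnj_mult_neq_0[of a z] a z by simp
  have aa: "a * cnj a = of_real ((cmod a)\<^sup>2)"
    by (metis complex_norm_square of_real_power)
  have eq: "1 - blaschke_factor a z = (1 - of_real (cmod a)) * (a + of_real (cmod a) * z) / (a * (1 - cnj a * z))"
  proof -
    have "a * (1 - cnj a * z) - of_real (cmod a) * (a - z) = (1 - of_real (cmod a)) * (a + of_real (cmod a) * z)"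
      using aa by (simp add: algebra_simps power2_eq_square)
    then show ?thesis
      using False ne by (simp add: blaschke_factor_def field_simps)
  qed
  have n1: "cmod (1 - of_real (cmod a)) = 1 - cmod a"
    using a by (metis abs_of_nonneg diff_ge_0_iff_ge less_imp_le norm_of_real of_real_1 of_real_diff)
  have n2: "cmod (a + of_real (cmod a) * z) \<le> cmod a * (1 + cmod z)"
    by (rule order_trans[OF norm_triangle_ineq]) (simp add: norm_mult algebra_simps)
  have "1 - cmod z \<le> 1 - cmod a * cmod z"
    using a by (simp add: mult_left_le_one_le)
  also have "\<dots> \<le> cmod (1 - cnj a * z)"
    using norm_triangle_ineq2[of 1 "cnj a * z"] by (simp add: norm_mult)
  finally have n3: "1 - cmod z \<le> cmod (1 - cnj a * z)" .
  have "cmod (1 - blaschke_factor a z)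
      = (1 - cmod a) * (cmod (a + of_real (cmod a) * z) / (cmod a * cmod (1 - cnj a * z)))"
    unfolding eq by (simp add: norm_mult norm_divide n1)
  also have "\<dots> \<le> (1 - cmod a) * ((cmod a * (1 + cmod z)) / (cmod a * (1 - cmod z)))"
    using a z n2 n3 False by (intro mult_left_mono frac_le) (auto intro!: mult_left_mono)
  also have "\<dots> = (1 - cmod a) * ((1 + cmod z) / (1 - cmod z))"
    using False by simp
  finally show ?thesis .
qed

text \<open>The analysis of fibres and critical values rests on this property and no longer refers
  to zeros. The sections exist on all of \<open>ball 0 r\<close>, critical values included. A
  compact set holds finitely many points of a fibre, so only finitely many points of a fibre over
  \<open>ball 0 r\<close> can fail to lie on a section.\<close>

locale sheeted =
  fixes B :: "complex \<Rightarrow> complex"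
  assumes B_holomorphic: "B holomorphic_on \<bbbD>"
    and B_less_1: "z \<in> \<bbbD> \<Longrightarrow> cmod (B z) < 1"
    and sheets: "0 < r \<Longrightarrow> r < 1 \<Longrightarrow> \<exists>(\<sigma> :: nat \<Rightarrow> complex \<Rightarrow> complex) K. compact K \<and> K \<subseteq> \<bbbD> \<and>
      (\<forall>k. \<sigma> k holomorphic_on ball 0 r) \<and>
      (\<forall>k. \<forall>w\<in>ball 0 r. \<sigma> k w \<in> \<bbbD> \<and> B (\<sigma> k w) = w) \<and>
      (\<forall>k j. \<forall>w\<in>ball 0 r. \<sigma> k w = \<sigma> j w \<longrightarrow> k = j) \<and>
      (\<forall>z\<in>\<bbbD>. cmod (B z) < r \<longrightarrow> z \<in> K \<or> (\<exists>k. z = \<sigma> k (B z)))"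

section \<open>Construction of the sheets of a thin Blaschke product\<close>

locale thin_product =
  fixes B :: "complex \<Rightarrow> complex" and a :: "nat \<Rightarrow> complex" and c :: complex
  assumes a: "cmod (a n) < 1" and a_summable: "summable (\<lambda>n. 1 - cmod (a n))"
    and c: "cmod c = 1" and B_eq: "z \<in> \<bbbD> \<Longrightarrow> B z = c * (\<Prod>n. blaschke_factor (a n) z)"
    and thin: "(\<lambda>k. \<Prod>j. if j = k then 1 else pseudohyperbolic_dist (a j) (a k)) \<longlonglongrightarrow> 1"
begin

abbreviation \<beta> where "\<beta> n \<equiv> blaschke_factor (a n)"

definition g :: "nat \<Rightarrow> complex \<Rightarrow> complex" where
  "g k z = c * (\<Prod>n. if n = k then 1 else \<beta> n z)"

text \<open>The involutive automorphism of the disk exchanging 0 and \<open>a k\<close>. It differs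
  from \<open>\<beta> k\<close> by a unimodular constant and serves as the coordinate around the
  zero.\<close>

definition \<phi> :: "nat \<Rightarrow> complex \<Rightarrow> complex" where
  "\<phi> k z = (a k - z) / (1 - cnj (a k) * z)"

lemma \<beta>_near: "z \<in> \<bbbD> \<Longrightarrow> cmod (1 - \<beta> n z) \<le> (1 - cmod (a n)) * ((1 + cmod z) / (1 - cmod z))"
  using blaschke_factor_near_1[OF a] by simp

lemma \<beta>_near': "z \<in> \<bbbD> \<Longrightarrow>
    cmod (1 - (if n = k then 1 else \<beta> n z)) \<le> (1 - cmod (a n)) * ((1 + cmod z) / (1 - cmod z))"
  using \<beta>_near[of z n] a[of n] by (auto intro!: mult_nonneg_nonneg divide_nonneg_nonneg)

lemma \<beta>_hol: "\<beta> n holomorphic_on \<bbbD>"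
  by (rule holomorphic_blaschke_factor[OF a])

lemma \<beta>_hol': "(\<lambda>z. if n = k then 1 else \<beta> n z) holomorphic_on \<bbbD>"
  by (cases "n = k") (auto intro: \<beta>_hol)

lemma \<beta>_less_1: "z \<in> \<bbbD> \<Longrightarrow> cmod (\<beta> n z) < 1"
  using norm_blaschke_factor_less_1[OF a] by simp

lemma B_LIMSEQ: "z \<in> \<bbbD> \<Longrightarrow> (\<lambda>N. c * (\<Prod>n<N. \<beta> n z)) \<longlonglongrightarrow> B z"
  unfolding B_eq by (intro tendsto_intros holomorphic_infinite_product(1)[OF \<beta>_hol \<beta>_near a_summable])

lemma g_LIMSEQ: "z \<in> \<bbbD> \<Longrightarrow> (\<lambda>N. c * (\<Prod>n<N. if n = k then 1 else \<beta> n z)) \<longlonglongrightarrow> g k z"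
  unfolding g_def
  by (intro tendsto_intros holomorphic_infinite_product(1)[OF \<beta>_hol' \<beta>_near' a_summable])

lemma B_holomorphic: "B holomorphic_on \<bbbD>"
  by (rule holomorphic_transform[of "\<lambda>z. c * (\<Prod>n. \<beta> n z)"])
    (auto simp: B_eq intro!: holomorphic_intros holomorphic_infinite_product(2)[OF \<beta>_hol \<beta>_near a_summable])

lemma g_holomorphic: "g k holomorphic_on \<bbbD>"
  unfolding g_def[abs_def]
  by (intro holomorphic_intros holomorphic_infinite_product(2)[OF \<beta>_hol' \<beta>_near' a_summable])

lemma norm_B_le:
  assumes z: "z \<in> \<bbbD>" and A: "finite A"
  shows "cmod (B z) \<le> (\<Prod>n\<in>A. cmod (\<beta> n z))"
proof (rule LIMSEQ_le_const2[OF tendsto_norm[OF B_LIMSEQ[OF z]]])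
  obtain N0 where N0: "A \<subseteq> {..<N0}"
    using finite_nat_iff_bounded A by blast
  have "cmod (c * (\<Prod>n<N. \<beta> n z)) \<le> (\<Prod>n\<in>A. cmod (\<beta> n z))" if N: "N \<ge> N0" for N
  proof -
    have sub: "A \<subseteq> {..<N}"
      using N N0 by force
    have "cmod (c * (\<Prod>n<N. \<beta> n z)) = (\<Prod>n\<in>{..<N} - A. cmod (\<beta> n z)) * (\<Prod>n\<in>A. cmod (\<beta> n z))"
      using prod.subset_diff[OF sub, of "\<lambda>n. cmod (\<beta> n z)"] by (simp add: norm_mult c prod_norm)
    also have "\<dots> \<le> 1 * (\<Prod>n\<in>A. cmod (\<beta> n z))"
      using \<beta>_less_1[OF z] less_imp_le by (intro mult_right_mono prod_le_1 prod_nonneg) auto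
    finally show ?thesis
      by simp
  qed
  then show "\<exists>N. \<forall>n\<ge>N. cmod (c * (\<Prod>n<n. \<beta> n z)) \<le> (\<Prod>n\<in>A. cmod (\<beta> n z))"
    by blast
qed

lemma norm_g_le:
  assumes z: "z \<in> \<bbbD>" and j: "j \<noteq> k"
  shows "cmod (g k z) \<le> cmod (\<beta> j z)"
proof (rule LIMSEQ_le_const2[OF tendsto_norm[OF g_LIMSEQ[OF z]]])
  have "cmod (c * (\<Prod>n<N. if n = k then 1 else \<beta> n z)) \<le> cmod (\<beta> j z)" if N: "N \<ge> Suc j" for N
  proof -
    have "cmod (c * (\<Prod>n<N. if n = k then 1 else \<beta> n z))
        = cmod (if j = k then 1 else \<beta> j z) * (\<Prod>n\<in>{..<N} - {j}. cmod (if n = k then 1 else \<beta> n z))"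
      using prod.remove[of "{..<N}" j "\<lambda>n. cmod (if n = k then 1 else \<beta> n z)"] N
      by (simp add: norm_mult c prod_norm)
    also have "\<dots> \<le> cmod (\<beta> j z) * 1"
      using \<beta>_less_1[OF z] less_imp_le j by (intro mult_mono prod_le_1 prod_nonneg) auto
    finally show ?thesis
      by simp
  qed
  then show "\<exists>N. \<forall>n\<ge>N. cmod (c * (\<Prod>n<n. if n = k then 1 else \<beta> n z)) \<le> cmod (\<beta> j z)"
    by blast
qed

lemma B_less_1: "z \<in> \<bbbD> \<Longrightarrow> cmod (B z) < 1"
  using norm_B_le[of z "{0}"] \<beta>_less_1[of z 0] by simp

lemma g_less_1: "z \<in> \<bbbD> \<Longrightarrow> cmod (g k z) < 1"
  using norm_g_le[of z "Suc k" k] \<beta>_less_1[of z "Suc k"] by simp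

lemma B_factor: "z \<in> \<bbbD> \<Longrightarrow> B z = \<beta> k z * g k z"
proof (rule LIMSEQ_unique[OF B_LIMSEQ])
  assume z: "z \<in> \<bbbD>"
  have "(\<lambda>N. \<beta> k z * (c * (\<Prod>n<N. if n = k then 1 else \<beta> n z))) \<longlonglongrightarrow> \<beta> k z * g k z"
    by (intro tendsto_intros g_LIMSEQ z)
  moreover have "\<forall>\<^sub>F N in sequentially. \<beta> k z * (c * (\<Prod>n<N. if n = k then 1 else \<beta> n z)) = c * (\<Prod>n<N. \<beta> n z)"
    using eventually_ge_at_top[of "Suc k"]
  proof eventually_elim
    case (elim N)
    have "(\<Prod>n\<in>{..<N} - {k}. if n = k then 1 else \<beta> n z) = (\<Prod>n\<in>{..<N} - {k}. \<beta> n z)"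
      by (rule prod.cong) auto
    then show ?case
      using prod.remove[of "{..<N}" k "\<lambda>n. \<beta> n z"] elim
        prod.remove[of "{..<N}" k "\<lambda>n. if n = k then 1 else \<beta> n z"]
      by (simp add: mult_ac)
  qed
  ultimately show "(\<lambda>N. c * (\<Prod>n<N. \<beta> n z)) \<longlonglongrightarrow> \<beta> k z * g k z"
    by (rule Lim_transform_eventually)
qed

lemma norm_g_zero_LIMSEQ: "(\<lambda>k. cmod (g k (a k))) \<longlonglongrightarrow> 1"
proof -
  have "cmod (g k (a k)) = (\<Prod>j. if j = k then 1 else pseudohyperbolic_dist (a j) (a k))" for k
  proof -
    have ak: "a k \<in> \<bbbD>"
      using a by simp
    have "cmod (g k (a k)) = (\<Prod>n. cmod (if n = k then 1 else \<beta> n (a k)))"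
      using holomorphic_infinite_product(3)[OF \<beta>_hol' \<beta>_near' a_summable ak]
      by (simp add: g_def norm_mult c)
    also have "(\<lambda>n. cmod (if n = k then 1 else \<beta> n (a k))) = (\<lambda>j. if j = k then 1 else pseudohyperbolic_dist (a j) (a k))"
    proof
      fix j
      have "cmod (1 - cnj (a j) * a k) = cmod (1 - cnj (a k) * a j)"
        using complex_mod_cnj[of "1 - cnj (a j) * a k"] by (simp add: mult.commute)
      then show "cmod (if j = k then 1 else \<beta> j (a k)) = (if j = k then 1 else pseudohyperbolic_dist (a j) (a k))"
        by (simp add: norm_blaschke_factor pseudohyperbolic_dist_def norm_divide norm_minus_commute)
    qed
    finally show ?thesis .
  qed
  with thin show ?thesis
    by simp
qed

lemma \<phi>_Moebius: "\<phi> k z = - Moebius_function 0 (a k) z"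
  by (simp add: \<phi>_def Moebius_function_simple minus_divide_left)

lemma \<phi>_holomorphic: "\<phi> k holomorphic_on \<bbbD>"
  unfolding \<phi>_Moebius[abs_def] by (intro holomorphic_intros Moebius_function_holomorphic a)

lemma \<phi>_in: "z \<in> \<bbbD> \<Longrightarrow> \<phi> k z \<in> \<bbbD>"
  using Moebius_function_norm_lt_1[OF a] by (simp add: \<phi>_Moebius)

lemma \<phi>_\<phi>:
  assumes "z \<in> \<bbbD>"
  shows "\<phi> k (\<phi> k z) = z"
proof -
  have d: "1 - cnj (a k) * z \<noteq> 0" "1 - cnj (a k) * a k \<noteq> 0"
    using one_minus_cnj_mult_neq_0[OF a] assms less_imp_le[OF a] by auto
  have e: "a k - \<phi> k z = z * (1 - cnj (a k) * a k) / (1 - cnj (a k) * z)"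
    using d(1) by (simp add: \<phi>_def field_simps)
  have f: "1 - cnj (a k) * \<phi> k z = (1 - cnj (a k) * a k) / (1 - cnj (a k) * z)"
    using d(1) by (simp add: \<phi>_def field_simps)
  show ?thesis
    unfolding \<phi>_def[of k "\<phi> k z"] e f using d by simp
qed

lemma \<phi>_0: "\<phi> k 0 = a k" and \<phi>_a: "\<phi> k (a k) = 0"
  by (simp_all add: \<phi>_def)

lemma norm_\<beta>_\<phi>: "cmod (\<beta> k z) = cmod (\<phi> k z)"
  by (simp add: norm_blaschke_factor \<phi>_def)

lemma blaschke_factor_unimodular:
  obtains u where "cmod u = 1" "\<And>z. \<beta> k z = u * \<phi> k z"
proof (cases "a k = 0")
  case True
  then show ?thesis
    by (intro that[of "-1"]) (auto simp: blaschke_factor_def \<phi>_def)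
next
  case False
  then show ?thesis
    by (intro that[of "of_real (cmod (a k)) / a k"]) (auto simp: blaschke_factor_def \<phi>_def norm_divide)
qed

text \<open>In the coordinate \<open>\<phi> k\<close> the function \<open>B\<close> becomes
  \<open>z * H z\<close>, where \<open>cmod (H 0)\<close> is \<open>cmod (g k (a k))\<close>, the
  separation of the zero from the others.\<close>

lemma sheet:
  assumes r: "0 < r" "r < 1" and \<rho>: "\<rho> = (1 + r) / 2"
    and small: "16 * (1 - cmod (g k (a k))) / (1 - \<rho>)\<^sup>2 \<le> cmod (g k (a k)) / 2"
      "r + 4 * (1 - cmod (g k (a k))) / (1 - \<rho>) < \<rho> * cmod (g k (a k))"
  obtains \<sigma> where "\<sigma> holomorphic_on ball 0 r"
    "\<And>w. w \<in> ball 0 r \<Longrightarrow> \<sigma> w \<in> \<bbbD> \<and> B (\<sigma> w) = w \<and> cmod (\<phi> k (\<sigma> w)) < \<rho>"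
    "\<And>z. z \<in> \<bbbD> \<Longrightarrow> cmod (\<phi> k z) \<le> \<rho> \<Longrightarrow> cmod (B z) < r \<Longrightarrow> z = \<sigma> (B z)"
    "\<And>z. z \<in> \<bbbD> \<Longrightarrow> cmod (\<phi> k z) = \<rho> \<Longrightarrow> r < cmod (B z)"
proof -
  obtain u where u: "cmod u = 1" "\<And>z. \<beta> k z = u * \<phi> k z"
    using blaschke_factor_unimodular by blast
  define H where "H = (\<lambda>z. u * g k (\<phi> k z))"
  have \<rho>01: "0 < \<rho>" "\<rho> < 1"
    using r by (auto simp: \<rho>)
  have BH: "B (\<phi> k z) = z * H z" if z: "z \<in> \<bbbD>" for z
    using B_factor[OF \<phi>_in[OF z], of k k] by (simp add: u \<phi>_\<phi>[OF z] H_def)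
  have H_hol: "H holomorphic_on \<bbbD>"
    unfolding H_def
    by (intro holomorphic_intros holomorphic_on_compose_gen[OF \<phi>_holomorphic g_holomorphic, unfolded comp_def])
      (use \<phi>_in in blast)
  have H_less: "cmod (H z) < 1" if "z \<in> \<bbbD>" for z
    using g_less_1[OF \<phi>_in[OF that], of k] by (simp add: H_def norm_mult u)
  have H0: "cmod (g k (a k)) = cmod (H 0)"
    by (simp add: H_def \<phi>_0 norm_mult u)
  have A: "r < cmod (z * H z)" if "cmod z = \<rho>" for z
    by (rule holomorphic_almost_linear(1)[OF H_hol _ H0 \<rho>01 small r(1) that]) (rule H_less)
  obtain s where s: "s holomorphic_on ball 0 r" "\<And>w. w \<in> ball 0 r \<Longrightarrow> cmod (s w) < \<rho> \<and> s w * H (s w) = w"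
    "\<And>z. cmod z \<le> \<rho> \<Longrightarrow> cmod (z * H z) < r \<Longrightarrow> z = s (z * H z)"
    using holomorphic_almost_linear(2)[OF H_hol H_less H0 \<rho>01 small r(1)] by blast
  have s_in: "s w \<in> \<bbbD>" if "w \<in> ball 0 r" for w
    using s(2)[OF that] \<rho>01 by simp
  show ?thesis
  proof (rule that[of "\<lambda>w. \<phi> k (s w)"])
    show "(\<lambda>w. \<phi> k (s w)) holomorphic_on ball 0 r"
      by (rule holomorphic_on_compose_gen[OF s(1) \<phi>_holomorphic, unfolded comp_def]) (use s_in in blast)
    show "\<phi> k (s w) \<in> \<bbbD> \<and> B (\<phi> k (s w)) = w \<and> cmod (\<phi> k (\<phi> k (s w))) < \<rho>" if "w \<in> ball 0 r" for w
      using s(2)[OF that] s_in[OF that] \<phi>_in BH \<phi>_\<phi> by metis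
    show "z = \<phi> k (s (B z))" if z: "z \<in> \<bbbD>" "cmod (\<phi> k z) \<le> \<rho>" "cmod (B z) < r" for z
    proof -
      have "B z = \<phi> k z * H (\<phi> k z)"
        using BH[OF \<phi>_in[OF z(1)], of k] by (simp add: \<phi>_\<phi>[OF z(1)])
      then have "\<phi> k z = s (B z)"
        using s(3)[OF z(2)] z(3) by simp
      then show ?thesis
        using \<phi>_\<phi>[OF z(1)] by metis
    qed
    show "r < cmod (B z)" if z: "z \<in> \<bbbD>" "cmod (\<phi> k z) = \<rho>" for z
      using A[OF z(2)] BH[OF \<phi>_in[OF z(1)], of k] by (simp add: \<phi>_\<phi>[OF z(1)])
  qed
qed

text \<open>As \<open>cmod (g k (a k))\<close> tends to 1, the conditions tend to
  \<open>0 \<le> 1 / 2\<close> and \<open>r < \<rho>\<close>. The latter is why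
  \<open>\<rho>\<close> is placed strictly between \<open>r\<close> and 1.\<close>

lemma eventually_small:
  assumes r: "0 < r" "r < 1" and \<rho>: "\<rho> = (1 + r) / 2"
  shows "\<forall>\<^sub>F k in sequentially. 16 * (1 - cmod (g k (a k))) / (1 - \<rho>)\<^sup>2 \<le> cmod (g k (a k)) / 2 \<and>
      r + 4 * (1 - cmod (g k (a k))) / (1 - \<rho>) < \<rho> * cmod (g k (a k))"
proof -
  have \<rho>1: "1 - \<rho> \<noteq> 0" "r < \<rho>"
    using r by (auto simp: \<rho>)
  have "(\<lambda>k. 16 * (1 - cmod (g k (a k))) / (1 - \<rho>)\<^sup>2 - cmod (g k (a k)) / 2) \<longlonglongrightarrow> 16 * (1 - 1) / (1 - \<rho>)\<^sup>2 - 1 / 2"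
    using \<rho>1 by (intro tendsto_intros norm_g_zero_LIMSEQ) auto
  then have 1: "\<forall>\<^sub>F k in sequentially. 16 * (1 - cmod (g k (a k))) / (1 - \<rho>)\<^sup>2 - cmod (g k (a k)) / 2 < 0"
    by (rule order_tendstoD(2)) simp
  have "(\<lambda>k. r + 4 * (1 - cmod (g k (a k))) / (1 - \<rho>) - \<rho> * cmod (g k (a k))) \<longlonglongrightarrow> r + 4 * (1 - 1) / (1 - \<rho>) - \<rho> * 1"
    using \<rho>1 by (intro tendsto_intros norm_g_zero_LIMSEQ) auto
  then have 2: "\<forall>\<^sub>F k in sequentially. r + 4 * (1 - cmod (g k (a k))) / (1 - \<rho>) - \<rho> * cmod (g k (a k)) < 0"
    by (rule order_tendstoD(2)) (use \<rho>1 in simp)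
  from 1 2 show ?thesis
    by eventually_elim simp
qed

text \<open>By the maximum principle the tail of the product stays at least \<open>r\<close> in
  modulus where \<open>cmod (B z) < r\<close> outside the disks of all zeros from \<open>K\<close>
  on. A small value of \<open>B\<close> off the sheets is thus caused by the finitely many leading
  factors.\<close>

lemma norm_B_lower:
  assumes r: "0 < r" "r < 1" and \<rho>: "0 < \<rho>"
    and circle: "\<And>k z. k \<ge> K \<Longrightarrow> z \<in> \<bbbD> \<Longrightarrow> cmod (\<phi> k z) = \<rho> \<Longrightarrow> r < cmod (B z)"
    and z: "z \<in> \<bbbD>" "cmod (B z) < r" "\<And>k. k \<ge> K \<Longrightarrow> cmod (\<phi> k z) > \<rho>"
  shows "r * (\<Prod>n<K. cmod (\<beta> n z)) \<le> cmod (B z)"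
proof (rule LIMSEQ_le_const[OF tendsto_norm[OF B_LIMSEQ[OF z(1)]]])
  have main: "r \<le> (\<Prod>j\<in>{K..<n}. cmod (\<beta> j z))" for n
  proof -
    define W where "W = {z \<in> \<bbbD>. cmod (B z) < r} \<inter> (\<Inter>k\<in>{K..<n}. {z \<in> \<bbbD>. cmod (\<phi> k z) > \<rho>})"
    \<comment> \<open>A boundary point of \<open>W\<close> either lies on the unit circle, where the
      factors have modulus 1, or satisfies \<open>cmod (B x) = r\<close>, since on the rim of a
      removed disk \<open>circle\<close> gives a larger value; there the partial product dominates
      \<open>B\<close>. Either way \<open>\<Phi>\<close> has modulus at most 1.\<close>
    define \<Phi> where "\<Phi> = (\<lambda>z. of_real r / (\<Prod>j\<in>{K..<n}. \<beta> j z))"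
    have contB: "continuous_on \<bbbD> (\<lambda>z. cmod (B z))"
      by (intro continuous_intros holomorphic_on_imp_continuous_on B_holomorphic)
    have op1: "open {z \<in> \<bbbD>. cmod (B z) < r}" "open {z \<in> \<bbbD>. cmod (B z) > r}"
      using continuous_on_open_vimage[OF open_ball, THEN iffD1, OF contB, rule_format, of "{..<r}"]
        continuous_on_open_vimage[OF open_ball, THEN iffD1, OF contB, rule_format, of "{r<..}"]
      by (auto simp: vimage_def Int_def conj_commute)
    have op2: "open {z \<in> \<bbbD>. cmod (\<phi> k z) > \<rho>}" for k
    proof -
      have cont: "continuous_on \<bbbD> (\<lambda>z. cmod (\<phi> k z))"
        by (intro continuous_intros holomorphic_on_imp_continuous_on \<phi>_holomorphic)
      show ?thesis
        using continuous_on_open_vimage[OF open_ball, THEN iffD1, OF cont, rule_format, of "{\<rho><..}"]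
        by (auto simp: vimage_def Int_def conj_commute)
    qed
    have W_open: "open W"
      unfolding W_def by (intro open_Int op1 open_INT op2 ballI) auto
    have W_sub: "W \<subseteq> \<bbbD>"
      by (auto simp: W_def)
    have zW: "z \<in> W"
      using z by (auto simp: W_def)
    have far: "cmod (\<beta> k x) \<ge> \<rho>" if x: "x \<in> closure W" and k: "k \<in> {K..<n}" for x k
    proof -
      have "closure W \<subseteq> {x \<in> cball 0 1. cmod (\<beta> k x) \<ge> \<rho>}"
      proof (rule closure_minimal)
        show "W \<subseteq> {x \<in> cball 0 1. cmod (\<beta> k x) \<ge> \<rho>}"
          using k by (auto simp: W_def norm_\<beta>_\<phi> intro: less_imp_le)
        have "continuous_on (cball 0 1) (\<lambda>x. cmod (\<beta> k x))"
          by (intro continuous_intros continuous_blaschke_factor a)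
        from continuous_on_closed_vimage[OF closed_cball, THEN iffD1, OF this, rule_format, of "{\<rho>..}"]
        show "closed {x \<in> cball 0 1. cmod (\<beta> k x) \<ge> \<rho>}"
          by (simp add: vimage_def Int_def conj_commute)
      qed
      with x show ?thesis
        by blast
    qed
    have cl_sub: "closure W \<subseteq> cball 0 1"
      using W_sub by (intro closure_minimal) (use ball_subset_cball in blast)+
    have nz: "(\<Prod>j\<in>{K..<n}. \<beta> j x) \<noteq> 0" if "x \<in> closure W" for x
      using far[OF that] \<rho> by (force simp: prod_zero_iff)
    have "cmod (\<Phi> z) \<le> 1"
    proof (rule maximum_modulus_frontier[of \<Phi> W])
      show "\<Phi> holomorphic_on interior W"
        unfolding \<Phi>_def interior_open[OF W_open] using nz closure_subset[of W]
        by (intro holomorphic_intros holomorphic_on_subset[OF \<beta>_hol W_sub]) auto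
      show "continuous_on (closure W) \<Phi>"
        unfolding \<Phi>_def using nz
        by (intro continuous_intros continuous_on_subset[OF continuous_blaschke_factor[OF a] cl_sub]) auto
      show "bounded W"
        using bounded_subset[OF bounded_ball W_sub] .
      fix x assume x: "x \<in> frontier W"
      then have xc: "x \<in> closure W" and xW: "x \<notin> W"
        using W_open by (auto simp: frontier_def interior_open)
      have norm_\<Phi>: "cmod (\<Phi> x) = r / (\<Prod>j\<in>{K..<n}. cmod (\<beta> j x))"
        using r by (simp add: \<Phi>_def norm_divide prod_norm)
      have pos: "(\<Prod>j\<in>{K..<n}. cmod (\<beta> j x)) > 0"
        using far[OF xc] \<rho> by (intro prod_pos) force
      show "cmod (\<Phi> x) \<le> 1"
      proof (cases "x \<in> \<bbbD>")
        case False
        then have "cmod x = 1"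
          using cl_sub xc by auto
        then show ?thesis
          unfolding norm_\<Phi> using r norm_blaschke_factor_circle[OF a] by simp
      next
        case True
        have "\<not> cmod (B x) > r"
        proof
          assume "cmod (B x) > r"
          then have "W \<inter> {z \<in> \<bbbD>. cmod (B z) > r} \<noteq> {}"
            using xc True op1(2) open_Int_closure_eq_empty[of "{z \<in> \<bbbD>. cmod (B z) > r}" W] by blast
          then show False
            by (auto simp: W_def)
        qed
        moreover have "\<not> cmod (B x) < r"
        proof
          assume less: "cmod (B x) < r"
          have "cmod (\<phi> k x) > \<rho>" if "k \<in> {K..<n}" for k
            using far[OF xc that] circle[of k x] that True less by (force simp: norm_\<beta>_\<phi>)
          then have "x \<in> W"
            using True less by (auto simp: W_def)
          with xW show False ..
        qed
        ultimately have "r = cmod (B x)"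
          by simp
        then show ?thesis
          unfolding norm_\<Phi> using norm_B_le[OF True, of "{K..<n}"] pos by (simp add: divide_le_eq)
      qed
    qed (rule zW)
    moreover have "(\<Prod>j\<in>{K..<n}. cmod (\<beta> j z)) > 0"
      using z(3) \<rho> by (intro prod_pos) (force simp: norm_\<beta>_\<phi>)
    ultimately show ?thesis
      using r by (simp add: \<Phi>_def norm_divide prod_norm divide_le_eq)
  qed
  have "r * (\<Prod>n<K. cmod (\<beta> n z)) \<le> cmod (c * (\<Prod>n<N. \<beta> n z))" if N: "N \<ge> K" for N
  proof -
    have P: "(\<Prod>n\<in>{..<K} \<union> {K..<N}. cmod (\<beta> n z)) = (\<Prod>n<K. cmod (\<beta> n z)) * (\<Prod>j\<in>{K..<N}. cmod (\<beta> j z))"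
      by (rule prod.union_disjoint) auto
    have U: "{..<K} \<union> {K..<N} = {..<N}"
      using N by auto
    have "(\<Prod>n<N. cmod (\<beta> n z)) = (\<Prod>n<K. cmod (\<beta> n z)) * (\<Prod>j\<in>{K..<N}. cmod (\<beta> j z))"
      using P unfolding U .
    then have "cmod (c * (\<Prod>n<N. \<beta> n z)) = (\<Prod>n<K. cmod (\<beta> n z)) * (\<Prod>j\<in>{K..<N}. cmod (\<beta> j z))"
      by (simp add: norm_mult c prod_norm[symmetric])
    moreover have "(\<Prod>n<K. cmod (\<beta> n z)) * r \<le> (\<Prod>n<K. cmod (\<beta> n z)) * (\<Prod>j\<in>{K..<N}. cmod (\<beta> j z))"
      by (intro mult_left_mono main prod_nonneg) auto
    ultimately show ?thesis
      by (simp add: mult.commute)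
  qed
  then show "\<exists>N. \<forall>n\<ge>N. r * (\<Prod>n<K. cmod (\<beta> n z)) \<le> cmod (c * (\<Prod>n<n. \<beta> n z))"
    by blast
qed

text \<open>The sheets are built over a larger disk, of radius \<open>r\<close> between
  \<open>r0\<close> and 1. A point over \<open>ball 0 r0\<close> on none of them has leading product
  at most \<open>r0 / r < 1\<close>, which confines it to a compact subset of the open disk because
  Blaschke factors are unimodular on the circle.\<close>

sublocale sheeted B
proof
  fix r0 :: real assume r0: "0 < r0" "r0 < 1"
  define r where "r = (1 + r0) / 2"
  define \<rho> where "\<rho> = (1 + r) / 2"
  have r: "0 < r" "r < 1" "r0 < r"
    using r0 by (auto simp: r_def)
  then have \<rho>: "0 < \<rho>" "\<rho> < 1"
    by (auto simp: \<rho>_def)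
  obtain K where K: "\<And>k. k \<ge> K \<Longrightarrow> 16 * (1 - cmod (g k (a k))) / (1 - \<rho>)\<^sup>2 \<le> cmod (g k (a k)) / 2"
      "\<And>k. k \<ge> K \<Longrightarrow> r + 4 * (1 - cmod (g k (a k))) / (1 - \<rho>) < \<rho> * cmod (g k (a k))"
    using eventually_small[OF r(1,2) \<rho>_def] unfolding eventually_sequentially by blast
  define Q where "Q = (\<lambda>k \<sigma>. \<sigma> holomorphic_on ball 0 r \<and>
    (\<forall>w. w \<in> ball 0 r \<longrightarrow> \<sigma> w \<in> \<bbbD> \<and> B (\<sigma> w) = w \<and> cmod (\<phi> k (\<sigma> w)) < \<rho>) \<and>
    (\<forall>z. z \<in> \<bbbD> \<longrightarrow> cmod (\<phi> k z) \<le> \<rho> \<longrightarrow> cmod (B z) < r \<longrightarrow> z = \<sigma> (B z)) \<and>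
    (\<forall>z. z \<in> \<bbbD> \<longrightarrow> cmod (\<phi> k z) = \<rho> \<longrightarrow> r < cmod (B z)))"
  have "\<exists>\<sigma>. Q k \<sigma>" if k: "k \<ge> K" for k
    by (rule sheet[OF r(1,2) \<rho>_def K(1)[OF k] K(2)[OF k]]) (auto simp: Q_def)
  then have "\<forall>k. \<exists>\<sigma>. k \<ge> K \<longrightarrow> Q k \<sigma>"
    by blast
  then obtain \<sigma> where Q: "\<forall>k. k \<ge> K \<longrightarrow> Q k (\<sigma> k)"
    using choice[of "\<lambda>k \<sigma>. k \<ge> K \<longrightarrow> Q k \<sigma>"] by blast
  have \<sigma>: "\<And>k. k \<ge> K \<Longrightarrow> \<sigma> k holomorphic_on ball 0 r"
    "\<And>k w. k \<ge> K \<Longrightarrow> w \<in> ball 0 r \<Longrightarrow> \<sigma> k w \<in> \<bbbD> \<and> B (\<sigma> k w) = w \<and> cmod (\<phi> k (\<sigma> k w)) < \<rho>"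
    "\<And>k z. k \<ge> K \<Longrightarrow> z \<in> \<bbbD> \<Longrightarrow> cmod (\<phi> k z) \<le> \<rho> \<Longrightarrow> cmod (B z) < r \<Longrightarrow> z = \<sigma> k (B z)"
    "\<And>k z. k \<ge> K \<Longrightarrow> z \<in> \<bbbD> \<Longrightarrow> cmod (\<phi> k z) = \<rho> \<Longrightarrow> r < cmod (B z)"
    using Q unfolding Q_def by blast+
  have \<sigma>0: "\<sigma> k 0 = a k" if "k \<ge> K" for k
  proof -
    have "B (a k) = 0"
      using B_factor[of "a k" k] a[of k] norm_\<beta>_\<phi>[of k "a k"] by (simp add: \<phi>_a)
    then show ?thesis
      using \<sigma>(3)[OF that, of "a k"] a[of k] \<rho> r by (simp add: \<phi>_a)
  qed
  \<comment> \<open>A sheet cannot cross the curve \<open>cmod (\<phi> k z) = \<rho>\<close>, where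
    \<open>B\<close> is too large. So the part of sheet \<open>j\<close> inside the disk of index
    \<open>k\<close> is clopen; if nonempty it contains the zero \<open>a j\<close>, the two zeros
    coincide, and \<open>g k (a k) = 0\<close>, against its closeness to 1.\<close>
  have \<sigma>_inj: "k = j" if k: "k \<ge> K" and j: "j \<ge> K" and w: "w \<in> ball 0 r" and eq: "\<sigma> k w = \<sigma> j w" for k j w
  proof (rule ccontr)
    assume "k \<noteq> j"
    let ?A = "{v \<in> ball 0 r. cmod (\<phi> k (\<sigma> j v)) < \<rho>}"
    have cont: "continuous_on (ball 0 r) (\<lambda>v. cmod (\<phi> k (\<sigma> j v)))"
      by (intro continuous_intros holomorphic_on_imp_continuous_on
          holomorphic_on_compose_gen[OF \<sigma>(1)[OF j] \<phi>_holomorphic, unfolded comp_def])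
        (use \<sigma>(2)[OF j] in blast)
    have "?A = {v \<in> ball 0 r. cmod (\<phi> k (\<sigma> j v)) \<le> \<rho>}"
    proof (rule Collect_cong, rule conj_cong[OF refl])
      fix v :: complex assume v: "v \<in> ball 0 r"
      show "cmod (\<phi> k (\<sigma> j v)) < \<rho> \<longleftrightarrow> cmod (\<phi> k (\<sigma> j v)) \<le> \<rho>"
        using \<sigma>(4)[OF k, of "\<sigma> j v"] \<sigma>(2)[OF j v] v by fastforce
    qed
    then have "closedin (top_of_set (ball 0 r)) ?A"
      using continuous_closedin_preimage[OF cont, of "{..\<rho>}"] by (simp add: vimage_def Int_def)
    moreover have "openin (top_of_set (ball 0 r)) ?A"
      using continuous_openin_preimage_gen[OF cont, of "{..<\<rho>}"] by (simp add: vimage_def Int_def)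
    moreover have "w \<in> ?A"
      using w eq \<sigma>(2)[OF k w] by simp
    ultimately have "?A = ball 0 r"
      using connected_ball[of "0 :: complex" r] unfolding connected_clopen by blast
    then have "(0 :: complex) \<in> ?A"
      using r by simp
    then have "cmod (\<phi> k (a j)) < \<rho>"
      using \<sigma>0[OF j] by simp
    moreover have "B (a j) = 0"
      using B_factor[of "a j" j] a[of j] norm_\<beta>_\<phi>[of j "a j"] by (simp add: \<phi>_a)
    ultimately have "a j = a k"
      using \<sigma>(3)[OF k, of "a j"] a[of j] r \<sigma>0[OF k] by simp
    moreover have "cmod (\<beta> j (a j)) = 0"
      using norm_\<beta>_\<phi>[of j "a j"] by (simp add: \<phi>_a)
    ultimately have "cmod (\<beta> j (a k)) = 0"
      by metis
    then have "cmod (g k (a k)) = 0"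
      using norm_g_le[of "a k" j k] \<open>k \<noteq> j\<close> a[of k] by simp
    then show False
      using K(2)[OF k] r \<rho> by simp (smt (verit) divide_nonneg_pos)
  qed
  define C where "C = {z \<in> cball 0 1. (\<Prod>n<K. cmod (\<beta> n z)) \<le> r0 / r}"
  have "closed C"
  proof -
    have "continuous_on (cball 0 1) (\<lambda>z. \<Prod>n<K. cmod (\<beta> n z))"
      by (intro continuous_intros continuous_blaschke_factor a)
    from continuous_on_closed_vimage[OF closed_cball, THEN iffD1, OF this, rule_format, of "{..r0 / r}"]
    show ?thesis
      by (simp add: C_def vimage_def Int_def conj_commute)
  qed
  then have "compact C"
    by (rule compact_eq_bounded_closed[THEN iffD2, OF conjI[rotated]])
      (auto simp: C_def intro!: bounded_subset[OF bounded_cball[of 0 1]])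
  moreover have "C \<subseteq> \<bbbD>"
  proof
    fix z assume z: "z \<in> C"
    have "cmod z \<noteq> 1"
    proof
      assume "cmod z = 1"
      then have "(\<Prod>n<K. cmod (\<beta> n z)) = 1"
        using norm_blaschke_factor_circle[OF a] by simp
      then show False
        using z r r0 by (simp add: C_def pos_le_divide_eq)
    qed
    with z show "z \<in> \<bbbD>"
      by (auto simp: C_def)
  qed
  moreover have "z \<in> C \<or> (\<exists>k. z = \<sigma> (k + K) (B z))" if z: "z \<in> \<bbbD>" "cmod (B z) < r0" for z
  proof (cases "\<exists>k\<ge>K. cmod (\<phi> k z) \<le> \<rho>")
    case True
    then obtain k where "k \<ge> K" "cmod (\<phi> k z) \<le> \<rho>"
      by blast
    then have "z = \<sigma> (k - K + K) (B z)"
      using \<sigma>(3)[of k z] z r by simp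
    then show ?thesis
      by blast
  next
    case False
    have "r * (\<Prod>n<K. cmod (\<beta> n z)) \<le> cmod (B z)"
      by (rule norm_B_lower[OF r(1,2) \<rho>(1) \<sigma>(4)]) (use z r False in auto)
    then have "(\<Prod>n<K. cmod (\<beta> n z)) \<le> r0 / r"
      using z(2) r by (simp add: pos_le_divide_eq mult.commute)
    then show ?thesis
      using z by (simp add: C_def)
  qed
  moreover have sub: "ball 0 r0 \<subseteq> ball 0 r"
    using r by (intro subset_ball) simp
  moreover have "\<sigma> (k + K) holomorphic_on ball 0 r0" for k
    by (rule holomorphic_on_subset[OF \<sigma>(1) sub]) simp
  moreover have "k = j" if "w \<in> ball 0 r0" "\<sigma> (k + K) w = \<sigma> (j + K) w" for k j w
    using \<sigma>_inj[of "k + K" "j + K" w] subsetD[OF sub that(1)] that(2) by simp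
  moreover have "\<sigma> (k + K) w \<in> \<bbbD> \<and> B (\<sigma> (k + K) w) = w" if "w \<in> ball 0 r0" for k w
    using \<sigma>(2)[of "k + K" w] subsetD[OF sub that] by simp
  ultimately show "\<exists>(\<sigma> :: nat \<Rightarrow> complex \<Rightarrow> complex) K. compact K \<and> K \<subseteq> \<bbbD> \<and>
      (\<forall>k. \<sigma> k holomorphic_on ball 0 r0) \<and>
      (\<forall>k. \<forall>w\<in>ball 0 r0. \<sigma> k w \<in> \<bbbD> \<and> B (\<sigma> k w) = w) \<and>
      (\<forall>k j. \<forall>w\<in>ball 0 r0. \<sigma> k w = \<sigma> j w \<longrightarrow> k = j) \<and>
      (\<forall>z\<in>\<bbbD>. cmod (B z) < r0 \<longrightarrow> z \<in> K \<or> (\<exists>k. z = \<sigma> k (B z)))"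
    by (intro exI[of _ "\<lambda>k. \<sigma> (k + K)"] exI[of _ C] conjI allI ballI impI) blast+
qed (use B_holomorphic B_less_1 in auto)

end

lemma thin_blaschke_product_sheeted:
  assumes "thin_blaschke_product B"
  shows "sheeted B"
proof -
  obtain a where a: "infinite_blaschke_product B a"
    "(\<lambda>k. \<Prod>j. if j = k then 1 else pseudohyperbolic_dist (a j) (a k)) \<longlonglongrightarrow> 1"
    using assms unfolding thin_blaschke_product_def by blast
  then obtain c where c: "cmod c = 1" "\<forall>z\<in>\<bbbD>. B z = c * (\<Prod>n. blaschke_factor (a n) z)"
    unfolding infinite_blaschke_product_def by blast
  interpret thin_product B a c
    by unfold_locales (use a c in \<open>auto simp: infinite_blaschke_product_def image_subset_iff\<close>)
  show ?thesis
    by (rule sheeted_axioms)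
qed

section \<open>Regular values and even covers\<close>

lemma holomorphic_on_locally:
  fixes g :: "complex \<Rightarrow> complex"
  assumes "\<And>x. x \<in> S \<Longrightarrow> \<exists>N f. open N \<and> x \<in> N \<and> f holomorphic_on N \<and> (\<forall>y\<in>N. g y = f y)"
  shows "g holomorphic_on S"
  unfolding holomorphic_on_def
proof
  fix x assume "x \<in> S"
  then obtain N f where N: "open N" "x \<in> N" "f holomorphic_on N" "\<forall>y\<in>N. g y = f y"
    using assms by blast
  have "g holomorphic_on N"
    using N(3) by (rule holomorphic_transform) (use N(4) in auto)
  then have "g field_differentiable at x"
    using N(1,2) holomorphic_on_imp_differentiable_at by blast
  then show "g field_differentiable at x within S"
    by (rule field_differentiable_at_within)
qed

text \<open>A function on a disk that continues locally across every larger circle extends to the unit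
  disk. The predicate \<open>P G w\<close> expresses that the germ of \<open>G\<close> at \<open>w\<close> belongs to the local system
  under consideration; it is only required on the dense set \<open>D\<close>.\<close>

lemma disk_extension:
  fixes P :: "(complex \<Rightarrow> complex) \<Rightarrow> complex \<Rightarrow> bool"
  assumes r: "0 < r" "r < 1"
    and germ: "\<And>G G' w. P G w \<Longrightarrow> (\<forall>\<^sub>F v in nhds w. G v = G' v) \<Longrightarrow> P G' w"
    and dense: "\<And>S. open S \<Longrightarrow> S \<noteq> {} \<Longrightarrow> S \<subseteq> ball 0 1 \<Longrightarrow> S \<inter> D \<noteq> {}"
    and local: "\<And>w0. r \<le> cmod w0 \<Longrightarrow> cmod w0 < 1 \<Longrightarrow> \<exists>\<rho>>0. \<forall>w\<in>ball w0 \<rho> \<inter> D. w \<noteq> w0 \<longrightarrow>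
        (\<forall>G. P G w \<longrightarrow> (\<exists>G'. G' holomorphic_on ball w0 \<rho> \<and> (\<forall>\<^sub>F v in nhds w. G' v = G v) \<and>
            (\<forall>v\<in>ball w0 \<rho> \<inter> D. P G' v)))"
    and G0: "G0 holomorphic_on ball 0 r" "\<And>w. w \<in> ball 0 r \<inter> D \<Longrightarrow> P G0 w"
  obtains G where "G holomorphic_on ball 0 1" "\<And>w. w \<in> ball 0 r \<Longrightarrow> G w = G0 w"
proof -
  \<comment> \<open>\<open>E s G\<close> says that \<open>G\<close> is an admissible extension to
    radius \<open>s\<close>. The supremum of such radii is attained by gluing, and a supremum below
    1 could be exceeded.\<close>
  define E where "E = (\<lambda>s G. G holomorphic_on ball 0 s \<and> (\<forall>w\<in>ball 0 s \<inter> D. P G w) \<and>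
      (\<forall>w\<in>ball 0 r. G w = G0 w))"
  define A where "A = {s. r \<le> s \<and> s \<le> 1 \<and> (\<exists>G. E s G)}"
  have "E r G0"
    using G0 by (auto simp: E_def)
  then have rA: "r \<in> A"
    using r by (auto simp: A_def)
  have bdd: "bdd_above A"
    by (auto simp: A_def bdd_above_def)
  define R where "R = Sup A"
  have R: "r \<le> R" "R \<le> 1"
    unfolding R_def using rA bdd by (auto intro: cSup_upper cSup_least simp: A_def)
  have unique: "G v = G' v" if "E s G" "E s' G'" "cmod v < s" "cmod v < s'" "r \<le> s" "r \<le> s'" for s s' G G' v
  proof (rule analytic_continuation_open[of "ball 0 r" "ball 0 (min s s')" G G'])
    show "ball 0 r \<noteq> ({} :: complex set)"
      using r by simp
    show "ball 0 r \<subseteq> ball (0 :: complex) (min s s')"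
      using that by (intro subset_ball) simp
    show "G holomorphic_on ball 0 (min s s')" "G' holomorphic_on ball 0 (min s s')"
      using that(1,2) by (auto simp: E_def intro: holomorphic_on_subset)
  qed (use that in \<open>auto simp: E_def\<close>)
  have "\<forall>s\<in>A. \<exists>G. E s G"
    by (auto simp: A_def)
  then obtain H where H: "\<And>s. s \<in> A \<Longrightarrow> E s (H s)"
    by metis
  have below: "\<exists>s\<in>A. cmod w < s" if "cmod w < R" for w :: complex
    using less_cSupD[of A "cmod w"] rA that unfolding R_def by auto
  define G1 where "G1 = (\<lambda>w. H (SOME s. s \<in> A \<and> cmod w < s) w)"
  have G1: "G1 v = H s v" if s: "s \<in> A" "cmod v < s" for s v
  proof -
    define t where "t = (SOME s. s \<in> A \<and> cmod v < s)"
    have t: "t \<in> A \<and> cmod v < t"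
      unfolding t_def by (rule someI[of _ s]) (use s in simp)
    have "H t v = H s v"
      by (rule unique[OF H H]) (use s t in \<open>simp_all add: A_def\<close>)
    then show ?thesis
      by (simp add: G1_def t_def)
  qed
  have near: "\<forall>\<^sub>F v in nhds w. H s v = G1 v" if "cmod w < s" "s \<in> A" for w s
  proof -
    have "\<forall>\<^sub>F v in nhds w. v \<in> ball 0 s"
      by (rule eventually_nhds_in_open) (use that in auto)
    then show ?thesis
      by eventually_elim (use G1 that in auto)
  qed
  have EG1: "E R G1"
    unfolding E_def
  proof (intro conjI ballI)
    show "G1 holomorphic_on ball 0 R"
    proof (rule holomorphic_on_locally)
      fix w :: complex assume "w \<in> ball 0 R"
      then obtain s where "s \<in> A" "cmod w < s"
        using below[of w] by auto
      then show "\<exists>N f. open N \<and> w \<in> N \<and> f holomorphic_on N \<and> (\<forall>y\<in>N. G1 y = f y)"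
        using H[of s] G1 by (intro exI[of _ "ball 0 s"] exI[of _ "H s"]) (auto simp: E_def)
    qed
    fix w assume w: "w \<in> ball 0 R \<inter> D"
    then obtain s where s: "s \<in> A" "cmod w < s"
      using below[of w] by auto
    then have "P (H s) w"
      using H[of s] w by (auto simp: E_def)
    then show "P G1 w"
      using near[OF s(2,1)] by (rule germ)
  next
    fix w assume "w \<in> ball (0 :: complex) r"
    then show "G1 w = G0 w"
      using G1[OF rA, of w] H[OF rA] by (simp add: E_def)
  qed
  have "R = 1"
  proof (rule ccontr)
    assume "R \<noteq> 1"
    then have R1: "R < 1"
      using R by simp
    have R0: "R > 0"
      using R r by simp
    define Z where "Z = (\<lambda>w0 \<rho> G'. 0 < \<rho> \<and> G' holomorphic_on ball w0 \<rho> \<and>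
        (\<forall>v\<in>ball w0 \<rho>. v \<in> ball 0 R \<longrightarrow> G' v = G1 v) \<and> (\<forall>v\<in>ball w0 \<rho>. v \<in> D \<longrightarrow> P G' v))"
    have "\<exists>\<rho> G'. Z w0 \<rho> G'" if w0: "cmod w0 = R" for w0
    proof -
      obtain \<rho> where \<rho>: "\<rho> > 0" "\<forall>w\<in>ball w0 \<rho> \<inter> D. w \<noteq> w0 \<longrightarrow>
        (\<forall>G. P G w \<longrightarrow> (\<exists>G'. G' holomorphic_on ball w0 \<rho> \<and> (\<forall>\<^sub>F v in nhds w. G' v = G v) \<and>
            (\<forall>v\<in>ball w0 \<rho> \<inter> D. P G' v)))"
        using local[of w0] w0 R R1 by auto
      let ?S = "ball w0 \<rho> \<inter> ball 0 R"
      have "w0 \<in> closure (ball 0 R)"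
        using w0 R0 by (simp add: closure_ball)
      moreover have "w0 \<in> ball w0 \<rho>"
        using \<rho>(1) by simp
      ultimately have "ball w0 \<rho> \<inter> closure (ball 0 R) \<noteq> {}"
        by blast
      then have "?S \<noteq> {}"
        using open_Int_closure_eq_empty[of "ball w0 \<rho>" "ball 0 R"] by blast
      moreover have "open ?S" "?S \<subseteq> ball 0 1"
        using R1 by auto
      \<comment> \<open>Continuation starts from a germ at a point of \<open>D\<close> other than
        the centre. Density supplies one in the overlap, and it differs from \<open>w0\<close>,
        which lies on the circle.\<close>
      ultimately obtain w where w: "w \<in> ?S" "w \<in> D"
        using dense[of ?S] by blast
      moreover have "w \<noteq> w0"
        using w w0 by auto
      moreover have "P G1 w"
        using EG1 w by (auto simp: E_def)
      ultimately obtain G' where G': "G' holomorphic_on ball w0 \<rho>" "\<forall>\<^sub>F v in nhds w. G' v = G1 v"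
          "\<forall>v\<in>ball w0 \<rho> \<inter> D. P G' v"
        using \<rho>(2) by blast
      obtain T where T: "open T" "w \<in> T" "\<forall>v\<in>T. G' v = G1 v"
        using G'(2) unfolding eventually_nhds by blast
      have "G' v = G1 v" if v: "v \<in> ?S" for v
      proof (rule analytic_continuation_open[of "T \<inter> ?S" ?S G' G1])
        show "connected ?S"
          by (intro convex_connected convex_Int convex_ball)
        show "G' holomorphic_on ?S"
          by (rule holomorphic_on_subset[OF G'(1)]) auto
        show "G1 holomorphic_on ?S"
          using EG1 by (auto simp: E_def intro: holomorphic_on_subset)
      qed (use T w v in auto)
      then have "Z w0 \<rho> G'"
        using \<rho>(1) G'(1,3) by (simp add: Z_def)
      then show ?thesis
        by blast
    qed
    then have "\<forall>w0. \<exists>p. cmod w0 = R \<longrightarrow> Z w0 (fst p) (snd p)"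
      by auto
    then obtain p where p: "\<forall>w0. cmod w0 = R \<longrightarrow> Z w0 (fst (p w0)) (snd (p w0))"
      using choice[of "\<lambda>w0 p. cmod w0 = R \<longrightarrow> Z w0 (fst p) (snd p)"] by blast
    define \<rho> where "\<rho> = (\<lambda>w0. fst (p w0))"
    define L where "L = (\<lambda>w0. snd (p w0))"
    have L: "\<And>w0. cmod w0 = R \<Longrightarrow> 0 < \<rho> w0"
        "\<And>w0. cmod w0 = R \<Longrightarrow> L w0 holomorphic_on ball w0 (\<rho> w0)"
        "\<And>w0 v. cmod w0 = R \<Longrightarrow> v \<in> ball w0 (\<rho> w0) \<Longrightarrow> v \<in> ball 0 R \<Longrightarrow> L w0 v = G1 v"
        "\<And>w0 v. cmod w0 = R \<Longrightarrow> v \<in> ball w0 (\<rho> w0) \<Longrightarrow> v \<in> D \<Longrightarrow> P (L w0) v"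
      using p unfolding Z_def \<rho>_def L_def by blast+
    have L_agree: "L w0 v = L w1 v" if w: "cmod w0 = R" "cmod w1 = R"
      "v \<in> ball w0 (\<rho> w0)" "v \<in> ball w1 (\<rho> w1)" for w0 w1 v
    proof (cases "v \<in> ball 0 R")
      case True
      then show ?thesis
        using L(3) w by metis
    next
      case False
      let ?S = "ball w0 (\<rho> w0) \<inter> ball w1 (\<rho> w1)"
      \<comment> \<open>Projecting \<open>v\<close> to the closed disk does not increase its
        distance to centres on the circle. So the overlap of two local disks, if it reaches outside,
        also meets \<open>ball 0 R\<close>, where both functions equal \<open>G1\<close>.\<close>
      define p where "p = closest_point (cball 0 R) v"
      have lip: "dist w' p \<le> dist w' v" if "cmod w' = R" for w'
      proof -
        have "closest_point (cball 0 R) w' = w'"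
          using that by (intro closest_point_self) auto
        moreover have "cball 0 R \<noteq> ({} :: complex set)"
          using R0 by auto
        ultimately show ?thesis
          using closest_point_lipschitz[of "cball 0 R" w' v] by (simp add: p_def)
      qed
      have "p \<in> ?S"
        using lip[OF w(1)] lip[OF w(2)] w(3,4) by auto
      moreover have "p \<in> closure (ball 0 R)"
      proof -
        have "cball 0 R \<noteq> ({} :: complex set)"
          using R0 by auto
        then show ?thesis
          using closest_point_in_set[of "cball 0 R" v] R0 by (simp add: p_def closure_ball)
      qed
      ultimately have "?S \<inter> closure (ball 0 R) \<noteq> {}"
        by blast
      then have ne: "?S \<inter> ball 0 R \<noteq> {}"
        using open_Int_closure_eq_empty[of ?S "ball 0 R"] by blast
      show ?thesis
      proof (rule analytic_continuation_open[of "?S \<inter> ball 0 R" ?S "L w0" "L w1"])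
        show "connected ?S"
          by (intro convex_connected convex_Int convex_ball)
        show "L w0 holomorphic_on ?S" "L w1 holomorphic_on ?S"
          using L(2) w by (auto intro: holomorphic_on_subset)
        show "L w0 z = L w1 z" if "z \<in> ?S \<inter> ball 0 R" for z
          using L(3) w that by (metis IntE)
      qed (use ne w in auto)
    qed
    define \<Omega> where "\<Omega> = ball 0 R \<union> (\<Union>w0\<in>{w0. cmod w0 = R}. ball w0 (\<rho> w0))"
    have "cball 0 R \<subseteq> \<Omega>"
    proof
      fix w :: complex assume "w \<in> cball 0 R"
      then consider "w \<in> ball 0 R" | "cmod w = R"
        by fastforce
      then show "w \<in> \<Omega>"
        using L(1)[of w] by cases (auto simp: \<Omega>_def)
    qed
    moreover have "open \<Omega>"
      by (auto simp: \<Omega>_def)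
    \<comment> \<open>Compactness of the closed disk gives a uniform margin, although the radii of
      the local disks may vary arbitrarily along the circle.\<close>
    ultimately obtain e where e: "e > 0" "(\<Union>x\<in>cball 0 R. ball x e) \<subseteq> \<Omega>"
      using compact_subset_open_imp_ball_epsilon_subset[OF compact_cball] by metis
    define R' where "R' = min 1 (R + e)"
    have R': "R < R'" "R' \<le> 1"
      using R1 e by (auto simp: R'_def)
    have cover: "\<exists>w0. cmod w0 = R \<and> w \<in> ball w0 (\<rho> w0)" if w: "cmod w < R'" "\<not> cmod w < R" for w
    proof -
      define x where "x = (R / cmod w) *\<^sub>R w"
      have w0: "cmod w > 0"
        using w(2) R0 by linarith
      have "cmod x = R"
        using w0 R0 by (simp add: x_def)
      moreover have "cmod (w - x) = cmod w - R"
      proof -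
        have "w - x = (1 - R / cmod w) *\<^sub>R w"
          by (simp add: x_def scaleR_diff_left)
        then have "cmod (w - x) = \<bar>1 - R / cmod w\<bar> * cmod w"
          by simp
        also have "\<dots> = cmod w - R"
          using w0 w(2) R0 by (simp add: abs_of_nonneg field_simps)
        finally show ?thesis .
      qed
      ultimately have "w \<in> (\<Union>x\<in>cball 0 R. ball x e)"
        using w(1) by (intro UN_I[of x]) (auto simp: R'_def dist_norm norm_minus_commute)
      then have "w \<in> \<Omega>"
        using e(2) by blast
      then show ?thesis
        using w(2) by (auto simp: \<Omega>_def)
    qed
    define G2 where "G2 = (\<lambda>w. if cmod w < R then G1 w else L (SOME w0. cmod w0 = R \<and> w \<in> ball w0 (\<rho> w0)) w)"
    have G2_L: "G2 v = L w0 v" if w0: "cmod w0 = R" "v \<in> ball w0 (\<rho> w0)" for v w0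
    proof (cases "cmod v < R")
      case True
      then show ?thesis
        using L(3)[OF w0] by (simp add: G2_def)
    next
      case False
      define w1 where "w1 = (SOME w0. cmod w0 = R \<and> v \<in> ball w0 (\<rho> w0))"
      have "cmod w1 = R \<and> v \<in> ball w1 (\<rho> w1)"
        unfolding w1_def by (rule someI[of _ w0]) (use w0 in simp)
      then have "L w1 v = L w0 v"
        using w0 by (intro L_agree) auto
      with False show ?thesis
        by (simp add: G2_def w1_def)
    qed
    have "E R' G2"
      unfolding E_def
    proof (intro conjI ballI)
      show "G2 holomorphic_on ball 0 R'"
      proof (rule holomorphic_on_locally)
        fix w :: complex assume w: "w \<in> ball 0 R'"
        show "\<exists>N f. open N \<and> w \<in> N \<and> f holomorphic_on N \<and> (\<forall>y\<in>N. G2 y = f y)"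
        proof (cases "cmod w < R")
          case True
          then show ?thesis
            using EG1 by (intro exI[of _ "ball 0 R"] exI[of _ G1]) (auto simp: E_def G2_def)
        next
          case False
          then obtain w0 where "cmod w0 = R" "w \<in> ball w0 (\<rho> w0)"
            using cover w by auto
          then show ?thesis
            using L(2) G2_L by (intro exI[of _ "ball w0 (\<rho> w0)"] exI[of _ "L w0"]) auto
        qed
      qed
      fix w assume w: "w \<in> ball 0 R' \<inter> D"
      show "P G2 w"
      proof (cases "cmod w < R")
        case True
        have ev: "\<forall>\<^sub>F v in nhds w. v \<in> ball 0 R"
          by (rule eventually_nhds_in_open) (use True in auto)
        have "\<forall>\<^sub>F v in nhds w. G1 v = G2 v"
          using ev by eventually_elim (simp add: G2_def)
        moreover have "P G1 w"
          using EG1 True w by (auto simp: E_def)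
        ultimately show ?thesis
          by (rule germ[rotated])
      next
        case False
        then obtain w0 where w0: "cmod w0 = R" "w \<in> ball w0 (\<rho> w0)"
          using cover w by auto
        have ev: "\<forall>\<^sub>F v in nhds w. v \<in> ball w0 (\<rho> w0)"
          by (rule eventually_nhds_in_open) (use w0 in auto)
        have "\<forall>\<^sub>F v in nhds w. L w0 v = G2 v"
          using ev by eventually_elim (simp add: G2_L[OF w0(1)])
        moreover have "P (L w0) w"
          using L(4)[OF w0] w by auto
        ultimately show ?thesis
          by (rule germ[rotated])
      qed
    next
      fix w assume "w \<in> ball (0 :: complex) r"
      then show "G2 w = G0 w"
        using EG1 R by (auto simp: E_def G2_def)
    qed
    then have "R' \<in> A"
      using R R' by (auto simp: A_def)
    then have "R' \<le> R"
      unfolding R_def using bdd by (rule cSup_upper)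
    with R' show False
      by simp
  qed
  with EG1 show ?thesis
    by (intro that[of G1]) (auto simp: E_def)
qed

section \<open>Critical values, fibres and uniqueness of lifts\<close>

context sheeted
begin

definition critical_values :: "complex set" where
  "critical_values = B ` critical_points B"

definition regular_values :: "complex set" where
  "regular_values = ball 0 1 - critical_values"

text \<open>Stronger than being noncritical: the whole fibre through the point is free of critical
  points, so that all its sheets continue together.\<close>

definition regular_points :: "complex set" where
  "regular_points = {z \<in> \<bbbD>. B z \<in> regular_values}"

definition fibre :: "complex \<Rightarrow> complex set" where
  "fibre w = {z \<in> \<bbbD>. B z = w}"

lemma section_noncritical:
  assumes N: "open N" "\<tau> holomorphic_on N" "\<And>w. w \<in> N \<Longrightarrow> \<tau> w \<in> \<bbbD> \<and> B (\<tau> w) = w" and w: "w \<in> N"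
  shows "deriv B (\<tau> w) \<noteq> 0"
  using deriv_section[OF B_holomorphic N w] by auto

lemma B_not_constant: "\<not> (\<lambda>z. B z - w) constant_on \<bbbD>"
proof
  assume "(\<lambda>z. B z - w) constant_on \<bbbD>"
  then obtain k where k: "\<And>z. z \<in> \<bbbD> \<Longrightarrow> B z - w = k"
    unfolding constant_on_def by blast
  obtain \<sigma> :: "nat \<Rightarrow> complex \<Rightarrow> complex" where "\<forall>k. \<forall>w\<in>ball 0 (1 / 2). \<sigma> k w \<in> \<bbbD> \<and> B (\<sigma> k w) = w"
    using sheets[of "1 / 2"] by auto
  then have \<sigma>: "\<sigma> 0 w \<in> \<bbbD> \<and> B (\<sigma> 0 w) = w" if "w \<in> ball 0 (1 / 2)" for w
    using that by blast
  define q :: complex where "q = of_real (1 / 4)"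
  have q: "q \<in> ball 0 (1 / 2)" "q \<noteq> 0"
    by (simp_all add: q_def norm_divide)
  have "0 - w = k" "q - w = k"
    using k[of "\<sigma> 0 0"] k[of "\<sigma> 0 q"] \<sigma>[of 0] \<sigma>[OF q(1)] by simp_all
  then have "q - w = 0 - w"
    by argo
  with q(2) show False
    by (metis diff_add_cancel)
qed

text \<open>If \<open>B\<close> were affine, its zeros on two different sections would make it
  constant.\<close>

lemma deriv_B_not_constant: "\<not> deriv B constant_on \<bbbD>"
proof
  assume "deriv B constant_on \<bbbD>"
  then obtain k where k: "\<And>z. z \<in> \<bbbD> \<Longrightarrow> deriv B z = k"
    unfolding constant_on_def by blast
  have "\<exists>c. \<forall>z\<in>\<bbbD>. B z - k * z = c"
  proof (rule has_field_derivative_zero_constant)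
    show "((\<lambda>z. B z - k * z) has_field_derivative 0) (at x within \<bbbD>)" if "x \<in> \<bbbD>" for x
      using holomorphic_derivI[OF B_holomorphic open_ball that] k[OF that]
      by (auto intro!: derivative_eq_intros intro: has_field_derivative_at_within)
  qed simp
  then obtain c where "\<And>z. z \<in> \<bbbD> \<Longrightarrow> B z - k * z = c"
    by blast
  from this[of 0] this have eq: "B z - k * z = B 0" if "z \<in> \<bbbD>" for z
    using that by simp
  have lin: "B z = B 0 + k * z" if "z \<in> \<bbbD>" for z
    using eq[OF that] by (simp only: diff_eq_eq)
  obtain \<sigma> :: "nat \<Rightarrow> complex \<Rightarrow> complex" where \<sigma>: "\<forall>k. \<forall>w\<in>ball 0 (1 / 2). \<sigma> k w \<in> \<bbbD> \<and> B (\<sigma> k w) = w"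
      "\<forall>k j. \<forall>w\<in>ball 0 (1 / 2). \<sigma> k w = \<sigma> j w \<longrightarrow> k = j"
    using sheets[of "1 / 2"] by auto
  have s: "\<sigma> 0 0 \<in> \<bbbD>" "\<sigma> 1 0 \<in> \<bbbD>" "B (\<sigma> 0 0) = 0" "B (\<sigma> 1 0) = 0" "\<sigma> 0 0 \<noteq> \<sigma> 1 0"
    using \<sigma>(1)[rule_format, of 0 0] \<sigma>(1)[rule_format, of 0 1] \<sigma>(2)[rule_format, of 0 0 1] by auto
  have "B 0 + k * \<sigma> 0 0 = B 0 + k * \<sigma> 1 0"
    using lin[OF s(1)] lin[OF s(2)] s(3,4) by argo
  then have "k = 0"
    using s(5) by simp
  then have "B z - 0 = B 0" if "z \<in> \<bbbD>" for z
    using lin[OF that] by simp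
  then have "(\<lambda>z. B z - 0) constant_on \<bbbD>"
    unfolding constant_on_def by blast
  then show False
    using B_not_constant by blast
qed

lemma finite_fibre_compact: "compact K \<Longrightarrow> K \<subseteq> \<bbbD> \<Longrightarrow> finite {z \<in> K. B z = w}"
proof -
  assume K: "compact K" "K \<subseteq> \<bbbD>"
  have "(\<lambda>z. B z - w) holomorphic_on \<bbbD>"
    by (intro holomorphic_intros B_holomorphic)
  from holomorphic_compact_finite_zeros[OF this open_ball connected_ball K B_not_constant]
  show ?thesis
    by simp
qed

lemma finite_critical_compact: "compact K \<Longrightarrow> K \<subseteq> \<bbbD> \<Longrightarrow> finite {z \<in> K. deriv B z = 0}"
  using holomorphic_compact_finite_zeros[of "deriv B" \<bbbD> K] deriv_B_not_constant
  by (auto intro!: holomorphic_deriv B_holomorphic)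

lemma countable_locally_finite:
  assumes "S \<subseteq> \<bbbD>" and fin: "\<And>K. compact K \<Longrightarrow> K \<subseteq> \<bbbD> \<Longrightarrow> finite (S \<inter> K)"
  shows "countable S"
proof -
  have "S \<subseteq> (\<Union>n. S \<inter> cball 0 (1 - 1 / real (Suc n)))"
  proof
    fix z assume z: "z \<in> S"
    then have "1 - cmod z > 0"
      using assms(1) by auto
    then obtain n where "inverse (real (Suc n)) < 1 - cmod z"
      using reals_Archimedean by blast
    then have "z \<in> cball 0 (1 - 1 / real (Suc n))"
      by (simp add: inverse_eq_divide)
    with z show "z \<in> (\<Union>n. S \<inter> cball 0 (1 - 1 / real (Suc n)))"
      by blast
  qed
  moreover have "finite (S \<inter> cball 0 (1 - 1 / real (Suc n)))" for n
  proof (rule fin)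
    show "cball 0 (1 - 1 / real (Suc n)) \<subseteq> \<bbbD>"
    proof
      fix z :: complex assume "z \<in> cball 0 (1 - 1 / real (Suc n))"
      then have "cmod z \<le> 1 - 1 / real (Suc n)"
        by (simp only: mem_cball dist_0_norm)
      moreover have "0 < 1 / real (Suc n)"
        by simp
      ultimately have "cmod z < 1"
        by argo
      then show "z \<in> \<bbbD>"
        by simp
    qed
  qed simp
  ultimately show ?thesis
    by (meson countable_UN countable_finite countable_subset countableI_type)
qed

lemma countable_fibre: "countable (fibre w)"
proof (rule countable_locally_finite)
  show "finite (fibre w \<inter> K)" if "compact K" "K \<subseteq> \<bbbD>" for K
    by (rule finite_subset[OF _ finite_fibre_compact[OF that, of w]]) (auto simp: fibre_def)
qed (auto simp: fibre_def)

lemma countable_critical_points: "countable (critical_points B)"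
proof (rule countable_locally_finite)
  show "finite (critical_points B \<inter> K)" if "compact K" "K \<subseteq> \<bbbD>" for K
    by (rule finite_subset[OF _ finite_critical_compact[OF that]]) (auto simp: critical_points_def)
qed (auto simp: critical_points_def)

text \<open>Sections consist of noncritical points, so every critical point over
  \<open>ball 0 r\<close> lies in the compact exceptional set, which contains finitely many of
  them.\<close>

lemma finite_critical_values: "finite (critical_values \<inter> ball 0 r)" if r1: "r < 1"
proof (cases "r > 0")
  case True
  obtain \<sigma> :: "nat \<Rightarrow> complex \<Rightarrow> complex" and K where \<sigma>: "compact K" "K \<subseteq> \<bbbD>"
      "\<forall>k. \<sigma> k holomorphic_on ball 0 r" "\<forall>k. \<forall>w\<in>ball 0 r. \<sigma> k w \<in> \<bbbD> \<and> B (\<sigma> k w) = w"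
      "\<forall>z\<in>\<bbbD>. cmod (B z) < r \<longrightarrow> z \<in> K \<or> (\<exists>k. z = \<sigma> k (B z))"
    using sheets[OF True r1] by blast
  have "critical_values \<inter> ball 0 r \<subseteq> B ` {z \<in> K. deriv B z = 0}"
  proof
    fix w assume w: "w \<in> critical_values \<inter> ball 0 r"
    then obtain z where z: "z \<in> \<bbbD>" "deriv B z = 0" "B z = w"
      by (auto simp: critical_values_def critical_points_def)
    have "z \<noteq> \<sigma> k (B z)" for k
      using section_noncritical[of "ball 0 r" "\<sigma> k" "B z"] \<sigma>(3,4) w z by auto
    then show "w \<in> B ` {z \<in> K. deriv B z = 0}"
      using \<sigma>(5) z w by auto
  qed
  then show ?thesis
    using finite_critical_compact[OF \<sigma>(1,2)] finite_subset by blast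
next
  case False
  then show ?thesis
    by (metis ball_eq_empty finite.emptyI inf_bot_right not_less)
qed

lemma open_regular_values: "open regular_values"
proof (rule openI)
  fix w assume w: "w \<in> regular_values"
  define r where "r = (1 + cmod w) / 2"
  have r: "cmod w < r" "r < 1"
    using w by (auto simp: r_def regular_values_def)
  have "open (ball 0 r - (critical_values \<inter> ball 0 r))"
    by (intro open_Diff open_ball finite_imp_closed finite_critical_values r)
  moreover have "w \<in> ball 0 r - (critical_values \<inter> ball 0 r)"
    using w r by (auto simp: regular_values_def)
  ultimately obtain e where "e > 0" "ball w e \<subseteq> ball 0 r - (critical_values \<inter> ball 0 r)"
    by (meson open_contains_ball_eq)
  then show "\<exists>T>0. ball w T \<subseteq> regular_values"
    using r by (intro exI[of _ e]) (auto simp: regular_values_def)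
qed

lemma countable_critical_values: "countable critical_values"
  unfolding critical_values_def by (intro countable_image countable_critical_points)

lemma regular_values_dense:
  assumes "open S" "S \<noteq> {}" "S \<subseteq> ball 0 1"
  shows "S \<inter> regular_values \<noteq> {}"
proof
  assume "S \<inter> regular_values = {}"
  then have "S \<subseteq> critical_values"
    using assms(3) by (auto simp: regular_values_def)
  then have "countable S"
    using countable_critical_values countable_subset by blast
  moreover obtain z where "z \<in> S"
    using assms(2) by blast
  moreover then obtain e where "e > 0" "ball z e \<subseteq> S"
    using openE[OF assms(1)] by blast
  ultimately show False
    using uncountable_ball countable_subset by blast
qed

lemma connected_regular_disk: "connected (ball 0 r \<inter> regular_values)" if "r \<le> 1"
proof -
  have "ball 0 r \<inter> regular_values = ball 0 r - critical_values"
    using that by (auto simp: regular_values_def)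
  then show ?thesis
    by (simp add: connected_open_diff_countable countable_critical_values)
qed

lemma continuous_B: "continuous_on \<bbbD> B"
  by (rule holomorphic_on_imp_continuous_on[OF B_holomorphic])

lemma open_regular_points: "open regular_points"
  using continuous_open_preimage[OF continuous_B open_ball open_regular_values]
  by (simp add: regular_points_def vimage_def Int_def)

text \<open>Only countably many points, those in fibres over critical values, are removed from the
  disk. Through this connectedness, quantities constant along sheets become constant on all regular
  points.\<close>

lemma connected_regular_points: "connected regular_points"
proof -
  have "regular_points = \<bbbD> - (\<Union>w\<in>critical_values. fibre w)"
    using B_less_1 by (auto simp: regular_points_def regular_values_def fibre_def)
  moreover have "countable (\<Union>w\<in>critical_values. fibre w)"
    by (intro countable_UN countable_critical_values countable_fibre)
  ultimately show ?thesis
    by (simp add: connected_open_diff_countable)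
qed

lemma regular_points_noncritical: "z \<in> regular_points \<Longrightarrow> deriv B z \<noteq> 0"
  by (auto simp: regular_points_def regular_values_def critical_values_def critical_points_def)

lemma fibre_regular: "w \<in> regular_values \<Longrightarrow> z \<in> fibre w \<Longrightarrow> z \<in> regular_points"
  by (simp add: fibre_def regular_points_def)

lemma infinite_fibre:
  assumes "cmod w < 1"
  shows "infinite (fibre w)"
proof -
  define r where "r = (1 + cmod w) / 2"
  have r: "0 < r" "cmod w < r" "r < 1"
    using assms by (auto simp: r_def add_pos_nonneg)
  obtain \<sigma> :: "nat \<Rightarrow> complex \<Rightarrow> complex" where \<sigma>: "\<forall>k. \<forall>w\<in>ball 0 r. \<sigma> k w \<in> \<bbbD> \<and> B (\<sigma> k w) = w"
      "\<forall>k j. \<forall>w\<in>ball 0 r. \<sigma> k w = \<sigma> j w \<longrightarrow> k = j"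
    using sheets[OF r(1,3)] by blast
  have "inj (\<lambda>k. \<sigma> k w)"
  proof (rule injI)
    fix k j assume "\<sigma> k w = \<sigma> j w"
    then show "k = j"
      using \<sigma>(2)[rule_format, of w k j] r by simp
  qed
  moreover have "range (\<lambda>k. \<sigma> k w) \<subseteq> fibre w"
    using \<sigma>(1) r by (auto simp: fibre_def)
  ultimately show ?thesis
    using range_inj_infinite infinite_super by blast
qed

lemma B_locally_injective:
  assumes "z \<in> \<bbbD>" "deriv B z \<noteq> 0"
  obtains r where "r > 0" "ball z r \<subseteq> \<bbbD>" "open (B ` ball z r)" "inj_on B (ball z r)"
  using has_complex_derivative_locally_invertible[OF B_holomorphic assms(1) open_ball assms(2)] by blast

lemma local_section:
  assumes "z \<in> \<bbbD>" "deriv B z \<noteq> 0"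
  obtains \<tau> d where "d > 0" "\<tau> holomorphic_on ball (B z) d" "\<tau> (B z) = z"
    "\<And>w. w \<in> ball (B z) d \<Longrightarrow> \<tau> w \<in> \<bbbD> \<and> B (\<tau> w) = w"
proof -
  obtain r where r: "r > 0" "ball z r \<subseteq> \<bbbD>" "open (B ` ball z r)" "inj_on B (ball z r)"
    using B_locally_injective[OF assms] .
  obtain \<tau> where \<tau>: "\<tau> holomorphic_on B ` ball z r" "\<And>x. x \<in> ball z r \<Longrightarrow> \<tau> (B x) = x"
    using holomorphic_has_inverse[OF holomorphic_on_subset[OF B_holomorphic r(2)] open_ball r(4)] by metis
  have "B z \<in> B ` ball z r"
    using r(1) by simp
  then obtain d where d: "d > 0" "ball (B z) d \<subseteq> B ` ball z r"
    using r(3) open_contains_ball_eq by blast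
  show ?thesis
  proof (rule that[of d \<tau>])
    show "\<tau> holomorphic_on ball (B z) d"
      by (rule holomorphic_on_subset[OF \<tau>(1) d(2)])
    show "\<tau> (B z) = z"
      using \<tau>(2) r(1) by simp
    show "\<tau> w \<in> \<bbbD> \<and> B (\<tau> w) = w" if w: "w \<in> ball (B z) d" for w
    proof -
      obtain x where "x \<in> ball z r" "w = B x"
        using w d(2) by blast
      then show ?thesis
        using \<tau>(2) r(2) by auto
    qed
  qed (rule d(1))
qed

text \<open>Near a noncritical coincidence \<open>B\<close> is injective, so the lifts agree on an
  open set. The identity theorem carries the agreement over \<open>A\<close>, even through critical
  points.\<close>

lemma lifts_agree:
  assumes A: "open A" "connected A" and f: "f holomorphic_on A" and g: "g holomorphic_on A"
    and lift: "\<And>x. x \<in> A \<Longrightarrow> f x \<in> \<bbbD> \<and> g x \<in> \<bbbD> \<and> B (f x) = B (g x)"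
    and x0: "x0 \<in> A" "f x0 = g x0" "deriv B (f x0) \<noteq> 0" and x: "x \<in> A"
  shows "f x = g x"
proof -
  obtain r where r: "r > 0" "ball (f x0) r \<subseteq> \<bbbD>" "inj_on B (ball (f x0) r)"
    using B_locally_injective[of "f x0"] lift x0 by metis
  let ?S = "A \<inter> f -` ball (f x0) r \<inter> (A \<inter> g -` ball (f x0) r)"
  have S_open: "open ?S"
    by (intro open_Int continuous_open_preimage[OF _ A(1) open_ball] holomorphic_on_imp_continuous_on f g)
  have S_ne: "?S \<noteq> {}"
    using x0 r by force
  have S_sub: "?S \<subseteq> A"
    by blast
  have S_eq: "f y = g y" if "y \<in> ?S" for y
    using inj_onD[OF r(3), of "f y" "g y"] lift that by auto
  show ?thesis
    by (rule analytic_continuation_open[OF S_open A(1) S_ne A(2) S_sub f g S_eq x])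
qed

lemma open_section_image:
  assumes N: "open N" "\<tau> holomorphic_on N" "\<And>w. w \<in> N \<Longrightarrow> B (\<tau> w) = w"
  shows "open (\<tau> ` N)"
  by (rule open_mapping_thm3[OF N(2,1)]) (metis N(3) inj_onI)

text \<open>Over a small disk every noncritical point of the central fibre continues to a section, and
  these sections exhaust the preimage up to a neighbourhood of the critical points.\<close>

lemma local_sections:
  assumes w0: "cmod w0 < 1" and Q: "open Q" "\<And>z. z \<in> fibre w0 \<Longrightarrow> deriv B z = 0 \<Longrightarrow> z \<in> Q"
  obtains \<tau> \<rho> where "\<rho> > 0"
    "\<And>x. x \<in> fibre w0 \<Longrightarrow> deriv B x \<noteq> 0 \<Longrightarrow> \<tau> x holomorphic_on ball w0 \<rho> \<and> \<tau> x w0 = x \<and>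
       (\<forall>w\<in>ball w0 \<rho>. \<tau> x w \<in> \<bbbD> \<and> B (\<tau> x w) = w)"
    "\<And>z. z \<in> \<bbbD> \<Longrightarrow> B z \<in> ball w0 \<rho> \<Longrightarrow>
       z \<in> Q \<or> (\<exists>x\<in>fibre w0. deriv B x \<noteq> 0 \<and> z = \<tau> x (B z))"
proof -
  define r where "r = (1 + cmod w0) / 2"
  have r: "0 < r" "cmod w0 < r" "r < 1"
    using w0 by (auto simp: r_def add_pos_nonneg)
  obtain \<sigma> :: "nat \<Rightarrow> complex \<Rightarrow> complex" and K where K: "compact K" "K \<subseteq> \<bbbD>"
    and \<sigma>: "\<forall>k. \<sigma> k holomorphic_on ball 0 r" "\<forall>k. \<forall>w\<in>ball 0 r. \<sigma> k w \<in> \<bbbD> \<and> B (\<sigma> k w) = w"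
      "\<forall>z\<in>\<bbbD>. cmod (B z) < r \<longrightarrow> z \<in> K \<or> (\<exists>k. z = \<sigma> k (B z))"
    using sheets[OF r(1,3)] by blast
  have w0r: "w0 \<in> ball 0 r"
    using r by simp
  define X where "X = {x \<in> K. B x = w0 \<and> deriv B x \<noteq> 0}"
  have X: "finite X" "X \<subseteq> \<bbbD>"
    using finite_subset[OF _ finite_fibre_compact[OF K, of w0], of X] K(2) by (auto simp: X_def)
  have "\<forall>x\<in>X. \<exists>\<tau> d. d > 0 \<and> \<tau> holomorphic_on ball w0 d \<and> \<tau> w0 = x \<and>
      (\<forall>w\<in>ball w0 d. \<tau> w \<in> \<bbbD> \<and> B (\<tau> w) = w)"
  proof
    fix x assume x: "x \<in> X"
    then have "x \<in> \<bbbD>" "deriv B x \<noteq> 0" "B x = w0"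
      using X by (auto simp: X_def)
    then show "\<exists>\<tau> d. d > 0 \<and> \<tau> holomorphic_on ball w0 d \<and> \<tau> w0 = x \<and>
      (\<forall>w\<in>ball w0 d. \<tau> w \<in> \<bbbD> \<and> B (\<tau> w) = w)"
      using local_section[of x] by metis
  qed
  then obtain \<tau>1 d where \<tau>1: "\<And>x. x \<in> X \<Longrightarrow> d x > 0 \<and> \<tau>1 x holomorphic_on ball w0 (d x) \<and> \<tau>1 x w0 = x \<and>
      (\<forall>w\<in>ball w0 (d x). \<tau>1 x w \<in> \<bbbD> \<and> B (\<tau>1 x w) = w)"
    by metis
  define \<rho>1 where "\<rho>1 = Min (insert (r - cmod w0) (d ` X))"
  have \<rho>1: "\<rho>1 > 0" "\<rho>1 \<le> r - cmod w0" "\<And>x. x \<in> X \<Longrightarrow> \<rho>1 \<le> d x"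
    using X r \<tau>1 by (auto simp: \<rho>1_def)
  have sub1: "ball w0 \<rho>1 \<subseteq> ball w0 (d x)" if "x \<in> X" for x
    using \<rho>1(3)[OF that] by (intro subset_ball)
  have sub2: "ball w0 \<rho>1 \<subseteq> ball 0 r"
  proof
    fix w assume "w \<in> ball w0 \<rho>1"
    then show "w \<in> ball 0 r"
      using \<rho>1(2) norm_triangle_ineq[of w0 "w - w0"] by (simp add: dist_norm norm_minus_commute)
  qed
  \<comment> \<open>Noncritical points of the fibre outside \<open>K\<close> lie on sections over
    all of \<open>ball 0 r\<close>; only the finitely many points of \<open>X\<close> need radii of
    their own. This is why one positive radius serves an infinite fibre.\<close>
  define \<tau> where "\<tau> = (\<lambda>x. if x \<in> X then \<tau>1 x else \<sigma> (SOME k. x = \<sigma> k w0))"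
  have \<tau>: "\<tau> x holomorphic_on ball w0 \<rho>1 \<and> \<tau> x w0 = x \<and> (\<forall>w\<in>ball w0 \<rho>1. \<tau> x w \<in> \<bbbD> \<and> B (\<tau> x w) = w)"
    if x: "x \<in> fibre w0" "deriv B x \<noteq> 0" for x
  proof (cases "x \<in> X")
    case True
    then show ?thesis
      using \<tau>1[OF True] sub1[OF True] holomorphic_on_subset[of "\<tau>1 x"] by (auto simp: \<tau>_def)
  next
    case False
    then have "\<exists>k. x = \<sigma> k w0"
      using \<sigma>(3) x r by (auto simp: X_def fibre_def)
    then have "x = \<sigma> (SOME k. x = \<sigma> k w0) w0"
      by (rule someI_ex)
    then show ?thesis
      using \<sigma>(1,2) sub2 holomorphic_on_subset[of "\<sigma> (SOME k. x = \<sigma> k w0)"] False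
      unfolding \<tau>_def by auto
  qed
  have O\<tau>: "open (\<tau> x ` ball w0 \<rho>1)" if "x \<in> fibre w0" "deriv B x \<noteq> 0" for x
    by (rule open_section_image) (use \<tau>[OF that] in auto)
  have \<sigma>_\<tau>: "z = \<tau> (\<sigma> k w0) (B z) \<and> \<sigma> k w0 \<in> fibre w0 \<and> deriv B (\<sigma> k w0) \<noteq> 0"
    if z: "z = \<sigma> k (B z)" "B z \<in> ball w0 \<rho>1" for z k
  proof -
    have nc: "deriv B (\<sigma> k w0) \<noteq> 0"
      using section_noncritical[of "ball 0 r" "\<sigma> k" w0] \<sigma> w0r by auto
    have fib: "\<sigma> k w0 \<in> fibre w0"
      using \<sigma>(2) w0r by (auto simp: fibre_def)
    note t = \<tau>[OF fib nc]
    have "\<tau> (\<sigma> k w0) (B z) = \<sigma> k (B z)"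
    proof (rule lifts_agree[of "ball w0 \<rho>1" "\<tau> (\<sigma> k w0)" "\<sigma> k" w0 "B z"])
      show "\<sigma> k holomorphic_on ball w0 \<rho>1"
        using \<sigma>(1) sub2 holomorphic_on_subset by blast
      show "\<tau> (\<sigma> k w0) y \<in> \<bbbD> \<and> \<sigma> k y \<in> \<bbbD> \<and> B (\<tau> (\<sigma> k w0) y) = B (\<sigma> k y)" if "y \<in> ball w0 \<rho>1" for y
        using t \<sigma>(2) that sub2 by auto
    qed (use t nc z \<rho>1(1) in auto)
    then show ?thesis
      using z fib nc by simp
  qed
  \<comment> \<open>What is left of \<open>K\<close> is compact and misses the fibre over
    \<open>w0\<close>, so its image under \<open>B\<close> keeps a distance from \<open>w0\<close>,
    and a smaller disk avoids it.\<close>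
  define K' where "K' = K - (Q \<union> (\<Union>x\<in>{x \<in> fibre w0. deriv B x \<noteq> 0}. \<tau> x ` ball w0 \<rho>1))"
  have K': "compact K'"
    unfolding K'_def using O\<tau> by (intro compact_diff K Q open_Un open_UN) auto
  have ne: "B z \<noteq> w0" if "z \<in> K'" for z
  proof
    assume "B z = w0"
    moreover have "z \<in> \<bbbD>"
      using that K(2) by (auto simp: K'_def)
    ultimately have fib: "z \<in> fibre w0"
      by (simp add: fibre_def)
    show False
    proof (cases "deriv B z = 0")
      case True
      then show False
        using Q(2)[OF fib] that by (simp add: K'_def)
    next
      case False
      then have "z \<in> \<tau> z ` ball w0 \<rho>1"
        using \<tau>[OF fib False] \<rho>1(1) by (intro image_eqI[of _ _ w0]) auto
      then show False
        using that fib False unfolding K'_def by blast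
    qed
  qed
  have "compact (B ` K')"
    using K' K(2) by (intro compact_continuous_image continuous_on_subset[OF continuous_B]) (auto simp: K'_def)
  then have "closed (B ` K')"
    by (rule compact_imp_closed)
  moreover have "w0 \<notin> B ` K'"
    using ne by auto
  ultimately have "open (- B ` K')" "w0 \<in> - B ` K'"
    by (simp_all add: open_Compl)
  then obtain e where e: "e > 0" "ball w0 e \<subseteq> - B ` K'"
    by (rule openE)
  define \<rho> where "\<rho> = min \<rho>1 e"
  have \<rho>: "\<rho> > 0" "ball w0 \<rho> \<subseteq> ball w0 \<rho>1"
    using e \<rho>1 by (auto simp: \<rho>_def)
  show ?thesis
  proof (rule that[of \<rho> \<tau>])
    show "\<tau> x holomorphic_on ball w0 \<rho> \<and> \<tau> x w0 = x \<and> (\<forall>w\<in>ball w0 \<rho>. \<tau> x w \<in> \<bbbD> \<and> B (\<tau> x w) = w)"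
      if "x \<in> fibre w0" "deriv B x \<noteq> 0" for x
      using \<tau>[OF that] \<rho>(2) holomorphic_on_subset by blast
    fix z assume z: "z \<in> \<bbbD>" "B z \<in> ball w0 \<rho>"
    then have "B z \<in> ball w0 \<rho>1" "B z \<in> ball 0 r"
      using \<rho>(2) sub2 by blast+
    then have z1: "B z \<in> ball w0 \<rho>1" "cmod (B z) < r"
      by simp_all
    show "z \<in> Q \<or> (\<exists>x\<in>fibre w0. deriv B x \<noteq> 0 \<and> z = \<tau> x (B z))"
    proof (cases "\<exists>k. z = \<sigma> k (B z)")
      case True
      then show ?thesis
        using \<sigma>_\<tau>[OF _ z1(1)] by metis
    next
      case False
      then have "z \<in> K"
        using \<sigma>(3) z z1 by blast
      moreover have "z \<notin> K'"
        using e(2) z(2) by (auto simp: \<rho>_def)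
      ultimately consider "z \<in> Q" | x where "x \<in> fibre w0" "deriv B x \<noteq> 0" "z \<in> \<tau> x ` ball w0 \<rho>1"
        unfolding K'_def by blast
      then show ?thesis
      proof cases
        case 2
        then obtain w where "w \<in> ball w0 \<rho>1" "z = \<tau> x w"
          by blast
        then have "z = \<tau> x (B z)"
          using \<tau>[OF 2(1,2)] by auto
        with 2 show ?thesis
          by blast
      qed simp
    qed
  qed (rule \<rho>(1))
qed

text \<open>Without critical points in the fibre the neighbourhood left out by
  \<open>local_sections\<close> can be empty. An enumeration of the countably infinite fibre turns
  its points into sheet indices.\<close>

lemma even_cover_exists:
  assumes w0: "w0 \<in> regular_values"
  obtains \<tau> \<rho> where "even_cover B \<tau> w0 \<rho>"
proof -
  have w01: "cmod w0 < 1"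
    using w0 by (simp add: regular_values_def)
  have nc: "deriv B z \<noteq> 0" if "z \<in> fibre w0" for z
    using regular_points_noncritical fibre_regular w0 that by blast
  obtain \<tau> \<rho> where \<rho>: "\<rho> > 0"
    and \<tau>: "\<And>x. x \<in> fibre w0 \<Longrightarrow> deriv B x \<noteq> 0 \<Longrightarrow> \<tau> x holomorphic_on ball w0 \<rho> \<and> \<tau> x w0 = x \<and>
       (\<forall>w\<in>ball w0 \<rho>. \<tau> x w \<in> \<bbbD> \<and> B (\<tau> x w) = w)"
    and cover: "\<And>z. z \<in> \<bbbD> \<Longrightarrow> B z \<in> ball w0 \<rho> \<Longrightarrow>
       z \<in> {} \<or> (\<exists>x\<in>fibre w0. deriv B x \<noteq> 0 \<and> z = \<tau> x (B z))"
    by (rule local_sections[OF w01 open_empty]) (use nc in auto)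
  define e where "e = from_nat_into (fibre w0)"
  have e: "bij_betw e UNIV (fibre w0)"
    unfolding e_def by (rule bij_betw_from_nat_into[OF countable_fibre infinite_fibre[OF w01]])
  have e_in: "e n \<in> fibre w0" for n
    using e bij_betwE by blast
  note \<tau>' = \<tau>[OF e_in nc[OF e_in]]
  have "even_cover B (\<lambda>n. \<tau> (e n)) w0 \<rho>"
  proof
    show "n = m" if "w \<in> ball w0 \<rho>" "\<tau> (e n) w = \<tau> (e m) w" for n m w
    proof -
      have "\<tau> (e n) w0 = \<tau> (e m) w0"
        by (rule lifts_agree[of "ball w0 \<rho>" "\<tau> (e n)" "\<tau> (e m)" w w0])
          (use \<tau>' that \<rho> section_noncritical[of "ball w0 \<rho>" "\<tau> (e n)" w] in auto)
      then have "e n = e m"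
        using \<tau>' by simp
      then show ?thesis
        using e by (auto simp: bij_betw_def inj_def)
    qed
    show "\<exists>n. z = \<tau> (e n) (B z)" if "z \<in> \<bbbD>" "B z \<in> ball w0 \<rho>" for z
      using cover[OF that] e by (auto simp: bij_betw_def) (metis imageE)
  qed (use \<tau>' \<rho> B_holomorphic in auto)
  then show ?thesis
    by (rule that)
qed

end

context even_cover
begin

lemma even_cover_shrink:
  assumes "0 < \<rho>'" "\<rho>' \<le> \<rho>"
  shows "even_cover B \<tau> w0 \<rho>'"
proof -
  have sub: "ball w0 \<rho>' \<subseteq> ball w0 \<rho>"
    using assms by (intro subset_ball)
  show ?thesis
    by unfold_locales (use assms sub \<tau>_hol \<tau>_in B_\<tau> \<tau>_inj \<tau>_cover B_hol holomorphic_on_subset in blast)+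
qed

end

section \<open>Equivalence of points in a fibre\<close>

abbreviation exchange :: "'a \<Rightarrow> 'a \<Rightarrow> 'a \<Rightarrow> 'a" where
  "exchange \<equiv> Transposition.transpose"

text \<open>\<open>c\<close> stands for the matrix entries \<open>kern\<close> of an operator in the commutant, and \<open>W0\<close> for the
  critical values that may have several or degenerate critical points in their fibre.\<close>

locale invariant_kernel = sheeted B for B +
  fixes c :: "complex \<Rightarrow> complex \<Rightarrow> complex" and W0 :: "complex set"
  assumes locally_constant: "w0 \<in> regular_values \<Longrightarrow> \<exists>\<tau> \<rho>. even_cover B \<tau> w0 \<rho> \<and>
      (\<forall>w\<in>ball w0 \<rho>. \<forall>i j. c (\<tau> i w) (\<tau> j w) = c (\<tau> i w0) (\<tau> j w0))"
    and finite_W0: "finite W0" and W0_subset: "W0 \<subseteq> ball 0 1"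
    and simple_critical: "w0 \<in> critical_values - W0 \<Longrightarrow> \<exists>p\<in>\<bbbD>. B p = w0 \<and> deriv B p = 0 \<and>
      deriv (deriv B) p \<noteq> 0 \<and> (\<forall>q\<in>fibre w0. deriv B q = 0 \<longrightarrow> q = p)"
begin

definition local_cover :: "(nat \<Rightarrow> complex \<Rightarrow> complex) \<Rightarrow> complex \<Rightarrow> real \<Rightarrow> bool" where
  "local_cover \<tau> w0 \<rho> \<longleftrightarrow> even_cover B \<tau> w0 \<rho> \<and>
      (\<forall>w\<in>ball w0 \<rho>. \<forall>i j. c (\<tau> i w) (\<tau> j w) = c (\<tau> i w0) (\<tau> j w0))"

lemma local_cover_exists:
  assumes "w0 \<in> regular_values"
  obtains \<tau> \<rho> where "local_cover \<tau> w0 \<rho>"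
  using locally_constant[OF assms] unfolding local_cover_def by blast

context
  fixes \<tau> w0 \<rho>
  assumes lc: "local_cover \<tau> w0 \<rho>"
begin

lemma cover_ec: "even_cover B \<tau> w0 \<rho>"
  using lc by (simp add: local_cover_def)

lemma cover_pos: "\<rho> > 0"
  using even_cover.\<rho>_pos[OF cover_ec] .

lemma cover_hol: "\<tau> n holomorphic_on ball w0 \<rho>"
  using even_cover.\<tau>_hol[OF cover_ec] .

lemma cover_lift: "w \<in> ball w0 \<rho> \<Longrightarrow> \<tau> n w \<in> \<bbbD> \<and> B (\<tau> n w) = w"
  using even_cover.\<tau>_in[OF cover_ec] even_cover.B_\<tau>[OF cover_ec] by blast

lemma cover_eq_iff: "w \<in> ball w0 \<rho> \<Longrightarrow> \<tau> n w = \<tau> m w \<longleftrightarrow> n = m"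
  using even_cover.\<tau>_inj[OF cover_ec] by blast

lemma cover_point: "z \<in> \<bbbD> \<Longrightarrow> B z \<in> ball w0 \<rho> \<Longrightarrow> \<exists>n. z = \<tau> n (B z)"
  using even_cover.\<tau>_cover[OF cover_ec] by blast

lemma cover_c: "w \<in> ball w0 \<rho> \<Longrightarrow> c (\<tau> i w) (\<tau> j w) = c (\<tau> i w0) (\<tau> j w0)"
  using lc by (auto simp: local_cover_def)

lemma cover_fibre: "w \<in> ball w0 \<rho> \<Longrightarrow> fibre w = range (\<lambda>n. \<tau> n w)"
  using cover_point cover_lift by (fastforce simp: fibre_def)

lemma cover_regular_value: "w \<in> ball w0 \<rho> \<Longrightarrow> w \<in> regular_values"
proof -
  assume w: "w \<in> ball w0 \<rho>"
  have "deriv B z \<noteq> 0" if z: "z \<in> \<bbbD>" "B z = w" for z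
  proof -
    obtain n where "z = \<tau> n w"
      using cover_point[OF z(1)] z(2) w by blast
    then show ?thesis
      using section_noncritical[of "ball w0 \<rho>" "\<tau> n" w] cover_hol cover_lift w by auto
  qed
  moreover have "cmod w < 1"
    using cover_lift[OF w, of 0] B_less_1[of "\<tau> 0 w"] by simp
  ultimately show ?thesis
    by (auto simp: regular_values_def critical_values_def critical_points_def)
qed

lemma cover_regular_point: "w \<in> ball w0 \<rho> \<Longrightarrow> \<tau> n w \<in> regular_points"
  using cover_regular_value cover_lift by (simp add: regular_points_def)

lemma cover_near:
  assumes "w \<in> ball w0 \<rho>"
  shows "\<forall>\<^sub>F z in nhds (\<tau> n w). B z \<in> ball w0 \<rho> \<and> z = \<tau> n (B z)"
proof -
  have "open (\<tau> n ` ball w0 \<rho>)"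
    by (rule open_section_image[OF open_ball cover_hol]) (use cover_lift in blast)
  then have "\<forall>\<^sub>F z in nhds (\<tau> n w). z \<in> \<tau> n ` ball w0 \<rho>"
    by (rule eventually_nhds_in_open) (use assms in blast)
  then show ?thesis
    by eventually_elim (use cover_lift in auto)
qed

end

text \<open>Two points of a fibre are equivalent if exchanging them preserves the kernel.\<close>

definition eqv :: "complex \<Rightarrow> complex \<Rightarrow> bool" where
  "eqv z \<zeta> \<longleftrightarrow> z \<in> regular_points \<and> \<zeta> \<in> fibre (B z) \<and>
     (\<forall>x\<in>fibre (B z). \<forall>y\<in>fibre (B z). c (exchange z \<zeta> x) (exchange z \<zeta> y) = c x y)"

definition cls :: "complex \<Rightarrow> complex set" where
  "cls z = {\<zeta>. eqv z \<zeta>}"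

lemma eqv_imp: "eqv z \<zeta> \<Longrightarrow> z \<in> regular_points \<and> \<zeta> \<in> regular_points \<and> B \<zeta> = B z \<and> \<zeta> \<in> \<bbbD> \<and> z \<in> \<bbbD>"
  by (auto simp: eqv_def fibre_def regular_points_def)

lemma eqv_refl: "z \<in> regular_points \<Longrightarrow> eqv z z"
  by (auto simp: eqv_def fibre_def regular_points_def)

lemma eqv_sym: "eqv z \<zeta> \<Longrightarrow> eqv \<zeta> z"
  using eqv_imp[of z \<zeta>] unfolding eqv_def by (auto simp: Transposition.transpose_commute fibre_def)

lemma transpose_fibre: "x \<in> fibre w \<Longrightarrow> z \<in> fibre w \<Longrightarrow> \<zeta> \<in> fibre w \<Longrightarrow> exchange z \<zeta> x \<in> fibre w"
  by (auto simp: Transposition.transpose_def)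

text \<open>For distinct points, the transposition of \<open>z\<close> and \<open>\<eta>\<close> is
  the conjugate of that of \<open>\<zeta>\<close> and \<open>\<eta>\<close> by that of
  \<open>z\<close> and \<open>\<zeta>\<close>.\<close>

lemma eqv_trans:
  assumes 1: "eqv z \<zeta>" and 2: "eqv \<zeta> \<eta>"
  shows "eqv z \<eta>"
proof (cases "z = \<zeta> \<or> \<zeta> = \<eta> \<or> z = \<eta>")
  case True
  then show ?thesis
    using 1 2 eqv_refl eqv_imp[OF 1] by auto
next
  case False
  have fib: "z \<in> fibre (B z)" "\<zeta> \<in> fibre (B z)" "\<eta> \<in> fibre (B z)" and B: "B \<zeta> = B z"
    using eqv_imp[OF 1] eqv_imp[OF 2] by (auto simp: fibre_def)
  have c1: "c (exchange z \<zeta> x) (exchange z \<zeta> y) = c x y" if "x \<in> fibre (B z)" "y \<in> fibre (B z)" for x y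
    using 1 that by (auto simp: eqv_def)
  have c2: "c (exchange \<zeta> \<eta> x) (exchange \<zeta> \<eta> y) = c x y" if "x \<in> fibre (B z)" "y \<in> fibre (B z)" for x y
    using 2 that B by (auto simp: eqv_def)
  have dec: "exchange z \<eta> x = exchange z \<zeta> (exchange \<zeta> \<eta> (exchange z \<zeta> x))" for x
    using False by (auto simp: Transposition.transpose_def)
  have "c (exchange z \<eta> x) (exchange z \<eta> y) = c x y" if "x \<in> fibre (B z)" "y \<in> fibre (B z)" for x y
    unfolding dec using that fib by (simp add: c1 c2 transpose_fibre)
  then show ?thesis
    using fib eqv_imp[OF 1] by (simp add: eqv_def)
qed

lemma cls_eq: "eqv z \<zeta> \<Longrightarrow> cls z = cls \<zeta>"
  unfolding cls_def using eqv_trans eqv_sym by blast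

text \<open>Equivalence read off on sheet indices at the centre of a local cover. As no moving base
  point occurs, comparison with \<open>eqv\<close> shows that equivalence is constant along
  sheets.\<close>

definition index_eqv :: "(nat \<Rightarrow> complex \<Rightarrow> complex) \<Rightarrow> complex \<Rightarrow> nat \<Rightarrow> nat \<Rightarrow> bool" where
  "index_eqv \<tau> w0 i j \<longleftrightarrow> (\<forall>m n. c (\<tau> (exchange i j m) w0) (\<tau> (exchange i j n) w0) = c (\<tau> m w0) (\<tau> n w0))"

lemma eqv_cover:
  assumes lc: "local_cover \<tau> w0 \<rho>" and w: "w \<in> ball w0 \<rho>"
  shows "eqv (\<tau> i w) (\<tau> j w) \<longleftrightarrow> index_eqv \<tau> w0 i j"
proof -
  have tr: "exchange (\<tau> i w) (\<tau> j w) (\<tau> m w) = \<tau> (exchange i j m) w" for m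
    using cover_eq_iff[OF lc w] by (auto simp: Transposition.transpose_def)
  have "eqv (\<tau> i w) (\<tau> j w) \<longleftrightarrow> (\<forall>m n. c (\<tau> (exchange i j m) w) (\<tau> (exchange i j n) w) = c (\<tau> m w) (\<tau> n w))"
    using cover_regular_point[OF lc w] cover_lift[OF lc w]
    by (auto simp: eqv_def cover_fibre[OF lc w] tr)
  also have "\<dots> \<longleftrightarrow> index_eqv \<tau> w0 i j"
    unfolding index_eqv_def cover_c[OF lc w] ..
  finally show ?thesis .
qed

lemma cls_cover:
  assumes lc: "local_cover \<tau> w0 \<rho>" and w: "w \<in> ball w0 \<rho>"
  shows "cls (\<tau> i w) = (\<lambda>j. \<tau> j w) ` {j. index_eqv \<tau> w0 i j}"
proof
  show "(\<lambda>j. \<tau> j w) ` {j. index_eqv \<tau> w0 i j} \<subseteq> cls (\<tau> i w)"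
    using eqv_cover[OF lc w] by (auto simp: cls_def)
  show "cls (\<tau> i w) \<subseteq> (\<lambda>j. \<tau> j w) ` {j. index_eqv \<tau> w0 i j}"
  proof
    fix \<zeta> assume \<zeta>: "\<zeta> \<in> cls (\<tau> i w)"
    then have "\<zeta> \<in> fibre w"
      using cover_lift[OF lc w] by (auto simp: cls_def eqv_def)
    then obtain j where "\<zeta> = \<tau> j w"
      using cover_fibre[OF lc w] by auto
    then show "\<zeta> \<in> (\<lambda>j. \<tau> j w) ` {j. index_eqv \<tau> w0 i j}"
      using \<zeta> eqv_cover[OF lc w] by (auto simp: cls_def)
  qed
qed

lemma lift_near:
  assumes lc: "local_cover \<tau> (B (\<alpha> x)) \<rho>" and cont: "continuous_on A \<alpha>" and x: "x \<in> A"
    and i: "\<alpha> x = \<tau> i (B (\<alpha> x))"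
  shows "\<forall>\<^sub>F y in at x within A. B (\<alpha> y) \<in> ball (B (\<alpha> x)) \<rho> \<and> \<alpha> y = \<tau> i (B (\<alpha> y))"
proof -
  have lim: "filterlim \<alpha> (nhds (\<alpha> x)) (at x within A)"
    using cont x by (simp add: continuous_on_def)
  have "\<forall>\<^sub>F z in nhds (\<alpha> x). B z \<in> ball (B (\<alpha> x)) \<rho> \<and> z = \<tau> i (B z)"
    using cover_near[OF lc, of "B (\<alpha> x)" i] cover_pos[OF lc] i by simp
  then show ?thesis
    using lim by (rule eventually_compose_filterlim)
qed

text \<open>Near each parameter both lifts stay on one sheet, so \<open>\<Phi>\<close> is locally
  constant along the pair, and connectedness finishes. This takes the place of continuation along
  paths, for matrix entries, for the equivalence and for the size of classes.\<close>

lemma local_invariant_constant: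
  fixes A :: "complex set" and \<Phi> :: "complex \<Rightarrow> complex \<Rightarrow> 'b"
  assumes A: "connected A" and \<alpha>: "continuous_on A \<alpha>" and \<beta>: "continuous_on A \<beta>"
    and lift: "\<And>x. x \<in> A \<Longrightarrow> \<alpha> x \<in> regular_points \<and> \<beta> x \<in> \<bbbD> \<and> B (\<beta> x) = B (\<alpha> x)"
    and \<Phi>: "\<And>\<tau> w0 \<rho> w i j. local_cover \<tau> w0 \<rho> \<Longrightarrow> w \<in> ball w0 \<rho> \<Longrightarrow> \<Phi> (\<tau> i w) (\<tau> j w) = \<Phi> (\<tau> i w0) (\<tau> j w0)"
    and ab: "a \<in> A" "b \<in> A"
  shows "\<Phi> (\<alpha> a) (\<beta> a) = \<Phi> (\<alpha> b) (\<beta> b)"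
proof (rule connected_local_const[OF A ab, of "\<lambda>x. \<Phi> (\<alpha> x) (\<beta> x)"], rule ballI)
  fix x assume x: "x \<in> A"
  let ?w = "B (\<alpha> x)"
  have "?w \<in> regular_values"
    using lift[OF x] by (simp add: regular_points_def)
  then obtain \<tau> \<rho> where lc: "local_cover \<tau> ?w \<rho>"
    using local_cover_exists by blast
  have w: "?w \<in> ball ?w \<rho>"
    using cover_pos[OF lc] by simp
  obtain i where i: "\<alpha> x = \<tau> i ?w"
    using cover_point[OF lc, of "\<alpha> x"] lift[OF x] w by (auto simp: regular_points_def)
  obtain j where j: "\<beta> x = \<tau> j ?w"
    using cover_point[OF lc, of "\<beta> x"] lift[OF x] w by auto
  have 1: "\<forall>\<^sub>F y in at x within A. B (\<alpha> y) \<in> ball ?w \<rho> \<and> \<alpha> y = \<tau> i (B (\<alpha> y))"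
    by (rule lift_near[OF lc \<alpha> x i])
  have 2: "\<forall>\<^sub>F y in at x within A. B (\<beta> y) \<in> ball ?w \<rho> \<and> \<beta> y = \<tau> j (B (\<beta> y))"
    using lift_near[of \<tau> \<beta> x \<rho> A j] lc \<beta> x j lift[OF x] by simp
  have 3: "\<forall>\<^sub>F y in at x within A. y \<in> A"
    by (simp add: eventually_at_filter)
  show "\<forall>\<^sub>F y in at x within A. \<Phi> (\<alpha> x) (\<beta> x) = \<Phi> (\<alpha> y) (\<beta> y)"
    using 1 2 3
  proof eventually_elim
    case (elim y)
    have "\<Phi> (\<alpha> y) (\<beta> y) = \<Phi> (\<tau> i (B (\<alpha> y))) (\<tau> j (B (\<alpha> y)))"
      using elim lift[of y] by metis
    also have "\<dots> = \<Phi> (\<tau> i ?w) (\<tau> j ?w)"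
      by (rule \<Phi>[OF lc]) (use elim in blast)
    finally show ?case
      using i j by metis
  qed
qed

lemma c_constant:
  assumes "connected (A :: complex set)" "continuous_on A \<alpha>" "continuous_on A \<beta>"
    "\<And>x. x \<in> A \<Longrightarrow> \<alpha> x \<in> regular_points \<and> \<beta> x \<in> \<bbbD> \<and> B (\<beta> x) = B (\<alpha> x)" "a \<in> A" "b \<in> A"
  shows "c (\<alpha> a) (\<beta> a) = c (\<alpha> b) (\<beta> b)"
proof (rule local_invariant_constant[OF assms(1-3) _ _ assms(5,6)])
  show "c (\<tau> i w) (\<tau> j w) = c (\<tau> i w0) (\<tau> j w0)"
    if "local_cover \<tau> w0 \<rho>" "w \<in> ball w0 \<rho>" for \<tau> w0 \<rho> w i j
    by (rule cover_c[OF that])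
qed (rule assms(4))

lemma eqv_constant:
  assumes "connected (A :: complex set)" "continuous_on A \<alpha>" "continuous_on A \<beta>"
    "\<And>x. x \<in> A \<Longrightarrow> \<alpha> x \<in> regular_points \<and> \<beta> x \<in> \<bbbD> \<and> B (\<beta> x) = B (\<alpha> x)" "a \<in> A" "b \<in> A"
  shows "eqv (\<alpha> a) (\<beta> a) \<longleftrightarrow> eqv (\<alpha> b) (\<beta> b)"
proof (rule local_invariant_constant[OF assms(1-3) _ _ assms(5,6)])
  show "eqv (\<tau> i w) (\<tau> j w) = eqv (\<tau> i w0) (\<tau> j w0)"
    if "local_cover \<tau> w0 \<rho>" "w \<in> ball w0 \<rho>" for \<tau> w0 \<rho> w i j
    using eqv_cover[OF that] eqv_cover[OF that(1), of w0] cover_pos[OF that(1)] by simp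
qed (rule assms(4))

lemma cls_card_cover:
  assumes lc: "local_cover \<tau> w0 \<rho>" and w: "w \<in> ball w0 \<rho>"
  shows "card (cls (\<tau> i w)) = card {j. index_eqv \<tau> w0 i j}"
    and "finite (cls (\<tau> i w)) \<longleftrightarrow> finite {j. index_eqv \<tau> w0 i j}"
proof -
  have "inj_on (\<lambda>j. \<tau> j w) {j. index_eqv \<tau> w0 i j}"
    using cover_eq_iff[OF lc w] by (auto simp: inj_on_def)
  then show "card (cls (\<tau> i w)) = card {j. index_eqv \<tau> w0 i j}"
    and "finite (cls (\<tau> i w)) \<longleftrightarrow> finite {j. index_eqv \<tau> w0 i j}"
    unfolding cls_cover[OF lc w] by (simp_all add: card_image finite_image_iff)
qed

lemma cls_card_constant:
  assumes "a \<in> regular_points" "b \<in> regular_points"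
  shows "card (cls a) = card (cls b)" "finite (cls a) \<longleftrightarrow> finite (cls b)"
proof -
  have lift: "x \<in> regular_points \<and> x \<in> \<bbbD> \<and> B x = B x" if "x \<in> regular_points" for x
    using that by (simp add: regular_points_def)
  show "card (cls a) = card (cls b)"
    by (rule local_invariant_constant[OF connected_regular_points continuous_on_id continuous_on_id lift
          _ assms, where \<Phi> = "\<lambda>x y. card (cls x)"])
      (use cls_card_cover(1) cover_pos centre_in_ball in metis)+
  show "finite (cls a) \<longleftrightarrow> finite (cls b)"
    by (rule local_invariant_constant[OF connected_regular_points continuous_on_id continuous_on_id lift
          _ assms, where \<Phi> = "\<lambda>x y. finite (cls x)"])
      (use cls_card_cover(2) cover_pos centre_in_ball in metis)+
qed

end

section \<open>Fibres near a simple critical value\<close>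

context invariant_kernel
begin

definition noncritical_fibre :: "complex \<Rightarrow> complex set" where
  "noncritical_fibre w = {x \<in> fibre w. deriv B x \<noteq> 0}"

text \<open>The preimage of a disk about \<open>w0\<close> splits into a double sheet uniformized by
  \<open>u\<close>, with \<open>B (\<pi> u) = w0 + u\<^sup>2\<close>, and unbranched sheets through
  the remaining points of the central fibre. The base has radius \<open>s\<^sup>2\<close> because of
  the square.\<close>

definition branched_cover ::
  "complex \<Rightarrow> real \<Rightarrow> (complex \<Rightarrow> complex) \<Rightarrow> (complex \<Rightarrow> complex \<Rightarrow> complex) \<Rightarrow> bool" where
  "branched_cover w0 s \<pi> \<tau> \<longleftrightarrow> s > 0 \<and> \<pi> holomorphic_on ball 0 s \<and> inj_on \<pi> (ball 0 s) \<and>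
     (\<forall>u\<in>ball 0 s. \<pi> u \<in> \<bbbD> \<and> B (\<pi> u) = w0 + u\<^sup>2) \<and>
     (\<forall>x\<in>noncritical_fibre w0. \<tau> x holomorphic_on ball w0 (s\<^sup>2) \<and>
        (\<forall>w\<in>ball w0 (s\<^sup>2). \<tau> x w \<in> \<bbbD> \<and> B (\<tau> x w) = w)) \<and>
     (\<forall>z\<in>\<bbbD>. B z \<in> ball w0 (s\<^sup>2) \<longrightarrow>
        (\<exists>u\<in>ball 0 s. z = \<pi> u) \<or> (\<exists>x\<in>noncritical_fibre w0. z = \<tau> x (B z))) \<and>
     (\<forall>u\<in>ball 0 s. \<forall>x\<in>noncritical_fibre w0. \<pi> u \<noteq> \<tau> x (w0 + u\<^sup>2)) \<and>
     ball w0 (s\<^sup>2) - {w0} \<subseteq> regular_values"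

lemma square_in_ball: "u \<in> ball 0 s \<Longrightarrow> w0 + u\<^sup>2 \<in> ball w0 (s\<^sup>2)" for u w0 :: complex
  by (auto simp: dist_norm norm_power intro!: power_strict_mono)

text \<open>Near the simple critical point \<open>B - w0\<close> is the square of a locally
  invertible function, whose inverse is \<open>\<pi>\<close>. The image of \<open>\<pi>\<close> is
  the neighbourhood of the critical point handed to \<open>local_sections\<close>.\<close>

lemma branched_cover_exists:
  assumes w0: "w0 \<in> critical_values - W0"
  obtains s \<pi> \<tau> where "branched_cover w0 s \<pi> \<tau>"
proof -
  obtain p where p: "p \<in> \<bbbD>" "B p = w0" "deriv B p = 0" "deriv (deriv B) p \<noteq> 0"
      "\<forall>q\<in>fibre w0. deriv B q = 0 \<longrightarrow> q = p"
    using simple_critical[OF w0] by blast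
  have d1: "(deriv ^^ 2) B p \<noteq> 0"
    using p(4) by (simp add: numeral_2_eq_2)
  have d2: "(deriv ^^ i) B p = 0" if "0 < i" "i < 2" for i
  proof -
    have "i = 1"
      using that by simp
    then show ?thesis
      using p(3) by simp
  qed
  obtain g r where g: "r > 0" "g holomorphic_on ball p r"
      "\<And>w. w \<in> ball p r \<Longrightarrow> B w - B p = ((w - p) * g w)\<^sup>2" "\<And>w. w \<in> ball p r \<Longrightarrow> g w \<noteq> 0"
  proof (rule holomorphic_factor_order_of_zero_strong[OF B_holomorphic open_ball p(1) zero_less_numeral d1])
    fix g r assume "0 < r" "g holomorphic_on ball p r"
      "\<And>w. w \<in> ball p r \<Longrightarrow> B w - B p = ((w - p) * g w)\<^sup>2" "\<And>w. w \<in> ball p r \<Longrightarrow> g w \<noteq> 0"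
    then show thesis
      by (rule that)
  qed (rule d2)
  define \<psi> where "\<psi> = (\<lambda>w. (w - p) * g w)"
  have \<psi>_hol: "\<psi> holomorphic_on ball p r"
    unfolding \<psi>_def by (intro holomorphic_intros g)
  have "(g has_field_derivative deriv g p) (at p)"
    by (rule holomorphic_derivI[OF g(2) open_ball]) (use g(1) in simp)
  then have "(\<psi> has_field_derivative g p) (at p)"
    unfolding \<psi>_def by (auto intro!: derivative_eq_intros)
  then have "deriv \<psi> p \<noteq> 0"
    using g(1,4) by (simp add: DERIV_imp_deriv)
  moreover have "\<psi> holomorphic_on ball p r \<inter> \<bbbD>" "p \<in> ball p r \<inter> \<bbbD>" "open (ball p r \<inter> \<bbbD>)"
    using holomorphic_on_subset[OF \<psi>_hol] g(1) p(1) by auto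
  ultimately obtain r1 where r1: "r1 > 0" "ball p r1 \<subseteq> ball p r \<inter> \<bbbD>" "open (\<psi> ` ball p r1)" "inj_on \<psi> (ball p r1)"
    using has_complex_derivative_locally_invertible[of \<psi> "ball p r \<inter> \<bbbD>" p] by metis
  have \<psi>_hol1: "\<psi> holomorphic_on ball p r1"
    using holomorphic_on_subset[OF \<psi>_hol] r1(2) by blast
  obtain \<pi> where \<pi>: "\<pi> holomorphic_on \<psi> ` ball p r1" "\<And>z. z \<in> ball p r1 \<Longrightarrow> \<pi> (\<psi> z) = z"
    using holomorphic_has_inverse[OF \<psi>_hol1 open_ball r1(4)] by metis
  have "0 \<in> \<psi> ` ball p r1"
    using r1(1) by (intro image_eqI[of _ _ p]) (auto simp: \<psi>_def)
  then obtain s0 where s0: "s0 > 0" "ball 0 s0 \<subseteq> \<psi> ` ball p r1"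
    using openE[OF r1(3)] by blast
  have \<pi>1: "\<pi> u \<in> ball p r1 \<and> \<psi> (\<pi> u) = u" if "u \<in> ball 0 s0" for u
    using s0(2) \<pi>(2) that by auto
  have \<pi>2: "\<pi> u \<in> \<bbbD> \<and> B (\<pi> u) = w0 + u\<^sup>2" if "u \<in> ball 0 s0" for u
  proof
    have "\<pi> u \<in> ball p r \<inter> \<bbbD>"
      using \<pi>1[OF that] r1(2) by blast
    then show "\<pi> u \<in> \<bbbD>"
      by blast
    have "B (\<pi> u) - B p = (\<psi> (\<pi> u))\<^sup>2"
      using g(3)[of "\<pi> u"] \<open>\<pi> u \<in> ball p r \<inter> \<bbbD>\<close> by (simp add: \<psi>_def)
    then show "B (\<pi> u) = w0 + u\<^sup>2"
      using \<pi>1[OF that] p(2) by (simp add: diff_eq_eq add.commute)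
  qed
  have \<pi>0: "\<pi> 0 = p"
    using \<pi>(2)[of p] r1(1) by (simp add: \<psi>_def)
  have \<pi>_hol: "\<pi> holomorphic_on ball 0 s0"
    by (rule holomorphic_on_subset[OF \<pi>(1) s0(2)])
  have \<pi>_inj: "inj_on \<pi> (ball 0 s0)"
    by (rule inj_onI) (metis \<pi>1)
  define Q where "Q = \<pi> ` ball 0 s0"
  have Q: "open Q"
    unfolding Q_def by (rule open_mapping_thm3[OF \<pi>_hol open_ball \<pi>_inj])
  have pQ: "p \<in> Q"
    using s0(1) \<pi>0 unfolding Q_def by (intro image_eqI[of _ _ 0]) auto
  have w01: "cmod w0 < 1"
    using B_less_1[OF p(1)] p(2) by simp
  obtain \<tau> \<rho> where \<rho>: "\<rho> > 0"
    and \<tau>: "\<And>x. x \<in> fibre w0 \<Longrightarrow> deriv B x \<noteq> 0 \<Longrightarrow> \<tau> x holomorphic_on ball w0 \<rho> \<and> \<tau> x w0 = x \<and>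
       (\<forall>w\<in>ball w0 \<rho>. \<tau> x w \<in> \<bbbD> \<and> B (\<tau> x w) = w)"
    and cover: "\<And>z. z \<in> \<bbbD> \<Longrightarrow> B z \<in> ball w0 \<rho> \<Longrightarrow>
       z \<in> Q \<or> (\<exists>x\<in>fibre w0. deriv B x \<noteq> 0 \<and> z = \<tau> x (B z))"
    by (rule local_sections[OF w01 Q]) (use p(5) pQ in auto)
  define s where "s = min s0 (sqrt \<rho>)"
  have s: "s > 0" "s \<le> s0"
    using s0 \<rho> by (auto simp: s_def)
  have "s\<^sup>2 \<le> (sqrt \<rho>)\<^sup>2"
    using s by (intro power_mono) (auto simp: s_def)
  then have sub: "ball w0 (s\<^sup>2) \<subseteq> ball w0 \<rho>"
    using \<rho> by (intro subset_ball) simp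
  have sub0: "ball 0 s \<subseteq> ball (0 :: complex) s0"
    using s by (intro subset_ball)
  have \<pi>s: "\<pi> u \<in> \<bbbD> \<and> B (\<pi> u) = w0 + u\<^sup>2" if "u \<in> ball 0 s" for u
    using \<pi>2 sub0 that by blast
  have \<tau>s: "\<tau> x holomorphic_on ball w0 (s\<^sup>2)" "\<tau> x w0 = x"
      "w \<in> ball w0 (s\<^sup>2) \<Longrightarrow> \<tau> x w \<in> \<bbbD> \<and> B (\<tau> x w) = w" if "x \<in> noncritical_fibre w0" for x w
    using \<tau>[of x] that sub holomorphic_on_subset[of "\<tau> x"] unfolding noncritical_fibre_def by blast+
  have \<pi>_nc: "deriv B (\<pi> u) \<noteq> 0" if u: "u \<in> ball 0 s" "u \<noteq> 0" for u
  proof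
    assume 0: "deriv B (\<pi> u) = 0"
    have "(\<pi> has_field_derivative deriv \<pi> u) (at u)"
      by (rule holomorphic_derivI[OF \<pi>_hol open_ball]) (use u sub0 in blast)
    moreover have "(B has_field_derivative deriv B (\<pi> u)) (at (\<pi> u))"
      by (rule holomorphic_derivI[OF B_holomorphic open_ball]) (use \<pi>s[OF u(1)] in blast)
    ultimately have "((\<lambda>u. B (\<pi> u)) has_field_derivative deriv B (\<pi> u) * deriv \<pi> u) (at u)"
      using DERIV_chain2 by blast
    moreover have "((\<lambda>u. w0 + u\<^sup>2) has_field_derivative 2 * u) (at u)"
      by (auto intro!: derivative_eq_intros)
    then have "((\<lambda>u. B (\<pi> u)) has_field_derivative 2 * u) (at u)"
      by (rule has_field_derivative_transform_within_open[OF _ open_ball u(1)]) (use \<pi>s in simp)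
    ultimately have "deriv B (\<pi> u) * deriv \<pi> u = 2 * u"
      by (rule DERIV_unique)
    with 0 u(2) show False
      by simp
  qed
  have cover': "(\<exists>u\<in>ball 0 s. z = \<pi> u) \<or> (\<exists>x\<in>noncritical_fibre w0. z = \<tau> x (B z))"
    if z: "z \<in> \<bbbD>" "B z \<in> ball w0 (s\<^sup>2)" for z
  proof -
    consider "z \<in> Q" | "\<exists>x\<in>fibre w0. deriv B x \<noteq> 0 \<and> z = \<tau> x (B z)"
      using cover[OF z(1)] z(2) sub by blast
    then show ?thesis
    proof cases
      case 1
      then obtain u where u: "u \<in> ball 0 s0" "z = \<pi> u"
        by (auto simp: Q_def)
      then have "(cmod u)\<^sup>2 < s\<^sup>2"
        using \<pi>2[OF u(1)] z(2) by (simp add: dist_norm norm_power)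
      then have "u \<in> ball 0 s"
        using s(1) by (simp add: power_less_imp_less_base)
      with u(2) show ?thesis
        by blast
    qed (auto simp: noncritical_fibre_def)
  qed
  \<comment> \<open>A meeting point with \<open>u \<noteq> 0\<close> is noncritical, so the two
    lifts would agree back to \<open>u = 0\<close>, and the critical point would equal a noncritical
    point of the fibre.\<close>
  have disj: "\<pi> u \<noteq> \<tau> x (w0 + u\<^sup>2)" if u: "u \<in> ball 0 s" and x: "x \<in> noncritical_fibre w0" for u x
  proof
    assume eq: "\<pi> u = \<tau> x (w0 + u\<^sup>2)"
    have "\<pi> 0 = \<tau> x (w0 + 0\<^sup>2)"
    proof (cases "u = 0")
      case False
      show ?thesis
      proof (rule lifts_agree[of "ball 0 s" \<pi> "\<lambda>u. \<tau> x (w0 + u\<^sup>2)" u 0])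
        show "\<pi> holomorphic_on ball 0 s"
          by (rule holomorphic_on_subset[OF \<pi>_hol sub0])
        show "(\<lambda>u. \<tau> x (w0 + u\<^sup>2)) holomorphic_on ball 0 s"
          by (rule holomorphic_on_compose_gen[OF _ \<tau>s(1)[OF x], unfolded comp_def])
            (auto intro!: holomorphic_intros square_in_ball simp del: mem_ball)
        show "\<pi> v \<in> \<bbbD> \<and> \<tau> x (w0 + v\<^sup>2) \<in> \<bbbD> \<and> B (\<pi> v) = B (\<tau> x (w0 + v\<^sup>2))" if "v \<in> ball 0 s" for v
          using \<pi>s[OF that] \<tau>s(3)[OF x square_in_ball[OF that]] by simp
        show "deriv B (\<pi> u) \<noteq> 0"
          by (rule \<pi>_nc[OF u False])
      qed (use u eq s in auto)
    qed (use eq in simp)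
    then have "p = x"
      using \<pi>0 \<tau>s(2)[OF x] by simp
    then show False
      using x p(3) by (simp add: noncritical_fibre_def)
  qed
  have reg: "w \<in> regular_values" if w: "w \<in> ball w0 (s\<^sup>2)" "w \<noteq> w0" for w
  proof -
    have "deriv B z \<noteq> 0" if z: "z \<in> \<bbbD>" "B z = w" for z
    proof -
      from cover'[of z] z w
      consider u where "u \<in> ball 0 s" "z = \<pi> u" | x where "x \<in> noncritical_fibre w0" "z = \<tau> x w"
        by auto
      then show ?thesis
      proof cases
        case 1
        then have "u \<noteq> 0"
          using \<pi>s[of u] z(2) w(2) by auto
        then show ?thesis
          using \<pi>_nc 1 by blast
      next
        case 2
        then show ?thesis
          using section_noncritical[OF open_ball \<tau>s(1)[OF 2(1)] \<tau>s(3)[OF 2(1)] w(1)] by simp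
      qed
    qed
    moreover have "cmod w < 1"
    proof -
      have "(cmod (csqrt (w - w0)))\<^sup>2 = cmod (w - w0)"
        by (metis norm_power power2_csqrt)
      then have "(cmod (csqrt (w - w0)))\<^sup>2 < s\<^sup>2"
        using w(1) by (simp add: dist_norm norm_minus_commute)
      then have "csqrt (w - w0) \<in> ball 0 s"
        using s(1) power_less_imp_less_base[of "cmod (csqrt (w - w0))" 2 s] by simp
      then show ?thesis
        using \<pi>s[of "csqrt (w - w0)"] B_less_1[of "\<pi> (csqrt (w - w0))"] by simp
    qed
    ultimately show ?thesis
      by (auto simp: regular_values_def critical_values_def critical_points_def)
  qed
  have "branched_cover w0 s \<pi> \<tau>"
    unfolding branched_cover_def
    using s(1) holomorphic_on_subset[OF \<pi>_hol sub0] inj_on_subset[OF \<pi>_inj sub0] \<pi>s \<tau>s(1,3) cover' disj reg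
    by blast
  then show ?thesis
    by (rule that)
qed

lemma branched_fibre:
  assumes bc: "branched_cover w0 s \<pi> \<tau>" and u: "u \<in> ball 0 s"
  shows "fibre (w0 + u\<^sup>2) = {\<pi> u, \<pi> (- u)} \<union> (\<lambda>x. \<tau> x (w0 + u\<^sup>2)) ` noncritical_fibre w0"
proof -
  have u': "- u \<in> ball 0 s" and w: "w0 + u\<^sup>2 \<in> ball w0 (s\<^sup>2)"
    using u square_in_ball by auto
  have 1: "\<pi> u \<in> fibre (w0 + u\<^sup>2)" "\<pi> (- u) \<in> fibre (w0 + u\<^sup>2)"
    using bc u u' unfolding branched_cover_def fibre_def by auto
  have 2: "\<tau> x (w0 + u\<^sup>2) \<in> fibre (w0 + u\<^sup>2)" if "x \<in> noncritical_fibre w0" for x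
    using bc w that unfolding branched_cover_def fibre_def by blast
  have 3: "z \<in> {\<pi> u, \<pi> (- u)} \<union> (\<lambda>x. \<tau> x (w0 + u\<^sup>2)) ` noncritical_fibre w0" if z: "z \<in> fibre (w0 + u\<^sup>2)" for z
  proof -
    have zB: "z \<in> \<bbbD>" "B z = w0 + u\<^sup>2"
      using z by (auto simp: fibre_def)
    have "(\<exists>v\<in>ball 0 s. z = \<pi> v) \<or> (\<exists>x\<in>noncritical_fibre w0. z = \<tau> x (B z))"
      using bc zB w unfolding branched_cover_def by metis
    then consider v where "v \<in> ball 0 s" "z = \<pi> v" | x where "x \<in> noncritical_fibre w0" "z = \<tau> x (B z)"
      by blast
    then show ?thesis
    proof cases
      case 1
      then have "w0 + v\<^sup>2 = w0 + u\<^sup>2"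
        using bc zB(2) unfolding branched_cover_def by metis
      then have "v = u \<or> v = - u"
        by (simp add: power2_eq_iff)
      then show ?thesis
        using 1 by blast
    next
      case 2
      then show ?thesis
        using zB(2) by auto
    qed
  qed
  from 1 2 3 show ?thesis
    by blast
qed

text \<open>The punctured \<open>u\<close>-disk is connected, and \<open>u\<close> and
  \<open>- u\<close> lie over the same value. Passing from one to the other swaps the two points of
  the double sheet and returns every function of \<open>u\<^sup>2\<close> to its value, so no
  explicit loop is needed.\<close>

lemma eqv_branch:
  assumes bc: "branched_cover w0 s \<pi> \<tau>" and u: "u \<in> ball 0 s" "u \<noteq> 0"
  shows "eqv (\<pi> u) (\<pi> (- u))"
proof -
  let ?A = "ball 0 s - {0 :: complex}"
  have A: "connected ?A"
    by (intro connected_punctured_ball) simp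
  have \<pi>_cont: "continuous_on ?A \<pi>"
    using bc unfolding branched_cover_def
    by (meson Diff_subset continuous_on_subset holomorphic_on_imp_continuous_on)
  have \<pi>_cont': "continuous_on ?A (\<lambda>u. \<pi> (- u))"
    by (rule continuous_on_compose2[OF \<pi>_cont]) (auto intro!: continuous_intros)
  have \<tau>_cont: "continuous_on ?A (\<lambda>u. \<tau> x (w0 + u\<^sup>2))" if "x \<in> noncritical_fibre w0" for x
  proof (rule continuous_on_compose2[of "ball w0 (s\<^sup>2)" "\<tau> x"])
    show "continuous_on (ball w0 (s\<^sup>2)) (\<tau> x)"
      using bc that unfolding branched_cover_def by (meson holomorphic_on_imp_continuous_on)
    show "(\<lambda>u. w0 + u\<^sup>2) ` ?A \<subseteq> ball w0 (s\<^sup>2)"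
      using square_in_ball by blast
  qed (intro continuous_intros)
  have B\<pi>: "\<pi> v \<in> \<bbbD> \<and> B (\<pi> v) = w0 + v\<^sup>2" if "v \<in> ball 0 s" for v
    using bc that unfolding branched_cover_def by blast
  have B\<tau>: "\<tau> x (w0 + v\<^sup>2) \<in> \<bbbD> \<and> B (\<tau> x (w0 + v\<^sup>2)) = w0 + v\<^sup>2"
    if "x \<in> noncritical_fibre w0" "v \<in> ball 0 s" for x v
    using bc that square_in_ball[OF that(2), of w0] unfolding branched_cover_def by blast
  have reg: "w0 + v\<^sup>2 \<in> regular_values" if "v \<in> ?A" for v
    using bc square_in_ball[of v s w0] that unfolding branched_cover_def by auto
  have uA: "u \<in> ?A" "- u \<in> ?A"
    using u by auto
  let ?w = "w0 + u\<^sup>2"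
  have c1: "c (\<pi> (- u)) (\<pi> (- u)) = c (\<pi> u) (\<pi> u)"
    by (rule c_constant[OF A \<pi>_cont \<pi>_cont _ uA(2,1)]) (use B\<pi> reg in \<open>auto simp: regular_points_def\<close>)
  \<comment> \<open>Here both arguments move: the pair of \<open>\<pi> v\<close> and
    \<open>\<pi> (- v)\<close> is compared at \<open>v = - u\<close> and
    \<open>v = u\<close>.\<close>
  have c2: "c (\<pi> (- u)) (\<pi> u) = c (\<pi> u) (\<pi> (- u))"
    using c_constant[OF A \<pi>_cont \<pi>_cont' _ uA(2,1)] B\<pi> reg by (auto simp: regular_points_def)
  have c3: "c (\<pi> (- u)) (\<tau> x ?w) = c (\<pi> u) (\<tau> x ?w)" if "x \<in> noncritical_fibre w0" for x
    using c_constant[OF A \<pi>_cont \<tau>_cont[OF that] _ uA(2,1)] B\<pi> B\<tau>[OF that] reg by (auto simp: regular_points_def)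
  have c4: "c (\<tau> x ?w) (\<pi> (- u)) = c (\<tau> x ?w) (\<pi> u)" if "x \<in> noncritical_fibre w0" for x
    using c_constant[OF A \<tau>_cont[OF that] \<pi>_cont _ uA(2,1)] B\<pi> B\<tau>[OF that] reg by (auto simp: regular_points_def)
  have d1: "\<pi> u \<noteq> \<tau> x ?w" if "x \<in> noncritical_fibre w0" for x
    using bc u that unfolding branched_cover_def by blast
  have d2: "\<pi> (- u) \<noteq> \<tau> x ?w" if "x \<in> noncritical_fibre w0" for x
    using bc uA that unfolding branched_cover_def by (metis DiffD1 power2_minus)
  have fib: "x = \<pi> u \<or> x = \<pi> (- u) \<or> (\<exists>y\<in>noncritical_fibre w0. x = \<tau> y ?w)" if "x \<in> fibre ?w" for x
    using that unfolding branched_fibre[OF bc u(1)] by blast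
  have ex: "exchange (\<pi> u) (\<pi> (- u)) (\<tau> x ?w) = \<tau> x ?w" if "x \<in> noncritical_fibre w0" for x
    using d1[OF that] d2[OF that] by (simp add: Transposition.transpose_def)
  have "c (exchange (\<pi> u) (\<pi> (- u)) x) (exchange (\<pi> u) (\<pi> (- u)) y) = c x y"
    if "x \<in> fibre ?w" "y \<in> fibre ?w" for x y
    using fib[OF that(1)] fib[OF that(2)]
    by (elim disjE bexE) (simp_all add: c1 c2 c3 c4 ex)
  moreover have "B (\<pi> u) = ?w" "\<pi> u \<in> regular_points" "\<pi> (- u) \<in> fibre ?w"
    using B\<pi>[OF u(1)] B\<pi>[of "- u"] reg[OF uA(1)] u by (auto simp: regular_points_def fibre_def)
  ultimately show ?thesis
    by (simp add: eqv_def)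
qed

end

text \<open>If the classes were finite, a symmetric function of the class would be holomorphic and locally
  a function of \<open>B\<close> except over \<open>W0\<close>.\<close>

locale finite_classes = invariant_kernel B c W0 for B c W0 +
  fixes q :: "complex \<Rightarrow> complex"
  assumes finite_cls: "z \<in> regular_points \<Longrightarrow> finite (cls z)"
    and q_hol: "q holomorphic_on \<bbbD>" and q_le_1: "z \<in> \<bbbD> \<Longrightarrow> cmod (q z) \<le> 1"
begin

text \<open>The product is chosen among the symmetric functions because, for finite classes, it
  vanishes exactly when \<open>q\<close> vanishes somewhere on the class, and because it inherits
  the bound 1 from \<open>q\<close>.\<close>

definition h :: "complex \<Rightarrow> complex" where
  "h z = (\<Prod>\<zeta>\<in>cls z. q \<zeta>)"

lemma h_eqv: "eqv z \<zeta> \<Longrightarrow> h z = h \<zeta>"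
  unfolding h_def using cls_eq by metis

lemma h_bound: "z \<in> regular_points \<Longrightarrow> cmod (h z) \<le> 1"
  unfolding h_def prod_norm[symmetric] by (intro prod_le_1) (use q_le_1 eqv_imp in \<open>auto simp: cls_def\<close>)

text \<open>Along a sheet the class is carried by a fixed set of indices, so \<open>h\<close> is
  there a fixed product of holomorphic functions.\<close>

lemma h_cover:
  assumes lc: "local_cover \<tau> w0 \<rho>"
  shows "(\<lambda>w. h (\<tau> i w)) holomorphic_on ball w0 \<rho>"
proof (rule holomorphic_transform)
  show "(\<lambda>w. \<Prod>j\<in>{j. index_eqv \<tau> w0 i j}. q (\<tau> j w)) holomorphic_on ball w0 \<rho>"
    by (intro holomorphic_on_prod holomorphic_on_compose_gen[OF cover_hol[OF lc] q_hol, unfolded comp_def])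
      (use cover_lift[OF lc] in blast)
  fix w assume w: "w \<in> ball w0 \<rho>"
  have "inj_on (\<lambda>j. \<tau> j w) {j. index_eqv \<tau> w0 i j}"
    using cover_eq_iff[OF lc w] by (auto simp: inj_on_def)
  then show "(\<Prod>j\<in>{j. index_eqv \<tau> w0 i j}. q (\<tau> j w)) = h (\<tau> i w)"
    unfolding h_def cls_cover[OF lc w] by (simp add: prod.reindex)
qed

lemma h_holomorphic: "h holomorphic_on regular_points"
proof (rule holomorphic_on_locally)
  fix z assume z: "z \<in> regular_points"
  then obtain \<tau> \<rho> where lc: "local_cover \<tau> (B z) \<rho>"
    using local_cover_exists by (auto simp: regular_points_def)
  have w: "B z \<in> ball (B z) \<rho>"
    using cover_pos[OF lc] by simp
  have "\<exists>n. z = \<tau> n (B z)"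
    by (rule cover_point[OF lc _ w]) (use z in \<open>simp add: regular_points_def\<close>)
  then obtain i where i: "z = \<tau> i (B z)"
    by blast
  let ?N = "\<tau> i ` ball (B z) \<rho>"
  have "open ?N"
    by (rule open_section_image[OF open_ball cover_hol[OF lc]]) (use cover_lift[OF lc] in blast)
  moreover have "z \<in> ?N"
    using i w by blast
  moreover have "?N \<subseteq> \<bbbD>"
    using cover_lift[OF lc] by blast
  then have "(\<lambda>z. h (\<tau> i (B z))) holomorphic_on ?N"
    using cover_lift[OF lc]
    by (intro holomorphic_on_compose_gen[OF _ h_cover[OF lc], unfolded comp_def, of B]
        holomorphic_on_subset[OF B_holomorphic]) auto
  moreover have "\<forall>y\<in>?N. h y = h (\<tau> i (B y))"
    using cover_lift[OF lc] by auto
  ultimately show "\<exists>N f. open N \<and> z \<in> N \<and> f holomorphic_on N \<and> (\<forall>y\<in>N. h y = f y)"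
    by blast
qed

lemma section_near:
  assumes z: "z \<in> regular_points" and T: "open T" "z \<in> T"
  obtains \<tau> d where "d > 0" "\<tau> holomorphic_on ball (B z) d" "\<tau> (B z) = z"
    "\<And>w. w \<in> ball (B z) d \<Longrightarrow> \<tau> w \<in> T \<and> \<tau> w \<in> \<bbbD> \<and> B (\<tau> w) = w"
proof -
  have "z \<in> \<bbbD>"
    using z by (simp add: regular_points_def)
  then obtain \<tau> d where \<tau>: "d > 0" "\<tau> holomorphic_on ball (B z) d" "\<tau> (B z) = z"
      "\<And>w. w \<in> ball (B z) d \<Longrightarrow> \<tau> w \<in> \<bbbD> \<and> B (\<tau> w) = w"
    using local_section[OF _ regular_points_noncritical[OF z]] by metis
  have "open (ball (B z) d \<inter> \<tau> -` T)"
    by (rule continuous_open_preimage[OF holomorphic_on_imp_continuous_on[OF \<tau>(2)] open_ball T(1)])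
  moreover have "B z \<in> ball (B z) d \<inter> \<tau> -` T"
    using \<tau> T by simp
  ultimately obtain e where e: "e > 0" "ball (B z) e \<subseteq> ball (B z) d \<inter> \<tau> -` T"
    by (rule openE)
  show ?thesis
  proof (rule that[of e \<tau>])
    show "\<tau> holomorphic_on ball (B z) e"
      using holomorphic_on_subset[OF \<tau>(2)] e(2) by blast
    show "\<tau> w \<in> T \<and> \<tau> w \<in> \<bbbD> \<and> B (\<tau> w) = w" if "w \<in> ball (B z) e" for w
      using \<tau>(4) e(2) that by blast
  qed (use e \<tau> in auto)
qed

text \<open>\<open>h\<close> descends to the punctured disk and is holomorphic there through local
  sections of \<open>B\<close>. Being bounded by 1, it extends over \<open>w0\<close> by Riemann's
  theorem on removable singularities.\<close>

lemma piece_extension: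
  assumes \<rho>: "\<rho> > 0"
    and O: "open O'" "O' \<subseteq> regular_points" and BO: "B ` O' = ball w0 \<rho> - {w0}"
    and inv: "\<And>z z'. z \<in> O' \<Longrightarrow> z' \<in> O' \<Longrightarrow> B z = B z' \<Longrightarrow> h z = h z'"
  obtains G where "G holomorphic_on ball w0 \<rho>" "\<And>z. z \<in> O' \<Longrightarrow> G (B z) = h z"
proof -
  define G0 where "G0 = (\<lambda>w. h (SOME z. z \<in> O' \<and> B z = w))"
  have G0: "G0 (B z) = h z" if "z \<in> O'" for z
  proof -
    have "(SOME y. y \<in> O' \<and> B y = B z) \<in> O' \<and> B (SOME y. y \<in> O' \<and> B y = B z) = B z"
      by (rule someI[of _ z]) (use that in simp)
    then show ?thesis
      unfolding G0_def using inv that by metis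
  qed
  have hol: "G0 holomorphic_on ball w0 \<rho> - {w0}"
  proof (rule holomorphic_on_locally)
    fix w assume "w \<in> ball w0 \<rho> - {w0}"
    then obtain z where z: "z \<in> O'" "w = B z"
      using BO by blast
    then have "z \<in> regular_points"
      using O(2) by blast
    then obtain \<tau> d where \<tau>: "d > 0" "\<tau> holomorphic_on ball (B z) d" "\<tau> (B z) = z"
        "\<And>v. v \<in> ball (B z) d \<Longrightarrow> \<tau> v \<in> O' \<and> \<tau> v \<in> \<bbbD> \<and> B (\<tau> v) = v"
      using section_near[OF _ O(1) z(1)] by metis
    have "(\<lambda>v. h (\<tau> v)) holomorphic_on ball (B z) d"
      by (rule holomorphic_on_compose_gen[OF \<tau>(2) h_holomorphic, unfolded comp_def]) (use \<tau>(4) O(2) in blast)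
    moreover have "\<forall>v\<in>ball (B z) d. G0 v = h (\<tau> v)"
      using \<tau>(4) G0 by metis
    ultimately show "\<exists>N f. open N \<and> w \<in> N \<and> f holomorphic_on N \<and> (\<forall>y\<in>N. G0 y = f y)"
      using \<tau>(1) z(2) by (intro exI[of _ "ball (B z) d"] exI[of _ "\<lambda>v. h (\<tau> v)"]) auto
  qed
  have bound: "cmod (G0 w) \<le> 1" if w: "w \<in> ball w0 \<rho> - {w0}" for w
  proof -
    obtain z where "z \<in> O'" "w = B z"
      using w BO by blast
    then show ?thesis
      using G0 h_bound O(2) by auto
  qed
  have "\<forall>\<^sub>F w in at w0. w \<in> ball w0 \<rho> - {w0}"
    using \<rho> by (simp add: eventually_at dist_commute) blast
  then have "\<forall>\<^sub>F w in at w0. cmod (G0 w) \<le> 1"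
    by eventually_elim (rule bound)
  then obtain G where "G holomorphic_on ball w0 \<rho>" "\<forall>z\<in>ball w0 \<rho> - {w0}. G z = G0 z"
    using holomorphic_on_extend_bounded[OF hol] \<rho> by (auto simp: interior_open)
  moreover have "B z \<in> ball w0 \<rho> - {w0}" if "z \<in> O'" for z
    using BO that by blast
  ultimately show ?thesis
    using G0 by (intro that[of G]) metis+
qed

text \<open>At a regular value a single sheet suffices. At a simple critical value the punctured
  double sheet is one piece, on which \<open>h\<close> depends only on \<open>B\<close> because its
  two points over a value are equivalent. Each piece lies over all regular values of the disk, so
  the relation between \<open>G\<close> and \<open>h\<close> reaches every one of them.\<close>

lemma local_extension:
  assumes w0: "cmod w0 < 1" "w0 \<notin> W0"
  shows "\<exists>\<rho>>0. \<forall>z\<in>regular_points. B z \<in> ball w0 \<rho> \<longrightarrow> (\<exists>O' G. open O' \<and> z \<in> O' \<and> O' \<subseteq> regular_points \<and>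
      G holomorphic_on ball w0 \<rho> \<and> (\<forall>y\<in>O'. G (B y) = h y) \<and> ball w0 \<rho> \<inter> regular_values \<subseteq> B ` O')"
proof (cases "w0 \<in> regular_values")
  case True
  then obtain \<tau> \<rho> where lc: "local_cover \<tau> w0 \<rho>"
    using local_cover_exists by blast
  show ?thesis
  proof (intro exI[of _ \<rho>] conjI ballI impI)
    fix z assume z: "z \<in> regular_points" "B z \<in> ball w0 \<rho>"
    have "\<exists>n. z = \<tau> n (B z)"
      by (rule cover_point[OF lc _ z(2)]) (use z in \<open>simp add: regular_points_def\<close>)
    then obtain i where i: "z = \<tau> i (B z)"
      by blast
    let ?N = "\<tau> i ` ball w0 \<rho>"
    have "open ?N"
      by (rule open_section_image[OF open_ball cover_hol[OF lc]]) (use cover_lift[OF lc] in blast)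
    moreover have "z \<in> ?N"
      using i z(2) by blast
    moreover have "?N \<subseteq> regular_points"
      using cover_regular_point[OF lc] by blast
    moreover have "\<forall>y\<in>?N. h (\<tau> i (B y)) = h y"
      using cover_lift[OF lc] by auto
    moreover have "ball w0 \<rho> \<inter> regular_values \<subseteq> B ` ?N"
    proof
      fix w assume "w \<in> ball w0 \<rho> \<inter> regular_values"
      then have "w = B (\<tau> i w)" "\<tau> i w \<in> ?N"
        using cover_lift[OF lc, of w i] by auto
      then show "w \<in> B ` ?N"
        by blast
    qed
    ultimately show "\<exists>O' G. open O' \<and> z \<in> O' \<and> O' \<subseteq> regular_points \<and>
      G holomorphic_on ball w0 \<rho> \<and> (\<forall>y\<in>O'. G (B y) = h y) \<and> ball w0 \<rho> \<inter> regular_values \<subseteq> B ` O'"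
      using h_cover[OF lc, of i] by (intro exI[of _ ?N] exI[of _ "\<lambda>w. h (\<tau> i w)"]) blast
  qed (rule cover_pos[OF lc])
next
  case False
  then have cv: "w0 \<in> critical_values - W0"
    using w0 by (simp add: regular_values_def)
  then obtain s \<pi> \<tau> where bc: "branched_cover w0 s \<pi> \<tau>"
    using branched_cover_exists by blast
  have s: "s > 0"
    using bc by (simp add: branched_cover_def)
  let ?\<rho> = "s\<^sup>2"
  let ?N = "ball w0 ?\<rho> - {w0}"
  have reg: "?N \<subseteq> regular_values"
    using bc by (simp add: branched_cover_def)
  have w0N: "w0 \<notin> regular_values"
    using cv by (simp add: regular_values_def)
  have \<rho>: "?\<rho> > 0"
    using s by simp
  have "\<exists>O'. open O' \<and> z \<in> O' \<and> O' \<subseteq> regular_points \<and> B ` O' = ?N \<and>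
      (\<forall>y\<in>O'. \<forall>y'\<in>O'. B y = B y' \<longrightarrow> h y = h y')" if z: "z \<in> regular_points" "B z \<in> ball w0 ?\<rho>" for z
  proof -
    have zD: "z \<in> \<bbbD>" "B z \<noteq> w0"
      using z w0N by (auto simp: regular_points_def)
    have "(\<exists>u\<in>ball 0 s. z = \<pi> u) \<or> (\<exists>x\<in>noncritical_fibre w0. z = \<tau> x (B z))"
      using bc zD z(2) unfolding branched_cover_def by blast
    then consider u where "u \<in> ball 0 s" "z = \<pi> u" | x where "x \<in> noncritical_fibre w0" "z = \<tau> x (B z)"
      by blast
    then show ?thesis
    proof cases
      case 1
      let ?U = "ball 0 s - {0 :: complex}"
      have \<pi>: "\<pi> holomorphic_on ?U" "inj_on \<pi> ?U"
        using bc unfolding branched_cover_def by (meson Diff_subset holomorphic_on_subset inj_on_subset)+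
      have B\<pi>: "\<pi> v \<in> \<bbbD> \<and> B (\<pi> v) = w0 + v\<^sup>2" if "v \<in> ball 0 s" for v
        using bc that unfolding branched_cover_def by blast
      have img: "w0 + v\<^sup>2 \<in> ?N" if "v \<in> ?U" for v
        using square_in_ball[of v s w0] that by auto
      have "open (\<pi> ` ?U)"
        by (rule open_mapping_thm3[OF \<pi>(1) _ \<pi>(2)]) (intro open_Diff open_ball closed_singleton)
      moreover have "u \<noteq> 0"
        using 1 zD(2) B\<pi>[of u] by auto
      then have "z \<in> \<pi> ` ?U"
        using 1 by blast
      moreover have "\<pi> v \<in> regular_points" if "v \<in> ?U" for v
        using B\<pi>[of v] subsetD[OF reg img[OF that]] that by (simp add: regular_points_def)
      then have "\<pi> ` ?U \<subseteq> regular_points"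
        by blast
      moreover have "B ` \<pi> ` ?U = ?N"
      proof
        show "B ` \<pi> ` ?U \<subseteq> ?N"
        proof
          fix w assume "w \<in> B ` \<pi> ` ?U"
          then obtain v where v: "v \<in> ?U" "w = B (\<pi> v)"
            by blast
          then have "w = w0 + v\<^sup>2"
            using B\<pi>[of v] by blast
          then show "w \<in> ?N"
            using img[OF v(1)] by argo
        qed
        show "?N \<subseteq> B ` \<pi> ` ?U"
        proof
          fix w assume w: "w \<in> ?N"
          have "(cmod (csqrt (w - w0)))\<^sup>2 = cmod (w - w0)"
            by (metis norm_power power2_csqrt)
          then have "(cmod (csqrt (w - w0)))\<^sup>2 < s\<^sup>2"
            using w by (simp add: dist_norm norm_minus_commute)
          then have v: "csqrt (w - w0) \<in> ?U"
            using s power_less_imp_less_base[of "cmod (csqrt (w - w0))" 2 s] w by simp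
          then have "B (\<pi> (csqrt (w - w0))) = w"
            using B\<pi>[of "csqrt (w - w0)"] by simp
          then show "w \<in> B ` \<pi> ` ?U"
            using v by (metis image_eqI)
        qed
      qed
      moreover have "\<forall>y\<in>\<pi> ` ?U. \<forall>y'\<in>\<pi> ` ?U. B y = B y' \<longrightarrow> h y = h y'"
      proof (intro ballI impI)
        fix y y' assume y: "y \<in> \<pi> ` ?U" "y' \<in> \<pi> ` ?U" "B y = B y'"
        then obtain v v' where v: "v \<in> ?U" "v' \<in> ?U" "y = \<pi> v" "y' = \<pi> v'"
          by blast
        then have "v\<^sup>2 = v'\<^sup>2"
          using B\<pi>[of v] B\<pi>[of v'] y(3) by simp
        then have "v' = v \<or> v' = - v"
          by (auto simp: power2_eq_iff)
        then show "h y = h y'"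
          using h_eqv[OF eqv_branch[OF bc, of v]] v by auto
      qed
      ultimately show ?thesis
        by blast
    next
      case 2
      have \<tau>: "\<tau> x holomorphic_on ?N" "\<And>w. w \<in> ?N \<Longrightarrow> \<tau> x w \<in> \<bbbD> \<and> B (\<tau> x w) = w"
        using bc 2(1) holomorphic_on_subset[of "\<tau> x" "ball w0 ?\<rho>" ?N] unfolding branched_cover_def by auto
      have "open (\<tau> x ` ?N)"
        by (rule open_section_image[OF _ \<tau>(1)]) (use \<tau>(2) in blast)+
      moreover have "z \<in> \<tau> x ` ?N"
        using 2 z zD by blast
      moreover have "\<tau> x w \<in> regular_points" if "w \<in> ?N" for w
        using \<tau>(2)[OF that] subsetD[OF reg that] by (simp add: regular_points_def)
      then have "\<tau> x ` ?N \<subseteq> regular_points"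
        by blast
      moreover have "B ` \<tau> x ` ?N = ?N"
        using \<tau>(2) by (force simp: image_image)
      moreover have "\<forall>y\<in>\<tau> x ` ?N. \<forall>y'\<in>\<tau> x ` ?N. B y = B y' \<longrightarrow> h y = h y'"
        using \<tau>(2) by auto
      ultimately show ?thesis
        by blast
    qed
  qed
  note pieces = this
  show ?thesis
  proof (intro exI[of _ ?\<rho>] conjI ballI impI)
    fix z assume z: "z \<in> regular_points" "B z \<in> ball w0 ?\<rho>"
    obtain O' where O': "open O'" "z \<in> O'" "O' \<subseteq> regular_points" "B ` O' = ?N"
        "\<forall>y\<in>O'. \<forall>y'\<in>O'. B y = B y' \<longrightarrow> h y = h y'"
      using pieces[OF z] by (elim exE conjE)
    have inv: "\<And>y y'. y \<in> O' \<Longrightarrow> y' \<in> O' \<Longrightarrow> B y = B y' \<Longrightarrow> h y = h y'"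
      using O'(5) by blast
    obtain G where G: "G holomorphic_on ball w0 ?\<rho>" "\<And>y. y \<in> O' \<Longrightarrow> G (B y) = h y"
      using piece_extension[OF \<rho> O'(1,3,4) inv] by metis
    have "ball w0 ?\<rho> \<inter> regular_values \<subseteq> B ` O'"
      using O'(4) w0N by blast
    then show "\<exists>O' G. open O' \<and> z \<in> O' \<and> O' \<subseteq> regular_points \<and>
      G holomorphic_on ball w0 ?\<rho> \<and> (\<forall>y\<in>O'. G (B y) = h y) \<and> ball w0 ?\<rho> \<inter> regular_values \<subseteq> B ` O'"
      using O'(1-3) G by blast
  qed (rule \<rho>)
qed

text \<open>The germ condition only asks that \<open>G\<close> composed with \<open>B\<close> be
  \<open>h\<close> near some point of the fibre, which is what survives continuation. Once
  \<open>G\<close> lives on the whole disk, the identity theorem on the connected set of regular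
  points extends the relation to entire fibres.\<close>

lemma global_extension:
  assumes r: "0 < r" "r < 1" and W0: "W0 \<subseteq> ball 0 r"
    and G0: "G0 holomorphic_on ball 0 r"
    and near: "\<And>w. w \<in> ball 0 r \<inter> regular_values \<Longrightarrow>
        \<exists>z\<in>regular_points. B z = w \<and> (\<forall>\<^sub>F y in nhds z. G0 (B y) = h y)"
    and z: "z \<in> regular_points" "z' \<in> regular_points" "B z = B z'"
  shows "h z = h z'"
proof -
  define P where "P = (\<lambda>G w. \<exists>z\<in>regular_points. B z = w \<and> (\<forall>\<^sub>F y in nhds z. G (B y) = h y))"
  have B_lim: "filterlim B (nhds (B z)) (nhds z)" if "z \<in> regular_points" for z
  proof -
    have "isCont B z"
      using that holomorphic_on_imp_continuous_on[OF B_holomorphic]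
      by (auto simp: regular_points_def continuous_on_eq_continuous_at)
    then show ?thesis
      by (simp add: isCont_def tendsto_at_iff_tendsto_nhds)
  qed
  obtain G where G: "G holomorphic_on ball 0 1" "\<And>w. w \<in> ball 0 r \<Longrightarrow> G w = G0 w"
  proof (rule disk_extension[of r P regular_values G0])
    fix G G' w assume P: "P G w" and ev: "\<forall>\<^sub>F v in nhds w. G v = G' v"
    then obtain y where y: "y \<in> regular_points" "B y = w" "\<forall>\<^sub>F x in nhds y. G (B x) = h x"
      by (auto simp: P_def)
    have "\<forall>\<^sub>F x in nhds y. G (B x) = G' (B x)"
      using ev B_lim[OF y(1)] unfolding y(2) by (rule eventually_compose_filterlim)
    with y(3) have "\<forall>\<^sub>F x in nhds y. G' (B x) = h x"
      by eventually_elim simp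
    with y show "P G' w"
      by (auto simp: P_def)
  next
    fix w0 :: complex assume w0: "r \<le> cmod w0" "cmod w0 < 1"
    then have "w0 \<notin> W0"
      using W0 by force
    then obtain \<rho> where \<rho>: "\<rho> > 0" "\<And>z. z \<in> regular_points \<Longrightarrow> B z \<in> ball w0 \<rho> \<Longrightarrow>
        \<exists>O' G. open O' \<and> z \<in> O' \<and> O' \<subseteq> regular_points \<and> G holomorphic_on ball w0 \<rho> \<and>
          (\<forall>y\<in>O'. G (B y) = h y) \<and> ball w0 \<rho> \<inter> regular_values \<subseteq> B ` O'"
      using local_extension[OF w0(2)] by blast
    show "\<exists>\<rho>>0. \<forall>w\<in>ball w0 \<rho> \<inter> regular_values. w \<noteq> w0 \<longrightarrow>
        (\<forall>G. P G w \<longrightarrow> (\<exists>G'. G' holomorphic_on ball w0 \<rho> \<and> (\<forall>\<^sub>F v in nhds w. G' v = G v) \<and>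
            (\<forall>v\<in>ball w0 \<rho> \<inter> regular_values. P G' v)))"
    proof (intro exI[of _ \<rho>] conjI ballI impI allI)
      fix w G assume w: "w \<in> ball w0 \<rho> \<inter> regular_values" and P: "P G w"
      obtain y where y: "y \<in> regular_points" "B y = w" "\<forall>\<^sub>F x in nhds y. G (B x) = h x"
        using P by (auto simp: P_def)
      obtain O' G' where O': "open O'" "y \<in> O'" "O' \<subseteq> regular_points" "G' holomorphic_on ball w0 \<rho>"
          "\<forall>y\<in>O'. G' (B y) = h y" "ball w0 \<rho> \<inter> regular_values \<subseteq> B ` O'"
        using \<rho>(2)[OF y(1)] y(2) w by blast
      obtain T where T: "open T" "y \<in> T" "\<forall>x\<in>T. G (B x) = h x"
        using y(3) unfolding eventually_nhds by blast
      obtain \<tau> d where \<tau>: "d > 0" "\<And>v. v \<in> ball (B y) d \<Longrightarrow> \<tau> v \<in> O' \<inter> T \<and> \<tau> v \<in> \<bbbD> \<and> B (\<tau> v) = v"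
        using section_near[OF y(1), of "O' \<inter> T"] O'(1,2) T(1,2) by (metis IntI open_Int)
      have "\<forall>\<^sub>F v in nhds w. v \<in> ball (B y) d"
        by (rule eventually_nhds_in_open) (use y(2) \<tau>(1) in auto)
      then have "\<forall>\<^sub>F v in nhds w. G' v = G v"
      proof eventually_elim
        case (elim v)
        then have "G' (B (\<tau> v)) = G (B (\<tau> v))"
          using \<tau>(2)[OF elim] O'(5) T(3) by (metis IntE)
        then show ?case
          using \<tau>(2)[OF elim] by simp
      qed
      moreover have "P G' v" if v: "v \<in> ball w0 \<rho> \<inter> regular_values" for v
      proof -
        obtain x where x: "x \<in> O'" "B x = v"
          using O'(6) v by blast
        have "\<forall>\<^sub>F y in nhds x. y \<in> O'"
          by (rule eventually_nhds_in_open[OF O'(1) x(1)])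
        then have "\<forall>\<^sub>F y in nhds x. G' (B y) = h y"
          by eventually_elim (use O'(5) in blast)
        then show ?thesis
          unfolding P_def using x O'(3) by blast
      qed
      ultimately show "\<exists>G'. G' holomorphic_on ball w0 \<rho> \<and> (\<forall>\<^sub>F v in nhds w. G' v = G v) \<and>
            (\<forall>v\<in>ball w0 \<rho> \<inter> regular_values. P G' v)"
        using O'(4) by blast
    qed (rule \<rho>(1))
  next
    show "S \<inter> regular_values \<noteq> {}" if "open S" "S \<noteq> {}" "S \<subseteq> ball 0 1" for S
      using regular_values_dense that by blast
    show "P G0 w" if "w \<in> ball 0 r \<inter> regular_values" for w
      using near[OF that] by (simp add: P_def)
  qed (use r G0 in auto)
  have "ball 0 r \<inter> regular_values \<noteq> {}"
    by (rule regular_values_dense) (use r in auto)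
  then obtain w where w: "w \<in> ball 0 r" "w \<in> regular_values"
    by blast
  obtain y where y: "y \<in> regular_points" "B y = w" "\<forall>\<^sub>F x in nhds y. G0 (B x) = h x"
    using near[of w] w by blast
  have "\<forall>\<^sub>F v in nhds (B y). v \<in> ball 0 r"
    by (rule eventually_nhds_in_open) (use y(2) w in auto)
  then have "\<forall>\<^sub>F x in nhds y. B x \<in> ball 0 r"
    using B_lim[OF y(1)] by (rule eventually_compose_filterlim)
  with y(3) have "\<forall>\<^sub>F x in nhds y. G (B x) = h x"
    by eventually_elim (use G(2) in auto)
  then obtain T where T: "open T" "y \<in> T" "\<forall>x\<in>T. G (B x) = h x"
    unfolding eventually_nhds by blast
  have GB: "(\<lambda>x. G (B x)) holomorphic_on regular_points"
    by (rule holomorphic_on_compose_gen[OF holomorphic_on_subset[OF B_holomorphic] G(1), unfolded comp_def])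
      (auto simp: regular_points_def B_less_1)
  have "G (B x) = h x" if x: "x \<in> regular_points" for x
    by (rule analytic_continuation_open[OF _ open_regular_points _ connected_regular_points _ GB h_holomorphic _ x,
          of "T \<inter> regular_points"])
      (use T y open_regular_points in auto)
  then show ?thesis
    using z by metis
qed

end

section \<open>Infinitude of the classes\<close>

context invariant_kernel
begin

text \<open>Two classes over one value are played off against each other: one lies on sections over
  a disk containing \<open>W0\<close>, which makes \<open>h\<close> a function of \<open>B\<close>;
  on the other \<open>q\<close> vanishes, so \<open>h\<close> separates two points of one
  fibre.\<close>

lemma infinite_cls:
  assumes z0: "z0 \<in> regular_points"
  shows "infinite (cls z0)"
proof
  assume "finite (cls z0)"
  then have fin: "finite (cls z)" if "z \<in> regular_points" for z
    using cls_card_constant(2)[OF z0 that] by simp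
  \<comment> \<open>The inserted 0 covers the case \<open>W0 = {}\<close>. The radius halfway
    between \<open>m\<close> and 1 makes \<open>ball 0 r\<close> contain \<open>W0\<close>.\<close>
  define m where "m = Max (insert 0 (cmod ` W0))"
  define r where "r = (1 + m) / 2"
  have m: "m < 1" "0 \<le> m" "\<And>w. w \<in> W0 \<Longrightarrow> cmod w \<le> m"
    using finite_W0 W0_subset by (auto simp: m_def)
  then have r: "0 < r" "r < 1"
    by (simp_all add: r_def)
  have W0r: "W0 \<subseteq> ball 0 r"
    using m unfolding r_def by fastforce
  obtain \<sigma> :: "nat \<Rightarrow> complex \<Rightarrow> complex" and K where K: "compact K" "K \<subseteq> \<bbbD>"
    and \<sigma>: "\<forall>k. \<sigma> k holomorphic_on ball 0 r" "\<forall>k. \<forall>w\<in>ball 0 r. \<sigma> k w \<in> \<bbbD> \<and> B (\<sigma> k w) = w"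
      "\<forall>k j. \<forall>w\<in>ball 0 r. \<sigma> k w = \<sigma> j w \<longrightarrow> k = j"
      "\<forall>z\<in>\<bbbD>. cmod (B z) < r \<longrightarrow> z \<in> K \<or> (\<exists>k. z = \<sigma> k (B z))"
    using sheets[OF r] by blast
  define A where "A = ball 0 r \<inter> regular_values"
  have A: "connected A" "open A" "A \<subseteq> ball 0 r"
    unfolding A_def using connected_regular_disk[of r] r open_regular_values by auto
  have "A \<noteq> {}"
    unfolding A_def by (rule regular_values_dense) (use r in auto)
  then obtain w where w: "w \<in> A"
    by blast
  have \<sigma>_reg: "\<sigma> k v \<in> regular_points" "\<sigma> k v \<in> \<bbbD>" "B (\<sigma> k v) = v" if "v \<in> A" for k v
    using \<sigma>(2) that by (auto simp: A_def regular_points_def)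
  have \<sigma>_inj: "inj (\<lambda>k. \<sigma> k v)" if "v \<in> A" for v
  proof (rule injI)
    fix k j assume "\<sigma> k v = \<sigma> j v"
    then show "k = j"
      using \<sigma>(3)[rule_format, of v k j] that A(3) by blast
  qed
  \<comment> \<open>A fibre has finitely many points in \<open>K\<close>, and their classes are
    finite by assumption, whereas the sections give infinitely many points. So some section
    \<open>k\<close> avoids these classes, and its class then misses \<open>K\<close>.\<close>
  define Bad where "Bad = {z \<in> K. B z = w}"
  have Bad: "finite Bad" "Bad \<subseteq> regular_points"
    using finite_fibre_compact[OF K] K(2) w by (auto simp: Bad_def regular_points_def A_def)
  have "finite (\<Union>b\<in>Bad. cls b)"
    using Bad fin by blast
  moreover have "infinite (range (\<lambda>k. \<sigma> k w))"
    by (rule range_inj_infinite[OF \<sigma>_inj[OF w]])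
  ultimately have "\<not> range (\<lambda>k. \<sigma> k w) \<subseteq> (\<Union>b\<in>Bad. cls b)"
    using finite_subset by blast
  then obtain k where k: "\<sigma> k w \<notin> (\<Union>b\<in>Bad. cls b)"
    by blast
  define \<Lambda> where "\<Lambda> = {l. eqv (\<sigma> k w) (\<sigma> l w)}"
  have sub: "cls (\<sigma> k w) \<subseteq> (\<lambda>l. \<sigma> l w) ` \<Lambda>"
  proof
    fix \<zeta> assume "\<zeta> \<in> cls (\<sigma> k w)"
    then have \<zeta>: "eqv (\<sigma> k w) \<zeta>"
      by (simp add: cls_def)
    have \<zeta>D: "\<zeta> \<in> \<bbbD>" "B \<zeta> = w"
      using eqv_imp[OF \<zeta>] \<sigma>_reg[OF w, of k] by auto
    have "\<zeta> \<notin> K"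
    proof
      assume "\<zeta> \<in> K"
      then have "\<zeta> \<in> Bad" "\<sigma> k w \<in> cls \<zeta>"
        using \<zeta>D eqv_sym[OF \<zeta>] by (auto simp: Bad_def cls_def)
      with k show False
        by blast
    qed
    moreover have "cmod (B \<zeta>) < r"
      using w A(3) \<zeta>D(2) by auto
    ultimately obtain l where "\<zeta> = \<sigma> l w"
      using \<sigma>(4) \<zeta>D by metis
    then show "\<zeta> \<in> (\<lambda>l. \<sigma> l w) ` \<Lambda>"
      using \<zeta> by (simp add: \<Lambda>_def)
  qed
  have cls_w: "cls (\<sigma> k w) = (\<lambda>l. \<sigma> l w) ` \<Lambda>"
    using sub by (auto simp: \<Lambda>_def cls_def)
  have card_img: "card ((\<lambda>l. \<sigma> l v) ` \<Lambda>) = card \<Lambda>" if "v \<in> A" for v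
    by (rule card_image) (rule inj_on_subset[OF \<sigma>_inj[OF that]], simp)
  \<comment> \<open>Equivalence persists along the connected set \<open>A\<close>, so the sections
    in \<open>\<Lambda>\<close> stay in the class. They exhaust it because the class has the same
    finite size everywhere.\<close>
  have cls_v: "cls (\<sigma> k v) = (\<lambda>l. \<sigma> l v) ` \<Lambda>" if v: "v \<in> A" for v
  proof (rule card_subset_eq[symmetric])
    show "finite (cls (\<sigma> k v))"
      by (rule fin[OF \<sigma>_reg(1)[OF v]])
    have cont: "continuous_on A (\<sigma> l)" for l
      using \<sigma>(1) A(3) holomorphic_on_imp_continuous_on continuous_on_subset by blast
    have "eqv (\<sigma> k v) (\<sigma> l v)" if "l \<in> \<Lambda>" for l
    proof -
      have "eqv (\<sigma> k v) (\<sigma> l v) \<longleftrightarrow> eqv (\<sigma> k w) (\<sigma> l w)"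
        by (rule eqv_constant[OF A(1) cont cont _ v w]) (use \<sigma>_reg in simp)
      then show ?thesis
        using that by (simp add: \<Lambda>_def)
    qed
    then show "(\<lambda>l. \<sigma> l v) ` \<Lambda> \<subseteq> cls (\<sigma> k v)"
      by (auto simp: cls_def)
    show "card ((\<lambda>l. \<sigma> l v) ` \<Lambda>) = card (cls (\<sigma> k v))"
      using cls_card_constant(1)[OF \<sigma>_reg(1)[OF v] \<sigma>_reg(1)[OF w], of k k] card_img[OF v] card_img[OF w]
      by (simp add: cls_w)
  qed
  have w1: "cmod w < 1"
    using w A(3) r by auto
  have "\<not> fibre w \<subseteq> cls (\<sigma> k w)"
    using infinite_fibre[OF w1] finite_subset[OF _ fin[OF \<sigma>_reg(1)[OF w], of k]] by blast
  then obtain x where x: "x \<in> fibre w" "x \<notin> cls (\<sigma> k w)"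
    by blast
  have x_reg: "x \<in> regular_points"
    using x(1) w fibre_regular by (auto simp: A_def)
  \<comment> \<open>A polynomial vanishing exactly on the class of \<open>x\<close>; halving keeps
    each factor at most 1 in modulus on the disk.\<close>
  define q where "q = (\<lambda>\<zeta>. \<Prod>\<eta>\<in>cls x. (\<zeta> - \<eta>) / 2)"
  interpret finite_classes B c W0 q
  proof
    show "finite (cls z)" if "z \<in> regular_points" for z
      by (rule fin[OF that])
    show "q holomorphic_on \<bbbD>"
      unfolding q_def by (intro holomorphic_intros) auto
    show "cmod (q z) \<le> 1" if z: "z \<in> \<bbbD>" for z
      unfolding q_def prod_norm[symmetric]
    proof (rule prod_le_1)
      fix \<eta> assume "\<eta> \<in> cls x"
      then have "cmod \<eta> < 1"
        using eqv_imp by (auto simp: cls_def)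
      moreover have "cmod z < 1"
        using z by simp
      ultimately show "0 \<le> cmod ((z - \<eta>) / 2) \<and> cmod ((z - \<eta>) / 2) \<le> 1"
        using norm_triangle_ineq4[of z \<eta>] by (simp add: norm_divide)
    qed
  qed
  \<comment> \<open>The sections are holomorphic on all of \<open>ball 0 r\<close>, so this
    continues \<open>h\<close> across the values in \<open>W0\<close> without any knowledge of the
    branching there.\<close>
  define G0 where "G0 = (\<lambda>v. \<Prod>l\<in>\<Lambda>. q (\<sigma> l v))"
  have "h (\<sigma> k w) = h x"
  proof (rule global_extension[OF r W0r])
    show "G0 holomorphic_on ball 0 r"
      unfolding G0_def
      by (intro holomorphic_on_prod holomorphic_on_compose_gen[OF _ q_hol, unfolded comp_def])
        (use \<sigma>(1,2) in blast)+
    fix v assume "v \<in> ball 0 r \<inter> regular_values"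
    then have v: "v \<in> A"
      by (simp add: A_def)
    have "open (\<sigma> k ` A)"
      by (rule open_section_image[OF A(2)]) (use \<sigma>(1) A(3) holomorphic_on_subset \<sigma>_reg in blast)+
    then have "\<forall>\<^sub>F y in nhds (\<sigma> k v). y \<in> \<sigma> k ` A"
      by (rule eventually_nhds_in_open) (use v in blast)
    then have "\<forall>\<^sub>F y in nhds (\<sigma> k v). G0 (B y) = h y"
    proof eventually_elim
      case (elim y)
      then obtain u where u: "u \<in> A" "y = \<sigma> k u"
        by blast
      have "inj_on (\<lambda>l. \<sigma> l u) \<Lambda>"
        by (rule inj_on_subset[OF \<sigma>_inj[OF u(1)]]) simp
      then have "h y = G0 u"
        unfolding h_def u(2) cls_v[OF u(1)] G0_def by (simp add: prod.reindex)
      then show ?case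
        using u \<sigma>_reg(3) by simp
    qed
    then show "\<exists>z\<in>regular_points. B z = v \<and> (\<forall>\<^sub>F y in nhds z. G0 (B y) = h y)"
      using \<sigma>_reg[OF v] by blast
  qed (use \<sigma>_reg[OF w] x_reg x(1) in \<open>auto simp: fibre_def\<close>)
  moreover have "h x = 0"
  proof -
    have xx: "x \<in> cls x"
      using eqv_refl[OF x_reg] by (simp add: cls_def)
    then have "q x = 0"
      unfolding q_def using fin[OF x_reg] by (intro prod_zero) auto
    then show ?thesis
      unfolding h_def using fin[OF x_reg] xx by (intro prod_zero) auto
  qed
  moreover have "h (\<sigma> k w) \<noteq> 0"
  proof -
    have "q \<zeta> \<noteq> 0" if \<zeta>: "\<zeta> \<in> cls (\<sigma> k w)" for \<zeta>
    proof
      assume "q \<zeta> = 0"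
      then have "\<zeta> \<in> cls x"
        using fin[OF x_reg] by (auto simp: q_def prod_zero_iff)
      then have "eqv (\<sigma> k w) x"
        using \<zeta> eqv_trans eqv_sym unfolding cls_def by blast
      then show False
        using x(2) by (simp add: cls_def)
    qed
    then show ?thesis
      unfolding h_def using fin[OF \<sigma>_reg(1)[OF w]] by (simp add: prod_zero_iff)
  qed
  ultimately show False
    by simp
qed

text \<open>A nonzero entry would be repeated along the infinite class of \<open>\<tau> i w0\<close> in a square summable
  column.\<close>

lemma off_diagonal_zero:
  assumes cover: "even_cover B \<tau> w0 \<rho>" and w0: "w0 \<in> regular_values"
    and summable: "summable (\<lambda>n. (cmod (c (\<tau> n w0) (\<tau> j w0)))\<^sup>2)" and ij: "i \<noteq> j"
  shows "c (\<tau> i w0) (\<tau> j w0) = 0"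
proof (rule ccontr)
  let ?a = "c (\<tau> i w0) (\<tau> j w0)"
  assume "?a \<noteq> 0"
  have w0b: "w0 \<in> ball w0 \<rho>"
    using even_cover.\<rho>_pos[OF cover] by simp
  note lift = even_cover.\<tau>_in[OF cover w0b] even_cover.B_\<tau>[OF cover w0b]
  have ne: "\<tau> i w0 \<noteq> \<tau> j w0"
    using even_cover.\<tau>_inj[OF cover w0b] ij by blast
  have fib: "\<tau> n w0 \<in> fibre w0" for n
    using lift by (simp add: fibre_def)
  have "\<forall>\<^sub>F n in sequentially. (cmod (c (\<tau> n w0) (\<tau> j w0)))\<^sup>2 < (cmod ?a)\<^sup>2"
    by (rule order_tendstoD(2)[OF summable_LIMSEQ_zero[OF summable]]) (use \<open>?a \<noteq> 0\<close> in simp)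
  then obtain n0 where n0: "\<And>n. n \<ge> n0 \<Longrightarrow> (cmod (c (\<tau> n w0) (\<tau> j w0)))\<^sup>2 < (cmod ?a)\<^sup>2"
    unfolding eventually_sequentially by blast
  \<comment> \<open>\<open>\<tau> j w0\<close> is set aside because exchanging with it would move
    the column as well; for every other member of the class the entry in its row is again
    \<open>?a\<close>.\<close>
  have "cls (\<tau> i w0) \<subseteq> insert (\<tau> j w0) ((\<lambda>n. \<tau> n w0) ` {..<n0})"
  proof
    fix \<zeta> assume "\<zeta> \<in> cls (\<tau> i w0)"
    then have e: "eqv (\<tau> i w0) \<zeta>"
      by (simp add: cls_def)
    have "\<zeta> \<in> \<bbbD>" "B \<zeta> = w0"
      using eqv_imp[OF e] lift by auto
    then obtain n where n: "\<zeta> = \<tau> n w0"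
      using even_cover.\<tau>_cover[OF cover, of \<zeta>] w0b by auto
    show "\<zeta> \<in> insert (\<tau> j w0) ((\<lambda>n. \<tau> n w0) ` {..<n0})"
    proof (cases "\<zeta> = \<tau> j w0")
      case False
      have "c (exchange (\<tau> i w0) \<zeta> (\<tau> i w0)) (exchange (\<tau> i w0) \<zeta> (\<tau> j w0)) = ?a"
      proof -
        have "\<forall>x\<in>fibre w0. \<forall>y\<in>fibre w0. c (exchange (\<tau> i w0) \<zeta> x) (exchange (\<tau> i w0) \<zeta> y) = c x y"
          using e lift(2) by (simp add: eqv_def)
        then show ?thesis
          using fib by blast
      qed
      then have "c (\<tau> n w0) (\<tau> j w0) = ?a"
        using False ne n by (simp add: Transposition.transpose_def)
      then have "n < n0"
        using n0[of n] by (cases "n < n0") auto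
      with n show ?thesis
        by blast
    qed simp
  qed
  then have "finite (cls (\<tau> i w0))"
    by (rule finite_subset) simp
  moreover have "\<tau> i w0 \<in> regular_points"
    using lift w0 by (simp add: regular_points_def)
  ultimately show False
    using infinite_cls by blast
qed

end

section \<open>Irreducibility\<close>

text \<open>A zero of order 1 means that \<open>deriv B\<close> factors locally as
  \<open>g w * (w - p)\<close> with \<open>g p \<noteq> 0\<close>, and the derivative of this
  product at \<open>p\<close> is \<open>g p\<close>.\<close>

lemma second_derivative_nonzero:
  assumes B: "B holomorphic_on \<bbbD>" "\<not> deriv B constant_on \<bbbD>" and p: "p \<in> \<bbbD>" "deriv B p = 0"
    and z: "zorder (deriv B) p = 1"
  shows "deriv (deriv B) p \<noteq> 0"
proof -
  have hol: "deriv B holomorphic_on \<bbbD>"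
    by (rule holomorphic_deriv[OF B(1) open_ball])
  have "\<exists>w\<in>\<bbbD>. deriv B w \<noteq> 0"
    using B(2) unfolding constant_on_def by auto
  from zorder_exist_zero[OF hol open_ball connected_ball p(1) this]
  obtain r where r: "r > 0" "zor_poly (deriv B) p holomorphic_on cball p r"
      "\<forall>w\<in>cball p r. deriv B w = zor_poly (deriv B) p w * (w - p) ^ nat 1 \<and> zor_poly (deriv B) p w \<noteq> 0"
    unfolding z by auto
  define g where "g = zor_poly (deriv B) p"
  have "g holomorphic_on ball p r"
    using r(2) holomorphic_on_subset ball_subset_cball unfolding g_def by blast
  then have "(g has_field_derivative deriv g p) (at p)"
    by (rule holomorphic_derivI[OF _ open_ball]) (use r(1) in simp)
  then have "((\<lambda>w. g w * (w - p)) has_field_derivative g p) (at p)"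
    by (auto intro!: derivative_eq_intros)
  then have "(deriv B has_field_derivative g p) (at p)"
    by (rule has_field_derivative_transform_within_open[of _ _ _ "ball p r"]) (use r in \<open>auto simp: g_def\<close>)
  then show ?thesis
    using r(1,3) by (auto simp: DERIV_imp_deriv g_def)
qed

text \<open>The exceptional values are the image of \<open>F\<close> under \<open>B\<close>. A
  critical value outside it has all its critical points outside \<open>F\<close>, hence exactly one
  by injectivity, and that one is simple.\<close>

lemma commutant_scalar:
  assumes thin: "thin_blaschke_product B" and F: "finite F" "F \<subseteq> critical_points B"
    and inj: "inj_on B (critical_points B - F)"
    and simple: "\<forall>z \<in> critical_points B - F. zorder (deriv B) z = 1"
    and T: "T \<in> \<V>\<^sup>* B"
  shows "\<exists>\<alpha>. T = (\<lambda>f. \<alpha> *\<^sub>C f)"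
proof -
  interpret sheeted B
    by (rule thin_blaschke_product_sheeted[OF thin])
  interpret com: commutant B T
    by unfold_locales (use B_holomorphic B_less_1 T in auto)
  have cc: "commutant_cover B T \<tau> w0 \<rho>" if "even_cover B \<tau> w0 \<rho>" for \<tau> w0 \<rho>
    by (rule commutant_cover.intro[OF com.commutant_axioms that])
  interpret ker: invariant_kernel B com.kern "B ` F"
  proof
    fix w0 assume "w0 \<in> regular_values"
    then obtain \<tau> \<rho> where ec: "even_cover B \<tau> w0 \<rho>"
      by (rule even_cover_exists)
    have "\<rho> > 0"
      by (rule even_cover.\<rho>_pos[OF ec])
    \<comment> \<open>Constancy of the entries was obtained only on a quarter of the covering
      disk.\<close>
    then have "even_cover B \<tau> w0 (\<rho> / 4)"
      by (intro even_cover.even_cover_shrink[OF ec]) auto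
    moreover have "\<forall>w\<in>ball w0 (\<rho> / 4). \<forall>i j. com.kern (\<tau> i w) (\<tau> j w) = com.kern (\<tau> i w0) (\<tau> j w0)"
      using commutant_cover.kern_constant[OF cc[OF ec]] by blast
    ultimately show "\<exists>\<tau> \<rho>. even_cover B \<tau> w0 \<rho> \<and>
        (\<forall>w\<in>ball w0 \<rho>. \<forall>i j. com.kern (\<tau> i w) (\<tau> j w) = com.kern (\<tau> i w0) (\<tau> j w0))"
      by blast
  next
    show "finite (B ` F)"
      using F by simp
    show "B ` F \<subseteq> ball 0 1"
      using F B_less_1 by (auto simp: critical_points_def)
  next
    fix w0 assume w0: "w0 \<in> critical_values - B ` F"
    then obtain p where p: "p \<in> critical_points B - F" "B p = w0"
      by (auto simp: critical_values_def)
    then have pD: "p \<in> \<bbbD>" "deriv B p = 0"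
      by (auto simp: critical_points_def)
    have "q = p" if q: "q \<in> fibre w0" "deriv B q = 0" for q
    proof -
      have "q \<in> critical_points B - F"
        using q w0 by (auto simp: fibre_def critical_points_def)
      then show ?thesis
        using inj_onD[OF inj, of q p] p q(1) by (simp add: fibre_def)
    qed
    moreover have "deriv (deriv B) p \<noteq> 0"
      by (rule second_derivative_nonzero[OF B_holomorphic deriv_B_not_constant pD]) (use simple p in blast)
    ultimately show "\<exists>p\<in>\<bbbD>. B p = w0 \<and> deriv B p = 0 \<and> deriv (deriv B) p \<noteq> 0 \<and>
        (\<forall>q\<in>fibre w0. deriv B q = 0 \<longrightarrow> q = p)"
      using pD p(2) by blast
  qed
  have diag: "Rep_bergman (T f) z = com.kern z z * Rep_bergman f z" if z: "z \<in> regular_points" for f z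
  proof -
    have w0: "B z \<in> regular_values" and zD: "z \<in> \<bbbD>"
      using z by (auto simp: regular_points_def)
    obtain \<tau> \<rho> where ec: "even_cover B \<tau> (B z) \<rho>"
      using even_cover_exists[OF w0] by blast
    have "B z \<in> ball (B z) \<rho>"
      using even_cover.\<rho>_pos[OF ec] by simp
    then obtain i where i: "z = \<tau> i (B z)"
      using even_cover.\<tau>_cover[OF ec zD] by blast
    have "com.kern (\<tau> i (B z)) (\<tau> n (B z)) = 0" if "n \<noteq> i" for n
      by (rule ker.off_diagonal_zero[OF ec w0 commutant_cover.kern_column_summable[OF cc[OF ec]]])
        (use that in blast)
    then have "Rep_bergman (T f) (\<tau> i (B z)) =
        com.kern (\<tau> i (B z)) (\<tau> i (B z)) * Rep_bergman f (\<tau> i (B z))"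
      by (rule commutant_cover.diagonal_kern[OF cc[OF ec]])
    with i show ?thesis
      by simp
  qed
  have "regular_points \<noteq> {}"
  proof -
    have "ball 0 1 \<inter> regular_values \<noteq> {}"
      by (rule regular_values_dense) auto
    then obtain w where w: "w \<in> regular_values"
      by blast
    then have "fibre w \<noteq> {}"
      using infinite_fibre[of w] by (auto simp: regular_values_def)
    then show ?thesis
      using fibre_regular[OF w] by blast
  qed
  then obtain z0 where z0: "z0 \<in> regular_points"
    by blast
  define \<alpha> where "\<alpha> = com.kern z0 z0"
  have \<alpha>: "com.kern z z = \<alpha>" if "z \<in> regular_points" for z
    unfolding \<alpha>_def
    by (rule ker.c_constant[OF connected_regular_points continuous_on_id continuous_on_id _ that z0])
      (simp add: regular_points_def)
  have "T f = \<alpha> *\<^sub>C f" for f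
  proof (rule bergman_eqI)
    fix z assume z: "z \<in> \<bbbD>"
    have eq: "Rep_bergman (T f) y = \<alpha> * Rep_bergman f y" if "y \<in> regular_points" for y
      using diag[OF that] \<alpha>[OF that] by simp
    have hol: "(\<lambda>y. \<alpha> * Rep_bergman f y) holomorphic_on \<bbbD>"
      by (intro holomorphic_intros Rep_bergman_holomorphic)
    have "Rep_bergman (T f) z = \<alpha> * Rep_bergman f z"
      by (rule analytic_continuation_open[OF open_regular_points open_ball _ connected_ball _
            Rep_bergman_holomorphic hol eq z]) (use z0 in \<open>auto simp: regular_points_def\<close>)
    then show "Rep_bergman (T f) z = Rep_bergman (\<alpha> *\<^sub>C f) z"
      by (simp add: scaleC.rep_eq)
  qed
  then show ?thesis
    by blast
qed

section \<open>Scalars and projections in the commutant\<close>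

lemma scalar_in_commutant:
  assumes B: "bounded_holomorphic B"
  shows "(\<lambda>f. \<alpha> *\<^sub>C f) \<in> \<V>\<^sup>* B"
proof -
  have "mult_op B (\<alpha> *\<^sub>C f) = \<alpha> *\<^sub>C mult_op B f" for f
    using bounded_operator_mult_op[OF B] by (simp add: bounded_operator_def)
  then show ?thesis
    using bounded_operator_scaleC[of \<alpha>] cadjoint_scaleC[OF bounded_operator_mult_op[OF B]]
    by (auto simp: von_Neumann_algebra_def fun_eq_iff)
qed

text \<open>Riesz representation on \<open>M\<close> yields the orthogonal projection, characterized
  by \<open>P y\<close> lying in \<open>M\<close> and having the same inner products with
  \<open>M\<close> as \<open>y\<close>. From this characterization follow linearity and, as
  \<open>M\<close> is invariant under both operators, commutation with both.\<close>

lemma reducing_projection: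
  assumes B: "bounded_holomorphic B" and M: "reducing (mult_op B) M"
  obtains P where "P \<in> \<V>\<^sup>* B" "\<And>y. P y \<in> M" "\<And>y. y \<in> M \<Longrightarrow> P y = y"
proof -
  have sub: "bergman.subspace M" "closed M"
    and inv: "\<And>x. x \<in> M \<Longrightarrow> mult_op B x \<in> M" "\<And>x. x \<in> M \<Longrightarrow> cadjoint (mult_op B) x \<in> M"
    using M by (auto simp: reducing_def)
  note MB = bounded_operator_mult_op[OF B]
  have rsub: "subspace M"
    using sub(1) unfolding subspace_def bergman.subspace_def by (auto simp: scaleR_bergman_def)
  have scale: "\<alpha> *\<^sub>C x \<in> M" if "x \<in> M" for \<alpha> x
    using sub(1) that by (rule bergman.subspace_scale)
  have "\<exists>m\<in>M. \<forall>x\<in>M. cinner x m = cinner x y" for y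
  proof -
    obtain m where m: "m \<in> M" "\<And>x. x \<in> M \<Longrightarrow> y \<bullet> x = m \<bullet> x"
      using riesz_representation_subspace[OF rsub sub(2) bounded_linear_inner_right[of y]] by blast
    have "cinner x m = cinner x y" if "x \<in> M" for x
      using m(2)[OF that] m(2)[OF scale[OF that, of \<i>]]
      by (simp add: complex_eq_iff Re_cinner Im_cinner inner_commute)
    with m(1) show ?thesis
      by blast
  qed
  then obtain P where P: "\<And>y. P y \<in> M" "\<And>x y. x \<in> M \<Longrightarrow> cinner x (P y) = cinner x y"
    by metis
  have P_eq: "P y = m" if m: "m \<in> M" "\<And>x. x \<in> M \<Longrightarrow> cinner x m = cinner x y" for y m
  proof -
    have "P y - m \<in> M"
      using P(1) m(1) rsub by (rule_tac subspace_diff)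
    then have "cinner (P y - m) (P y - m) = 0"
      using P(2) m(2) by (simp add: cinner_diff_right)
    then show ?thesis
      using cinner_self_eq_0 by fastforce
  qed
  have lin: "P (\<alpha> *\<^sub>C y) = \<alpha> *\<^sub>C P y" for \<alpha> y
    by (rule P_eq) (simp_all add: scale P cinner_scaleC_right)
  have add: "P (x + y) = P x + P y" for x y
    by (rule P_eq) (simp_all add: subspace_add[OF rsub] P cinner_add_right)
  have bound: "norm (P y) \<le> norm y * 1" for y
  proof -
    have "cinner (P y) (P y) = cinner (P y) y"
      by (rule P(2)[OF P(1)])
    then have "P y \<bullet> P y = P y \<bullet> y"
      by (simp flip: Re_cinner)
    then have "norm (P y) * norm (P y) \<le> norm (P y) * norm y"
      using norm_cauchy_schwarz[of "P y" y] by (simp add: dot_square_norm power2_eq_square)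
    then show ?thesis
      by (cases "P y = 0") auto
  qed
  have "bounded_operator P"
    unfolding bounded_operator_def
    by (intro conjI bounded_linear_intro[OF add _ bound]) (simp_all add: scaleR_bergman_def lin)
  \<comment> \<open>The operator moves to the other side of the inner product as its adjoint, which
    keeps the test vector in \<open>M\<close>.\<close>
  moreover have "P (mult_op B y) = mult_op B (P y)" for y
    by (rule P_eq) (simp_all add: inv P cadjoint_right[OF MB])
  moreover have "P (cadjoint (mult_op B) y) = cadjoint (mult_op B) (P y)" for y
    by (rule P_eq) (simp_all add: inv P cadjoint[OF MB, symmetric])
  ultimately have "P \<in> \<V>\<^sup>* B"
    by (simp add: von_Neumann_algebra_def fun_eq_iff)
  then show ?thesis
    by (rule that) (simp_all add: P P_eq)
qed

theorem theorem4p1: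
  fixes B :: "complex \<Rightarrow> complex" and F :: "complex set"
  assumes "thin_blaschke_product B"
    and "finite F" and "F \<subseteq> critical_points B"
    and "inj_on B (critical_points B - F)"
    and "\<forall>z \<in> critical_points B - F. zorder (deriv B) z = 1"
  shows "(\<nexists>M. reducing (mult_op B) M \<and> nontrivial M) \<and>
    \<V>\<^sup>* B = {(\<lambda>f. c *\<^sub>C f) | c. True}"
proof
  interpret sheeted B
    by (rule thin_blaschke_product_sheeted[OF assms(1)])
  have B: "bounded_holomorphic B"
    unfolding bounded_holomorphic_def bounded_iff using B_holomorphic B_less_1 less_imp_le by blast
  have scalar: "\<exists>\<alpha>. T = (\<lambda>f. \<alpha> *\<^sub>C f)" if "T \<in> \<V>\<^sup>* B" for T
    by (rule commutant_scalar[OF assms that])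
  show "\<V>\<^sup>* B = {(\<lambda>f. c *\<^sub>C f) | c. True}"
    using scalar scalar_in_commutant[OF B] by blast
  show "\<nexists>M. reducing (mult_op B) M \<and> nontrivial M"
  proof
    assume "\<exists>M. reducing (mult_op B) M \<and> nontrivial M"
    then obtain M where M: "reducing (mult_op B) M" "M \<noteq> {0}" "M \<noteq> UNIV"
      by (auto simp: nontrivial_def)
    obtain P where P: "P \<in> \<V>\<^sup>* B" "\<And>y. P y \<in> M" "\<And>y. y \<in> M \<Longrightarrow> P y = y"
      using reducing_projection[OF B M(1)] by blast
    obtain \<alpha> where \<alpha>: "P = (\<lambda>f. \<alpha> *\<^sub>C f)"
      using scalar[OF P(1)] by blast
    have "0 \<in> M"
      using M(1) bergman.subspace_0 by (auto simp: reducing_def)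
    then obtain m where m: "m \<in> M" "m \<noteq> 0"
      using M(2) by blast
    \<comment> \<open>A scalar fixing a nonzero vector is 1, so the projection is the identity and
      \<open>M\<close> is the whole space.\<close>
    have "\<alpha> *\<^sub>C m = 1 *\<^sub>C m"
      using P(3)[OF m(1)] \<alpha> by simp
    then have "\<alpha> = 1"
      using m(2) by (simp only: bergman.scale_cancel_right) simp
    then have "y \<in> M" for y
      using P(2)[of y] \<alpha> by simp
    with M(3) show False
      by blast
  qed
qed

end
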